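(* If the set $\mathbf{S}=\{K\in[\omega]^\omega : \mathbf{PH}^K\neq\mathbf{PSPACE}^K\}$ is Ramsey positive, then $\mathbf{PSPACE}\not\subseteq\mathbf{PH}$.
   Context: Binary strings are identified with natural numbers via a fixed effective enumeration of $\{0,1\}^{<\omega}$, so that infinite oracles are identified with elements of $[\omega]^\omega$, the set of infinite subsets of $\omega$. $\mathbf{PH}^K$ and $\mathbf{PSPACE}^K$ are the relativized polynomial hierarchy and relativized polynomial space. The Ellentuck topology on $[\omega]^\omega$ has basic open sets $[a,A]=\{S\in[\omega]^\omega : S\cap(\max a+1)=a,\ S\setminus a\subseteq A\}$ for finite $a$ and infinite $A$ with $\min A>\max a$. A set is Ramsey small if it is meager in the Ellentuck topology, and Ramsey positive if it is not Ramsey small. *)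

theory Defs
  imports "HOL-Analysis.Function_Topology" "HOL-Computational_Algebra.Polynomial"
begin

section \<open>Binary strings\<close>

type_synonym word = "bool list"
type_synonym lang = "word set"

text \<open>
  Bijective base-2 numeration, least significant digit first, with digit 1 for \<^term>\<open>False\<close>
  and digit 2 for \<^term>\<open>True\<close>.  The induced enumeration of the binary strings lists shorter
  strings before longer ones.  Under it, a set of natural numbers is an oracle.
\<close>

fun nat_of_word :: "word \<Rightarrow> nat" where
  "nat_of_word [] = 0"
| "nat_of_word (b # w) = (if b then 2 else 1) + 2 * nat_of_word w"

lemma bij_nat_of_word: "bij nat_of_word"
proof (rule bijI)
  show "inj nat_of_word"
  proof (rule injI)
    fix v w :: word
    assume "nat_of_word v = nat_of_word w"
    then show "v = w"
    proof (induction v arbitrary: w)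
      case Nil
      then show ?case by (cases w) (auto split: if_splits)
    next
      case (Cons b v)
      show ?case
      proof (cases w)
        case Nil
        then show ?thesis using Cons.prems by (auto split: if_splits)
      next
        case w: (Cons c u)
        have *: "(if b then 2 else 1) + 2 * nat_of_word v =
                 (if c then 2 else 1) + 2 * nat_of_word u"
          using Cons.prems by (simp only: w nat_of_word.simps)
        have "b = c"
          using * by (cases b; cases c) (simp; presburger)+
        moreover from this * have "nat_of_word v = nat_of_word u" by simp
        ultimately show ?thesis using Cons.IH w by simp
      qed
    qed
  qed
next
  have "\<exists>w. nat_of_word w = n" for n
  proof (induction n rule: less_induct)
    case (less n)
    show ?case
    proof (cases "n = 0")
      case True
      then show ?thesis by (metis nat_of_word.simps(1))
    next
      case False
      then have "(n - 1) div 2 < n" by simp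
      from less.IH[OF this] obtain w where w: "nat_of_word w = (n - 1) div 2" by blast
      have "nat_of_word (even n # w) = n"
        using False by (cases "even n") (simp_all add: w, presburger+)
      then show ?thesis by blast
    qed
  qed
  then show "surj nat_of_word" by (metis surjI)
qed

text \<open>Pairing of strings: the bits of the first component are doubled, \<open>01\<close> is a separator.\<close>

definition pair :: "word \<Rightarrow> word \<Rightarrow> word" where
  "pair x y = concat (map (\<lambda>b. [b, b]) x) @ [False, True] @ y"

section \<open>Oracle Turing machines\<close>

text \<open>
  Deterministic multi-tape machines.  Tapes are infinite in both directions, with cells indexed by
  the integers; a tape is given by its contents and its head position.  States and tape symbols
  are natural numbers below \<open>states\<close> and \<open>symbols\<close>; symbol 0 is the blank, symbols 1 and 2 are the
  bits 0 and 1.  Tape 0 carries the input and tape 1 is the query tape; both are ordinary read-write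
  tapes.

  A state \<open>q\<close> with \<open>query M q = Some (y, n)\<close> is a query state: in one step the machine moves to
  state \<open>y\<close> or \<open>n\<close> according to the oracle's answer, leaving all tapes as they are.  In any other
  non-halting state, \<open>trans M\<close> maps the state and the list of scanned symbols to the new state and,
  for each tape, the symbol to write and the head movement.
\<close>

type_synonym tape = "(int \<Rightarrow> nat) \<times> int"
type_synonym config = "nat \<times> tape list"

record machine =
  states :: nat
  symbols :: nat
  tapes :: nat
  start :: nat
  accept :: nat
  reject :: nat
  query :: "nat \<Rightarrow> (nat \<times> nat) option"
  trans :: "nat \<Rightarrow> nat list \<Rightarrow> nat \<times> (nat \<times> int) list"

definition oracle_tm :: "machine \<Rightarrow> bool" where
  "oracle_tm M \<longleftrightarrow>
     symbols M \<ge> 3 \<and> tapes M \<ge> 2 \<and>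
     start M < states M \<and> accept M < states M \<and> reject M < states M \<and> accept M \<noteq> reject M \<and>
     (\<forall>q < states M. \<forall>y n. query M q = Some (y, n) \<longrightarrow> y < states M \<and> n < states M) \<and>
     (\<forall>q < states M. \<forall>ss. length ss = tapes M \<and> (\<forall>s \<in> set ss. s < symbols M) \<longrightarrow>
        fst (trans M q ss) < states M \<and>
        length (snd (trans M q ss)) = tapes M \<and>
        (\<forall>(s, d) \<in> set (snd (trans M q ss)). s < symbols M \<and> d \<in> {-1, 0, 1}))"

text \<open>Turing machines without oracle: no state is a query state.\<close>

definition plain_tm :: "machine \<Rightarrow> bool" where
  "plain_tm M \<longleftrightarrow> oracle_tm M \<and> (\<forall>q. query M q = None)"

definition input_tape :: "word \<Rightarrow> tape" where
  "input_tape x =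
     (\<lambda>i. if 0 \<le> i \<and> i < int (length x) then (if x ! nat i then 2 else 1) else 0, 0)"

definition blank_tape :: tape where
  "blank_tape = (\<lambda>_. 0, 0)"

definition init :: "machine \<Rightarrow> word \<Rightarrow> config" where
  "init M x = (start M, input_tape x # replicate (tapes M - 1) blank_tape)"

text \<open>
  The string written on the query tape extends from cell 0 to the first cell that does not hold a
  bit.  Such a cell exists in every reachable configuration, as only finitely many cells are
  non-blank.
\<close>

definition query_word :: "(int \<Rightarrow> nat) \<Rightarrow> word" where
  "query_word c = map (\<lambda>i. c (int i) = 2) [0..<(LEAST n. c (int n) \<notin> {1, 2})]"

definition act :: "nat \<times> int \<Rightarrow> tape \<Rightarrow> tape" where
  "act = (\<lambda>(s, d) (c, h). (c(h := s), h + d))"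

definition step :: "machine \<Rightarrow> nat set \<Rightarrow> config \<Rightarrow> config" where
  "step M K = (\<lambda>(q, ts).
     if q = accept M \<or> q = reject M then (q, ts)
     else case query M q of
       Some (y, n) \<Rightarrow> (if nat_of_word (query_word (fst (ts ! 1))) \<in> K then y else n, ts)
     | None \<Rightarrow> (let (q', as) = trans M q (map (\<lambda>(c, h). c h) ts) in (q', map2 act as ts)))"

definition run :: "machine \<Rightarrow> nat set \<Rightarrow> word \<Rightarrow> nat \<Rightarrow> config" where
  "run M K x t = (step M K ^^ t) (init M x)"

definition verdict :: "machine \<Rightarrow> lang \<Rightarrow> word \<Rightarrow> nat" where
  "verdict M L x = (if x \<in> L then accept M else reject M)"

definition decides_in_time :: "machine \<Rightarrow> nat set \<Rightarrow> lang \<Rightarrow> (nat \<Rightarrow> nat) \<Rightarrow> bool" where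
  "decides_in_time M K L T \<longleftrightarrow>
     (\<forall>x. \<exists>t \<le> T (length x). fst (run M K x t) = verdict M L x)"

text \<open>
  All tapes, including the query tape, are subject to the space bound.  Heads start at cell 0, so
  up to a constant factor space is the maximal distance of a head from cell 0.
\<close>

definition decides_in_space :: "machine \<Rightarrow> nat set \<Rightarrow> lang \<Rightarrow> (nat \<Rightarrow> nat) \<Rightarrow> bool" where
  "decides_in_space M K L s \<longleftrightarrow>
     (\<forall>x. (\<exists>t. fst (run M K x t) = verdict M L x) \<and>
          (\<forall>t. \<forall>(c, h) \<in> set (snd (run M K x t)). \<bar>h\<bar> \<le> int (s (length x))))"

section \<open>Complexity classes\<close>

definition P_rel :: "nat set \<Rightarrow> lang set" where
  "P_rel K = {L. \<exists>M p. oracle_tm M \<and> decides_in_time M K L (poly p)}"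

definition PSPACE_rel :: "nat set \<Rightarrow> lang set" where
  "PSPACE_rel K = {L. \<exists>M p. oracle_tm M \<and> decides_in_space M K L (poly p)}"

text \<open>For oracle-free machines the oracle argument \<^term>\<open>{} :: nat set\<close> is never consulted.\<close>

definition PTIME :: "lang set" where
  "PTIME = {L. \<exists>M p. plain_tm M \<and> decides_in_time M {} L (poly p)}"

definition PSPACE :: "lang set" where
  "PSPACE = {L. \<exists>M p. plain_tm M \<and> decides_in_space M {} L (poly p)}"

text \<open>
  The levels \<open>\<Sigma>\<^sub>k\<close> over a class \<open>C\<close> of deterministic polynomial time: a language is in \<open>\<Sigma>\<^sub>k\<^sub>+\<^sub>1\<close> iff it
  arises from a language in \<open>\<Pi>\<^sub>k\<close> (a complement of a \<open>\<Sigma>\<^sub>k\<close> language) by a polynomially bounded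
  existential quantifier.
\<close>

fun Sigma_level :: "lang set \<Rightarrow> nat \<Rightarrow> lang set" where
  "Sigma_level C 0 = C"
| "Sigma_level C (Suc k) =
     {L. \<exists>p. \<exists>R \<in> uminus ` Sigma_level C k.
           \<forall>x. x \<in> L \<longleftrightarrow> (\<exists>y. length y \<le> poly p (length x) \<and> pair x y \<in> R)}"

definition PH_rel :: "nat set \<Rightarrow> lang set" where
  "PH_rel K = (\<Union>k. Sigma_level (P_rel K) k)"

definition PH :: "lang set" where
  "PH = (\<Union>k. Sigma_level PTIME k)"

section \<open>The Ellentuck topology\<close>

text \<open>\<open>max a + 1\<close>, read as 0 for empty \<open>a\<close>.\<close>

definition stem_end :: "nat set \<Rightarrow> nat" where
  "stem_end a = (if a = {} then 0 else Max a + 1)"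

definition ellentuck_basic :: "nat set \<Rightarrow> nat set \<Rightarrow> nat set set" where
  "ellentuck_basic a A = {S. infinite S \<and> S \<inter> {..<stem_end a} = a \<and> S - a \<subseteq> A}"

definition ellentuck :: "nat set topology" where
  "ellentuck = topology_generated_by
     {ellentuck_basic a A |a A. finite a \<and> infinite A \<and> (\<forall>i \<in> A. stem_end a \<le> i)}"

lemma topspace_ellentuck: "topspace ellentuck = {S. infinite S}"
proof
  show "topspace ellentuck \<subseteq> {S. infinite S}"
    by (auto simp: ellentuck_def ellentuck_basic_def)
  have "ellentuck_basic {} UNIV = {S. infinite S}"
    by (simp add: ellentuck_basic_def stem_end_def)
  moreover have "\<forall>i \<in> UNIV. stem_end {} \<le> i"
    by (simp add: stem_end_def)
  ultimately show "{S. infinite S} \<subseteq> topspace ellentuck"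
    unfolding ellentuck_def topology_generated_by_topspace
    by (intro Union_upper CollectI exI[of _ "{}"] exI[of _ UNIV]) simp
qed

definition nowhere_dense_in :: "'a topology \<Rightarrow> 'a set \<Rightarrow> bool" where
  "nowhere_dense_in X N \<longleftrightarrow> N \<subseteq> topspace X \<and> X interior_of (X closure_of N) = {}"

definition meager_in :: "'a topology \<Rightarrow> 'a set \<Rightarrow> bool" where
  "meager_in X S \<longleftrightarrow> (\<exists>F. countable F \<and> (\<forall>N \<in> F. nowhere_dense_in X N) \<and> S = \<Union>F)"

definition ramsey_small :: "nat set set \<Rightarrow> bool" where
  "ramsey_small S \<longleftrightarrow> meager_in ellentuck S"

definition ramsey_positive :: "nat set set \<Rightarrow> bool" where
  "ramsey_positive S \<longleftrightarrow> \<not> ramsey_small S"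

end

theory Submission
  imports Defs
begin

text \<open>
  Call \<open>K\<close> sparse if it has at most \<open>N + O(1)\<close> elements below \<open>2\<^sup>N\<close>.  Every infinite set has a sparse
  infinite subset, so the infinite sets that are not sparse are nowhere dense in the Ellentuck
  topology.  It therefore suffices that \<open>PSPACE \<subseteq> PH\<close> implies \<open>PH\<^sup>K = PSPACE\<^sup>K\<close> for sparse \<open>K\<close>.  The
  inclusion of \<open>PH\<^sup>K\<close> in \<open>PSPACE\<^sup>K\<close> relativizes.  Conversely, on an input \<open>x\<close> a machine with
  polynomial space can only query words of polynomial length, and those in \<open>K\<close> fit into a list \<open>l\<close> of
  polynomial length.  Running the machine with \<open>l\<close> as oracle is a task for \<open>PSPACE\<close>, hence for \<open>PH\<close>; to
  guess \<open>l\<close> and to verify that it agrees with \<open>K\<close> on all short words costs two more quantifiers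
  over a predicate that queries \<open>K\<close> once.

  To obtain the machines that this needs, programs built from sequencing, branching and loops are
  compiled to oracle machines; simulated machines keep their state on a tape.
\<close>

section \<open>Structured programs for multi-tape machines\<close>

text \<open>The obstacle is that \<open>PSPACE \<subseteq> PH\<close> speaks of oracle-free
  machines, so \<open>K\<close> may not enter the language that is moved into \<open>PH\<close>.
  Hence \<open>list_sim\<close> sees an oracle only as part of its input, and \<open>K\<close> comes
  back as a claim, a bit followed by a word, which is checked by one query in the polynomial-time
  predicate below all quantifiers. A word is in \<open>L\<close> iff some list survives every
  correct claim: a list that disagrees with \<open>K\<close> on a short word is refuted by the
  correct claim about this word. A guessed list may be wrong, and then the machine need not halt or
  keep to its space bound. The simulation therefore has a binary clock and unary rulers along the
  tapes, with sizes read off from padding that is guessed along with the list. An accepting run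
  found under a correct list is a true run, so short padding does no harm; long padding exceeds the
  logarithm of the number of configurations, which bounds the halting time. The form of sparseness
  fits the coding of words: those of length at most \<open>b\<close> are numbers below
  \<open>2 ^ (b + 1)\<close>, so that linearly many of them belong to \<open>K\<close>.\<close>

type_synonym store = "nat \<Rightarrow> tape"

definition scan :: "store \<Rightarrow> nat \<Rightarrow> nat" where
  "scan \<sigma> i = fst (\<sigma> i) (snd (\<sigma> i))"

datatype prog =
    Act "(nat \<Rightarrow> nat) \<Rightarrow> nat \<Rightarrow> nat \<times> int"
  | Seq prog prog
  | Cond "(nat \<Rightarrow> nat) \<Rightarrow> bool" prog prog
  | Loop "(nat \<Rightarrow> nat) \<Rightarrow> bool" prog
  | Ask prog prog

definition heads_le :: "nat \<Rightarrow> store \<Rightarrow> bool" where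
  "heads_le B \<sigma> \<longleftrightarrow> (\<forall>i. \<bar>snd (\<sigma> i)\<bar> \<le> int B)"

definition answer :: "nat set \<Rightarrow> store \<Rightarrow> bool" where
  "answer K \<sigma> \<longleftrightarrow> nat_of_word (query_word (fst (\<sigma> 1))) \<in> K"

text \<open>
  The number in \<open>exec K B p \<sigma> t \<sigma>'\<close> is only an upper bound on the running time of the compiled
  program; all head positions on the way are at most \<open>B\<close> in absolute value.
\<close>

inductive exec :: "nat set \<Rightarrow> nat \<Rightarrow> prog \<Rightarrow> store \<Rightarrow> nat \<Rightarrow> store \<Rightarrow> bool" for K B where
  Act: "\<sigma>' = (\<lambda>i. act (f (scan \<sigma>) i) (\<sigma> i)) \<Longrightarrow> heads_le B \<sigma>' \<Longrightarrow> exec K B (Act f) \<sigma> 1 \<sigma>'"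
| Seq: "exec K B p \<sigma> t \<sigma>' \<Longrightarrow> exec K B q \<sigma>' u \<sigma>'' \<Longrightarrow> exec K B (Seq p q) \<sigma> (t + u) \<sigma>''"
| CondT: "c (scan \<sigma>) \<Longrightarrow> exec K B p \<sigma> t \<sigma>' \<Longrightarrow> exec K B (Cond c p q) \<sigma> (t + 2) \<sigma>'"
| CondF: "\<not> c (scan \<sigma>) \<Longrightarrow> exec K B q \<sigma> t \<sigma>' \<Longrightarrow> exec K B (Cond c p q) \<sigma> (t + 2) \<sigma>'"
| LoopF: "\<not> c (scan \<sigma>) \<Longrightarrow> exec K B (Loop c p) \<sigma> 1 \<sigma>"
| LoopT: "c (scan \<sigma>) \<Longrightarrow> exec K B p \<sigma> t \<sigma>' \<Longrightarrow> exec K B (Loop c p) \<sigma>' u \<sigma>''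
    \<Longrightarrow> exec K B (Loop c p) \<sigma> (t + u + 2) \<sigma>''"
| AskT: "answer K \<sigma> \<Longrightarrow> exec K B p \<sigma> t \<sigma>' \<Longrightarrow> exec K B (Ask p q) \<sigma> (t + 2) \<sigma>'"
| AskF: "\<not> answer K \<sigma> \<Longrightarrow> exec K B q \<sigma> t \<sigma>' \<Longrightarrow> exec K B (Ask p q) \<sigma> (t + 2) \<sigma>'"
| weaken: "exec K B p \<sigma> t \<sigma>' \<Longrightarrow> t \<le> u \<Longrightarrow> exec K B p \<sigma> u \<sigma>'"

lemma exec_heads_le: "exec K B p \<sigma> t \<sigma>' \<Longrightarrow> heads_le B \<sigma> \<Longrightarrow> heads_le B \<sigma>'"
  by (induction rule: exec.induct) auto

subsection \<open>Compilation\<close>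

datatype instr =
    IAct "(nat \<Rightarrow> nat) \<Rightarrow> nat \<Rightarrow> nat \<times> int"
  | IBranch "(nat \<Rightarrow> nat) \<Rightarrow> bool" nat nat
  | IAsk nat nat

fun plen :: "prog \<Rightarrow> nat" where
  "plen (Act f) = 1"
| "plen (Seq p q) = plen p + plen q"
| "plen (Cond c p q) = plen p + plen q + 2"
| "plen (Loop c p) = plen p + 2"
| "plen (Ask p q) = plen p + plen q + 2"

text \<open>Addresses are absolute: \<open>a\<close> is the place of the first instruction in the
  whole code. A branch on \<open>\<lambda>_. True\<close> is an unconditional jump, and its second
  target \<open>0\<close> is a dummy. Every block is left through the address just behind it, so
  blocks can be concatenated.\<close>

fun compile :: "nat \<Rightarrow> prog \<Rightarrow> instr list" where
  "compile a (Act f) = [IAct f]"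
| "compile a (Seq p q) = compile a p @ compile (a + plen p) q"
| "compile a (Cond c p q) =
     IBranch c (a + 1) (a + plen p + 2) # compile (a + 1) p @
     IBranch (\<lambda>_. True) (a + plen p + plen q + 2) 0 # compile (a + plen p + 2) q"
| "compile a (Loop c p) =
     IBranch c (a + 1) (a + plen p + 2) # compile (a + 1) p @ [IBranch (\<lambda>_. True) a 0]"
| "compile a (Ask p q) =
     IAsk (a + 1) (a + plen p + 2) # compile (a + 1) p @
     IBranch (\<lambda>_. True) (a + plen p + plen q + 2) 0 # compile (a + plen p + 2) q"

lemma length_compile [simp]: "length (compile a p) = plen p"
  by (induction p arbitrary: a) auto

text \<open>\<open>S\<close> bounds the alphabet and \<open>T\<close> the tapes. Stores have
  infinitely many tapes; the clause on \<open>T \<le> i\<close> makes every action the identity from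
  tape \<open>T\<close> on, so that a machine with \<open>T\<close> tapes can carry it out.\<close>

fun wf_prog :: "nat \<Rightarrow> nat \<Rightarrow> prog \<Rightarrow> bool" where
  "wf_prog S T (Act f) \<longleftrightarrow>
     (\<forall>s. (\<forall>i. s i < S) \<longrightarrow> (\<forall>i. fst (f s i) < S \<and> snd (f s i) \<in> {-1, 0, 1})) \<and>
     (\<forall>s i. T \<le> i \<longrightarrow> f s i = (s i, 0))"
| "wf_prog S T (Seq p q) \<longleftrightarrow> wf_prog S T p \<and> wf_prog S T q"
| "wf_prog S T (Cond c p q) \<longleftrightarrow> wf_prog S T p \<and> wf_prog S T q"
| "wf_prog S T (Loop c p) \<longleftrightarrow> wf_prog S T p"
| "wf_prog S T (Ask p q) \<longleftrightarrow> wf_prog S T p \<and> wf_prog S T q"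

fun ask_free :: "prog \<Rightarrow> bool" where
  "ask_free (Act f) \<longleftrightarrow> True"
| "ask_free (Seq p q) \<longleftrightarrow> ask_free p \<and> ask_free q"
| "ask_free (Cond c p q) \<longleftrightarrow> ask_free p \<and> ask_free q"
| "ask_free (Loop c p) \<longleftrightarrow> ask_free p"
| "ask_free (Ask p q) \<longleftrightarrow> False"

fun wf_instr :: "nat \<Rightarrow> nat \<Rightarrow> nat \<Rightarrow> instr \<Rightarrow> bool" where
  "wf_instr S T n (IAct f) \<longleftrightarrow> wf_prog S T (Act f)"
| "wf_instr S T n (IBranch c y z) \<longleftrightarrow> y \<le> n \<and> z \<le> n"
| "wf_instr S T n (IAsk y z) \<longleftrightarrow> y \<le> n \<and> z \<le> n"

lemma wf_compile:
  "wf_prog S T p \<Longrightarrow> a + plen p \<le> n \<Longrightarrow> i \<in> set (compile a p) \<Longrightarrow> wf_instr S T n i"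
proof (induction p arbitrary: a)
  case (Act f)
  then show ?case by (auto simp del: wf_prog.simps(1))
next
  case (Seq p q)
  then show ?case using Seq.IH(1)[of a] Seq.IH(2)[of "a + plen p"] by auto
next
  case (Cond c p q)
  then show ?case using Cond.IH(1)[of "a + 1"] Cond.IH(2)[of "a + plen p + 2"] by auto
next
  case (Loop c p)
  then show ?case using Loop.IH[of "a + 1"] by auto
next
  case (Ask p q)
  then show ?case using Ask.IH(1)[of "a + 1"] Ask.IH(2)[of "a + plen p + 2"] by auto
qed

lemma ask_free_compile: "ask_free p \<Longrightarrow> IAsk y n \<notin> set (compile a p)"
  by (induction p arbitrary: a) auto

section \<open>The machine of a compiled program\<close>

definition pad_scan :: "nat \<Rightarrow> nat list \<Rightarrow> nat \<Rightarrow> nat" where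
  "pad_scan T ss i = (if i < T then ss ! i else 0)"

definition code_of :: "prog \<Rightarrow> ((nat \<Rightarrow> nat) \<Rightarrow> bool) \<Rightarrow> instr list" where
  "code_of p c = compile 0 p @ [IBranch c (plen p + 1) (plen p + 2)]"

text \<open>States are code addresses, followed by the two halting states; at address
  \<open>plen p\<close> the final test \<open>c\<close> chooses between these. The values of
  \<open>trans\<close> at halting and at query states are never executed and exist because
  \<open>oracle_tm\<close> restricts \<open>trans\<close> at all states.\<close>

definition machine_of :: "nat \<Rightarrow> nat \<Rightarrow> prog \<Rightarrow> ((nat \<Rightarrow> nat) \<Rightarrow> bool) \<Rightarrow> machine" where
  "machine_of S T p c = \<lparr>
     states = plen p + 3, symbols = S, tapes = T, start = 0,
     accept = plen p + 1, reject = plen p + 2,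
     query = (\<lambda>q. if q \<le> plen p then
        (case code_of p c ! q of IAsk y n \<Rightarrow> Some (y, n) | _ \<Rightarrow> None) else None),
     trans = (\<lambda>q ss. case (if q \<le> plen p then code_of p c ! q else IBranch c 0 0) of
        IAct f \<Rightarrow> (q + 1, map (f (pad_scan T ss)) [0..<T])
      | IBranch c y n \<Rightarrow> (if c (pad_scan T ss) then y else n, map (\<lambda>i. (ss ! i, 0)) [0..<T])
      | IAsk y n \<Rightarrow> (0, map (\<lambda>i. (ss ! i, 0)) [0..<T]))\<rparr>"

lemma length_code_of [simp]: "length (code_of p c) = plen p + 1"
  by (simp add: code_of_def)

lemma oracle_tm_machine_of:
  assumes wf: "wf_prog S T p" and S: "3 \<le> S" and T: "2 \<le> T"
  shows "oracle_tm (machine_of S T p c)"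
proof -
  have code: "wf_instr S T (plen p + 2) i" if "i \<in> set (code_of p c)" for i
    using that wf_compile[OF wf, of 0 "plen p + 2"] by (auto simp: code_of_def)
  have nth: "wf_instr S T (plen p + 2) (code_of p c ! q)" if "q \<le> plen p" for q
    using that by (intro code nth_mem) simp
  show ?thesis
    unfolding oracle_tm_def
  proof (intro conjI allI impI)
    fix q y n assume "query (machine_of S T p c) q = Some (y, n)"
    then have q: "q \<le> plen p" "code_of p c ! q = IAsk y n"
      by (auto simp: machine_of_def split: if_splits instr.splits)
    with nth[OF q(1)]
    show "y < states (machine_of S T p c)" "n < states (machine_of S T p c)"
      by (auto simp: machine_of_def)
  next
    fix q ss
    assume q: "q < states (machine_of S T p c)"
      and ss: "length ss = tapes (machine_of S T p c) \<and> (\<forall>s\<in>set ss. s < symbols (machine_of S T p c))"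
    have ss': "length ss = T" "\<And>i. i < T \<Longrightarrow> ss ! i < S"
      using ss by (auto simp: machine_of_def)
    have pad: "pad_scan T ss i < S" for i
      using ss'(2)[of i] S by (auto simp: pad_scan_def)
    show "fst (trans (machine_of S T p c) q ss) < states (machine_of S T p c)"
      using nth[of q] q
      by (auto simp: machine_of_def split: instr.splits if_splits)
    show "length (snd (trans (machine_of S T p c) q ss)) = tapes (machine_of S T p c)"
      by (auto simp: machine_of_def split: instr.splits)
    show "\<forall>(s, d)\<in>set (snd (trans (machine_of S T p c) q ss)).
            s < symbols (machine_of S T p c) \<and> d \<in> {- 1, 0, 1}"
    proof (cases "q \<le> plen p")
      case True
      show ?thesis
      proof (cases "code_of p c ! q")
        case (IAct f)
        with nth[OF True] pad
        have "\<forall>i. fst (f (pad_scan T ss) i) < S \<and> snd (f (pad_scan T ss) i) \<in> {- 1, 0, 1}"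
          by simp
        then show ?thesis
          using True IAct by (auto simp: machine_of_def case_prod_beta)
      qed (use True ss' in \<open>auto simp: machine_of_def\<close>)
    qed (use ss' in \<open>auto simp: machine_of_def\<close>)
  qed (use S T in \<open>auto simp: machine_of_def\<close>)
qed

lemma plain_tm_machine_of:
  assumes "wf_prog S T p" "3 \<le> S" "2 \<le> T" "ask_free p"
  shows "plain_tm (machine_of S T p c)"
proof -
  have "IAsk y n \<notin> set (code_of p c)" for y n
    using ask_free_compile[OF assms(4)] by (auto simp: code_of_def)
  then have "code_of p c ! q \<noteq> IAsk y n" if "q \<le> plen p" for q y n
    using that by (metis length_code_of less_Suc_eq_le Suc_eq_plus1 nth_mem)
  then show ?thesis
    unfolding plain_tm_def using oracle_tm_machine_of[OF assms(1-3)]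
    by (auto simp: machine_of_def split: instr.splits)
qed

section \<open>Correctness of the compilation\<close>

definition bounded_tapes :: "nat \<Rightarrow> tape list \<Rightarrow> bool" where
  "bounded_tapes B ts \<longleftrightarrow> (\<forall>(c, h) \<in> set ts. \<bar>h\<bar> \<le> int B)"

text \<open>Heads are controlled at all intermediate times because \<open>decides_in_space\<close>
  restricts every configuration of a run.\<close>

definition path :: "machine \<Rightarrow> nat set \<Rightarrow> nat \<Rightarrow> config \<Rightarrow> nat \<Rightarrow> config \<Rightarrow> bool" where
  "path M K B cf t cf' \<longleftrightarrow> (step M K ^^ t) cf = cf' \<and>
     (\<forall>u\<le>t. bounded_tapes B (snd ((step M K ^^ u) cf)))"

lemma path_trans:
  assumes "path M K B a t b" "path M K B b u c"
  shows "path M K B a (t + u) c"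
proof -
  have *: "(step M K ^^ (t + v)) a = (step M K ^^ v) b" for v
    using assms(1) by (simp add: path_def add.commute[of t] funpow_add)
  show ?thesis
    unfolding path_def
  proof (intro conjI allI impI)
    show "(step M K ^^ (t + u)) a = c" using assms(2) by (simp add: * path_def)
    fix w assume w: "w \<le> t + u"
    show "bounded_tapes B (snd ((step M K ^^ w) a))"
    proof (cases "w \<le> t")
      case False
      then have "w = t + (w - t)" "w - t \<le> u" using w by auto
      then show ?thesis using assms(2) *[of "w - t"] by (simp add: path_def)
    qed (use assms(1) in \<open>auto simp: path_def\<close>)
  qed
qed

lemma path_step:
  "bounded_tapes B (snd a) \<Longrightarrow> step M K a = b \<Longrightarrow> bounded_tapes B (snd b) \<Longrightarrow> path M K B a 1 b"
  by (auto simp: path_def le_Suc_eq)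

definition tape_list :: "nat \<Rightarrow> store \<Rightarrow> tape list" where
  "tape_list T \<sigma> = map \<sigma> [0..<T]"

lemma bounded_tape_list: "heads_le B \<sigma> \<Longrightarrow> bounded_tapes B (tape_list T \<sigma>)"
  by (auto simp: bounded_tapes_def tape_list_def heads_le_def) (metis snd_conv)

text \<open>Preserved by programs with \<open>wf_prog S T\<close>. It makes the list of scanned
  symbols, extended by blanks in \<open>pad_scan\<close>, agree with the scan of the store.\<close>

definition blank_above :: "nat \<Rightarrow> store \<Rightarrow> bool" where
  "blank_above T \<sigma> \<longleftrightarrow> (\<forall>i\<ge>T. \<sigma> i = blank_tape)"

lemma pad_scan_tape_list:
  "blank_above T \<sigma> \<Longrightarrow> pad_scan T (map (\<lambda>(c, h). c h) (tape_list T \<sigma>)) = scan \<sigma>"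
  by (auto simp: pad_scan_def tape_list_def scan_def blank_above_def blank_tape_def case_prod_beta
      fun_eq_iff)

lemma act_scan: "act (scan \<sigma> i, 0) (\<sigma> i) = \<sigma> i"
  by (cases "\<sigma> i") (simp add: act_def scan_def)

locale compiled =
  fixes S T :: nat and p0 :: prog and c0 :: "(nat \<Rightarrow> nat) \<Rightarrow> bool" and K :: "nat set" and B :: nat
  assumes wf0: "wf_prog S T p0" and T2: "2 \<le> T"
begin

abbreviation "M \<equiv> machine_of S T p0 c0"
abbreviation "cfg_at q \<sigma> \<equiv> (q, tape_list T \<sigma>)"

lemma step_IAct:
  assumes "q \<le> plen p0" "code_of p0 c0 ! q = IAct f" "blank_above T \<sigma>"
  shows "step M K (cfg_at q \<sigma>) = cfg_at (q + 1) (\<lambda>i. act (f (scan \<sigma>) i) (\<sigma> i))"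
  using assms pad_scan_tape_list[OF assms(3)]
  by (auto simp: step_def machine_of_def tape_list_def intro!: nth_equalityI)

lemma step_IBranch:
  assumes "q \<le> plen p0" "code_of p0 c0 ! q = IBranch c y n" "blank_above T \<sigma>"
  shows "step M K (cfg_at q \<sigma>) = cfg_at (if c (scan \<sigma>) then y else n) \<sigma>"
  using assms pad_scan_tape_list[OF assms(3)] act_scan
  by (auto simp: step_def machine_of_def tape_list_def scan_def case_prod_beta intro!: nth_equalityI)

lemma step_IAsk:
  assumes "q \<le> plen p0" "code_of p0 c0 ! q = IAsk y n"
  shows "step M K (cfg_at q \<sigma>) = cfg_at (if answer K \<sigma> then y else n) \<sigma>"
  using assms T2
  by (auto simp: step_def machine_of_def tape_list_def answer_def)

text \<open>The machine belongs to the fixed program \<open>p0\<close>, while the induction in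
  \<open>exec_path\<close> descends to its parts; this predicate locates such a part in the
  code.\<close>

definition code_at :: "nat \<Rightarrow> prog \<Rightarrow> bool" where
  "code_at a p \<longleftrightarrow> a + plen p \<le> plen p0 \<and>
     (\<forall>j < plen p. code_of p0 c0 ! (a + j) = compile a p ! j)"

lemma code_at_whole: "code_at 0 p0"
  by (auto simp: code_at_def code_of_def nth_append)

lemma code_at_Seq:
  assumes "code_at a (Seq p q)"
  shows "code_at a p" "code_at (a + plen p) q"
proof -
  have 1: "code_of p0 c0 ! (a + j) = (compile a p @ compile (a + plen p) q) ! j"
    if "j < plen p + plen q" for j
    using assms that by (auto simp: code_at_def)
  show "code_at a p" unfolding code_at_def
    using assms 1 by (auto simp: code_at_def nth_append)
  show "code_at (a + plen p) q" unfolding code_at_def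
    using assms 1[of "plen p + _"] by (auto simp: code_at_def nth_append add.assoc)
qed

text \<open>The common shape of conditionals, queries and loops: one instruction \<open>i\<close>, a
  block, and a rest \<open>r\<close>, which in all uses starts with a jump.\<close>

lemma code_at_nested:
  assumes "a + n + plen p + 1 \<le> plen p0"
    and "\<And>j. j < plen p + n + 1 \<Longrightarrow> code_of p0 c0 ! (a + j) = (i # compile (a + 1) p @ r) ! j"
    and "length r = n"
  shows "code_at (a + 1) p" "code_of p0 c0 ! a = i"
    "\<And>j. j < n \<Longrightarrow> code_of p0 c0 ! (a + plen p + 1 + j) = r ! j"
proof -
  show "code_at (a + 1) p" unfolding code_at_def
  proof (intro conjI allI impI)
    fix j assume "j < plen p"
    then show "code_of p0 c0 ! (a + 1 + j) = compile (a + 1) p ! j"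
      using assms(2)[of "Suc j"] by (simp add: nth_append)
  qed (use assms(1) in simp)
  show "code_of p0 c0 ! a = i" using assms(2)[of 0] by simp
  fix j assume "j < n"
  then show "code_of p0 c0 ! (a + plen p + 1 + j) = r ! j"
    using assms(2)[of "Suc (plen p + j)"] by (simp add: nth_append add.assoc)
qed

lemma code_at_two_branches:
  assumes "a + plen p + plen q + 2 \<le> plen p0"
    and "\<And>j. j < plen p + plen q + 2 \<Longrightarrow> code_of p0 c0 ! (a + j) =
       (i # compile (a + 1) p @
     IBranch (\<lambda>_. True) (a + plen p + plen q + 2) 0 # compile (a + plen p + 2) q) ! j"
  shows "code_at (a + 1) p" "code_at (a + plen p + 2) q" "code_of p0 c0 ! a = i"
    "code_of p0 c0 ! (a + plen p + 1) = IBranch (\<lambda>_. True) (a + plen p + plen q + 2) 0"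
proof -
  note * = code_at_nested[of a "plen q + 1" p i
      "IBranch (\<lambda>_. True) (a + plen p + plen q + 2) 0 # compile (a + plen p + 2) q"]
  show "code_at (a + 1) p" "code_of p0 c0 ! a = i"
    using * assms by auto
  have r: "code_of p0 c0 ! (a + plen p + 1 + j) =
    (IBranch (\<lambda>_. True) (a + plen p + plen q + 2) 0 # compile (a + plen p + 2) q) ! j"
    if "j < plen q + 1" for j
    using *(3)[of j] assms that by auto
  show "code_of p0 c0 ! (a + plen p + 1) = IBranch (\<lambda>_. True) (a + plen p + plen q + 2) 0"
    using r[of 0] by simp
  show "code_at (a + plen p + 2) q"
    unfolding code_at_def
  proof (intro conjI allI impI)
    fix j assume "j < plen q"
    then show "code_of p0 c0 ! (a + plen p + 2 + j) = compile (a + plen p + 2) q ! j"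
      using r[of "Suc j"] by simp
  qed (use assms in simp)
qed

lemma code_at_Cond:
  assumes "code_at a (Cond c p q)"
  shows "code_at (a + 1) p" "code_at (a + plen p + 2) q"
    "code_of p0 c0 ! a = IBranch c (a + 1) (a + plen p + 2)"
    "code_of p0 c0 ! (a + plen p + 1) = IBranch (\<lambda>_. True) (a + plen p + plen q + 2) 0"
  using assms code_at_two_branches[of a p q "IBranch c (a + 1) (a + plen p + 2)"]
  by (auto simp: code_at_def)

lemma code_at_Ask:
  assumes "code_at a (Ask p q)"
  shows "code_at (a + 1) p" "code_at (a + plen p + 2) q"
    "code_of p0 c0 ! a = IAsk (a + 1) (a + plen p + 2)"
    "code_of p0 c0 ! (a + plen p + 1) = IBranch (\<lambda>_. True) (a + plen p + plen q + 2) 0"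
  using assms code_at_two_branches[of a p q "IAsk (a + 1) (a + plen p + 2)"]
  by (auto simp: code_at_def)

lemma code_at_Loop:
  assumes "code_at a (Loop c p)"
  shows "code_at (a + 1) p"
    "code_of p0 c0 ! a = IBranch c (a + 1) (a + plen p + 2)"
    "code_of p0 c0 ! (a + plen p + 1) = IBranch (\<lambda>_. True) a 0"
  using assms code_at_nested[of a 1 p "IBranch c (a + 1) (a + plen p + 2)" "[IBranch (\<lambda>_. True) a 0]"]
  by (auto simp: code_at_def)

lemma path_Branch:
  assumes "a \<le> plen p0" "code_of p0 c0 ! a = IBranch c y n" "blank_above T \<sigma>" "heads_le B \<sigma>"
  shows "path M K B (cfg_at a \<sigma>) 1 (cfg_at (if c (scan \<sigma>) then y else n) \<sigma>)"
  using assms by (intro path_step step_IBranch) (auto simp: bounded_tape_list)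

lemma path_Ask:
  assumes "a \<le> plen p0" "code_of p0 c0 ! a = IAsk y n" "heads_le B \<sigma>"
  shows "path M K B (cfg_at a \<sigma>) 1 (cfg_at (if answer K \<sigma> then y else n) \<sigma>)"
  using assms by (intro path_step step_IAsk) (auto simp: bounded_tape_list)

text \<open>Rule induction on \<open>exec\<close> with arbitrary address. Only
  \<open>u \<le> t\<close> can be promised, since an \<open>else\<close> branch needs no closing
  jump and \<open>weaken\<close> adds slack. For a loop the second induction hypothesis is used at
  the same address \<open>a\<close>, to which the jump behind the body returns.\<close>

lemma exec_path:
  assumes "exec K B p \<sigma> t \<sigma>'" "wf_prog S T p" "blank_above T \<sigma>" "heads_le B \<sigma>" "code_at a p"
  shows "blank_above T \<sigma>' \<and> (\<exists>u\<le>t. path M K B (cfg_at a \<sigma>) u (cfg_at (a + plen p) \<sigma>'))"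
  using assms
proof (induction arbitrary: a rule: exec.induct)
  case (Act \<sigma>' f \<sigma>)
  have "code_of p0 c0 ! a = IAct f" "a \<le> plen p0"
    using Act.prems by (auto simp: code_at_def)
  from step_IAct[OF this(2,1)] Act.prems Act.hyps
  have st: "step M K (cfg_at a \<sigma>) = cfg_at (a + 1) \<sigma>'" by simp
  have "path M K B (cfg_at a \<sigma>) 1 (cfg_at (a + 1) \<sigma>')"
    by (rule path_step) (use st Act bounded_tape_list in auto)
  moreover have "blank_above T \<sigma>'"
    unfolding blank_above_def
  proof (intro allI impI)
    fix i assume "T \<le> i"
    then show "\<sigma>' i = blank_tape"
      using Act.prems act_scan[of \<sigma> i] by (simp add: Act.hyps blank_above_def)
  qed
  ultimately show ?case by auto
next
  case (Seq p \<sigma> t \<sigma>' q u \<sigma>'')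
  note c = code_at_Seq[OF Seq.prems(4)]
  have h: "heads_le B \<sigma>'" using Seq by (auto dest: exec_heads_le)
  from Seq.IH(1)[OF _ _ _ c(1)] Seq.prems obtain t1
    where 1: "blank_above T \<sigma>'" "t1 \<le> t" "path M K B (cfg_at a \<sigma>) t1 (cfg_at (a + plen p) \<sigma>')" by auto
  from Seq.IH(2)[OF _ _ h c(2)] Seq.prems 1 obtain t2
    where 2: "blank_above T \<sigma>''" "t2 \<le> u"
      "path M K B (cfg_at (a + plen p) \<sigma>') t2 (cfg_at (a + plen p + plen q) \<sigma>'')" by auto
  from path_trans[OF 1(3) 2(3)] 1 2 show ?case
    by (auto intro!: exI[of _ "t1 + t2"] simp: add.assoc)
next
  case (CondT c \<sigma> p t \<sigma>' q)
  note c = code_at_Cond[OF CondT.prems(4)]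
  have a: "a + plen p + 1 \<le> plen p0" using CondT.prems(4) by (simp add: code_at_def)
  have h: "heads_le B \<sigma>'" using CondT by (auto dest: exec_heads_le)
  from CondT.IH[OF _ _ _ c(1)] CondT.prems obtain t1
    where 1: "blank_above T \<sigma>'" "t1 \<le> t" "path M K B (cfg_at (a + 1) \<sigma>) t1 (cfg_at (a + 1 + plen p) \<sigma>')" by auto
  have "path M K B (cfg_at a \<sigma>) 1 (cfg_at (a + 1) \<sigma>)"
    using path_Branch[OF _ c(3), where \<sigma>=\<sigma>] CondT.prems CondT.hyps a by simp
  note path_trans[OF path_trans[OF this 1(3)], of 1 "cfg_at (a + plen p + plen q + 2) \<sigma>'"]
  with path_Branch[OF a c(4) 1(1) h] 1 show ?case
    by (auto intro!: exI[of _ "1 + t1 + 1"] simp: add.commute add.left_commute)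
next
  case (CondF c \<sigma> q t \<sigma>' p)
  note c = code_at_Cond[OF CondF.prems(4)]
  have a: "a \<le> plen p0" using CondF.prems(4) by (simp add: code_at_def)
  from CondF.IH[OF _ _ _ c(2)] CondF.prems obtain t1
    where 1: "blank_above T \<sigma>'" "t1 \<le> t"
     "path M K B (cfg_at (a + plen p + 2) \<sigma>) t1 (cfg_at (a + plen p + 2 + plen q) \<sigma>')" by auto
  have "path M K B (cfg_at a \<sigma>) 1 (cfg_at (a + plen p + 2) \<sigma>)"
    using path_Branch[OF a c(3), where \<sigma>=\<sigma>] CondF.prems CondF.hyps by simp
  from path_trans[OF this 1(3)] 1 show ?case
    by (auto intro!: exI[of _ "1 + t1"] simp: add.commute add.left_commute)
next
  case (LoopF c \<sigma> p)
  note c = code_at_Loop[OF LoopF.prems(4)]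
  have a: "a \<le> plen p0" using LoopF.prems(4) by (simp add: code_at_def)
  from path_Branch[OF a c(2) LoopF.prems(2,3)] LoopF show ?case
    by (intro conjI exI[of _ 1]) auto
next
  case (LoopT c \<sigma> p t \<sigma>' u \<sigma>'')
  note c = code_at_Loop[OF LoopT.prems(4)]
  have a: "a + plen p + 1 \<le> plen p0" using LoopT.prems(4) by (simp add: code_at_def)
  have h: "heads_le B \<sigma>'" using LoopT by (auto dest: exec_heads_le)
  from LoopT.IH(1)[OF _ _ _ c(1)] LoopT.prems obtain t1
    where 1: "blank_above T \<sigma>'" "t1 \<le> t" "path M K B (cfg_at (a + 1) \<sigma>) t1 (cfg_at (a + 1 + plen p) \<sigma>')" by auto
  from LoopT.IH(2)[OF LoopT.prems(1) 1(1) h LoopT.prems(4)] obtain t2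
    where 2: "blank_above T \<sigma>''" "t2 \<le> u" "path M K B (cfg_at a \<sigma>') t2 (cfg_at (a + plen (Loop c p)) \<sigma>'')" by auto
  have "path M K B (cfg_at a \<sigma>) 1 (cfg_at (a + 1) \<sigma>)"
    using path_Branch[OF _ c(2), where \<sigma>=\<sigma>] LoopT.prems LoopT.hyps a by simp
  note path_trans[OF this 1(3)]
  moreover have "path M K B (cfg_at (a + 1 + plen p) \<sigma>') 1 (cfg_at a \<sigma>')"
    using path_Branch[OF a c(3) 1(1) h] by (simp add: add.commute add.left_commute)
  ultimately have "path M K B (cfg_at a \<sigma>) (1 + t1 + 1 + t2) (cfg_at (a + plen (Loop c p)) \<sigma>'')"
    using 2(3) by (meson path_trans)
  with 1 2 show ?case
    by (intro conjI exI[of _ "1 + t1 + 1 + t2"]) auto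
next
  case (AskT \<sigma> p t \<sigma>' q)
  note c = code_at_Ask[OF AskT.prems(4)]
  have a: "a + plen p + 1 \<le> plen p0" using AskT.prems(4) by (simp add: code_at_def)
  have h: "heads_le B \<sigma>'" using AskT by (auto dest: exec_heads_le)
  from AskT.IH[OF _ _ _ c(1)] AskT.prems obtain t1
    where 1: "blank_above T \<sigma>'" "t1 \<le> t" "path M K B (cfg_at (a + 1) \<sigma>) t1 (cfg_at (a + 1 + plen p) \<sigma>')" by auto
  have "path M K B (cfg_at a \<sigma>) 1 (cfg_at (a + 1) \<sigma>)"
    using path_Ask[OF _ c(3), where \<sigma>=\<sigma>] AskT.prems AskT.hyps a by simp
  note path_trans[OF path_trans[OF this 1(3)], of 1 "cfg_at (a + plen p + plen q + 2) \<sigma>'"]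
  with path_Branch[OF a c(4) 1(1) h] 1 show ?case
    by (auto intro!: exI[of _ "1 + t1 + 1"] simp: add.commute add.left_commute)
next
  case (AskF \<sigma> q t \<sigma>' p)
  note c = code_at_Ask[OF AskF.prems(4)]
  have a: "a \<le> plen p0" using AskF.prems(4) by (simp add: code_at_def)
  from AskF.IH[OF _ _ _ c(2)] AskF.prems obtain t1
    where 1: "blank_above T \<sigma>'" "t1 \<le> t"
     "path M K B (cfg_at (a + plen p + 2) \<sigma>) t1 (cfg_at (a + plen p + 2 + plen q) \<sigma>')" by auto
  have "path M K B (cfg_at a \<sigma>) 1 (cfg_at (a + plen p + 2) \<sigma>)"
    using path_Ask[OF a c(3), where \<sigma>=\<sigma>] AskF.prems AskF.hyps by simp
  from path_trans[OF this 1(3)] 1 show ?case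
    by (auto intro!: exI[of _ "1 + t1"] simp: add.commute add.left_commute)
next
  case (weaken p \<sigma> t \<sigma>' u)
  then show ?case by (meson order_trans)
qed

end

section \<open>From programs to membership in complexity classes\<close>

definition init_store :: "word \<Rightarrow> store" where
  "init_store x = (\<lambda>i. if i = 0 then input_tape x else blank_tape)"

lemma step_halted: "q = accept M \<or> q = reject M \<Longrightarrow> (step M K ^^ t) (q, ts) = (q, ts)"
  by (induction t) (auto simp: step_def)

text \<open>One more step, the final branch on \<open>c\<close>, leads to a halting state. From
  there on the configuration is frozen, so that the head bound along the path holds at all
  times.\<close>

lemma machine_of_run:
  assumes "exec K B p (init_store x) t \<sigma>'" "wf_prog S T p" "2 \<le> T"
  shows "\<exists>u \<le> t + 1. fst (run (machine_of S T p c) K x u) =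
       (if c (scan \<sigma>') then plen p + 1 else plen p + 2) \<and>
     (\<forall>v. bounded_tapes B (snd (run (machine_of S T p c) K x v)))"
proof -
  interpret compiled S T p c K B using assms by unfold_locales
  have hl: "heads_le B (init_store x)"
    by (auto simp: heads_le_def init_store_def input_tape_def blank_tape_def)
  have bl: "blank_above T (init_store x)"
    using assms(3) by (auto simp: blank_above_def init_store_def)
  have i: "init M x = cfg_at 0 (init_store x)"
  proof -
    have "[0..<T] = 0 # [1..<T]" using assms(3) by (simp add: upt_conv_Cons)
    then show ?thesis
      by (auto simp: init_def machine_of_def tape_list_def init_store_def intro!: nth_equalityI)
  qed
  from exec_path[OF assms(1,2) bl hl code_at_whole] obtain u where
    u: "blank_above T \<sigma>'" "u \<le> t" "path M K B (cfg_at 0 (init_store x)) u (cfg_at (plen p) \<sigma>')" by auto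
  define e where "e = (if c (scan \<sigma>') then plen p + 1 else plen p + 2)"
  have "heads_le B \<sigma>'" using exec_heads_le[OF assms(1) hl] .
  then have "path M K B (cfg_at (plen p) \<sigma>') 1 (cfg_at e \<sigma>')"
    unfolding e_def using u by (intro path_Branch) (auto simp: code_of_def nth_append)
  from path_trans[OF u(3) this] have pa: "path M K B (init M x) (u + 1) (cfg_at e \<sigma>')"
    by (simp add: i)
  have hlt: "(step M K ^^ v) (cfg_at e \<sigma>') = cfg_at e \<sigma>'" for v
    by (rule step_halted) (auto simp: machine_of_def e_def)
  have "bounded_tapes B (snd (run M K x v))" for v
  proof (cases "v \<le> u + 1")
    case True then show ?thesis using pa by (simp add: path_def run_def)
  next
    case False
    then have "v = (v - (u + 1)) + (u + 1)" by simp
    then have "run M K x v = (step M K ^^ (v - (u + 1))) ((step M K ^^ (u + 1)) (init M x))"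
      unfolding run_def by (metis funpow_add o_apply)
    also have "\<dots> = cfg_at e \<sigma>'" using pa hlt by (simp add: path_def)
    finally show ?thesis using pa by (auto simp: path_def)
  qed
  moreover have "fst (run M K x (u + 1)) = e" using pa by (simp add: path_def run_def)
  ultimately show ?thesis using u(2) unfolding e_def by (intro exI[of _ "u + 1"]) auto
qed

lemma P_relI:
  assumes "wf_prog S T p" "3 \<le> S" "2 \<le> T"
    and "\<And>x. \<exists>B \<sigma>'. exec K B p (init_store x) (poly r (length x)) \<sigma>' \<and> (c (scan \<sigma>') \<longleftrightarrow> x \<in> L)"
  shows "L \<in> P_rel K"
proof -
  \<comment> \<open>The summand \<open>1\<close> pays for the final branch on
    \<open>c\<close>.\<close>
  have "decides_in_time (machine_of S T p c) K L (poly (r + 1))"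
    unfolding decides_in_time_def
  proof
    fix x
    from assms(4)[of x] obtain B \<sigma>' where
      e: "exec K B p (init_store x) (poly r (length x)) \<sigma>'" "c (scan \<sigma>') \<longleftrightarrow> x \<in> L" by blast
    from machine_of_run[OF e(1) assms(1,3), of c] e(2)
    show "\<exists>t\<le>poly (r + 1) (length x). fst (run (machine_of S T p c) K x t) = verdict (machine_of S T p c) L x"
      by (auto simp: verdict_def machine_of_def)
  qed
  with oracle_tm_machine_of[OF assms(1-3)] show ?thesis unfolding P_rel_def by blast
qed

lemma decides_in_space_machine_of:
  assumes "wf_prog S T p" "2 \<le> T"
    and "\<And>x. \<exists>t \<sigma>'. exec K (poly r (length x)) p (init_store x) t \<sigma>' \<and> (c (scan \<sigma>') \<longleftrightarrow> x \<in> L)"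
  shows "decides_in_space (machine_of S T p c) K L (poly r)"
  unfolding decides_in_space_def
proof
  fix x
  from assms(3)[of x] obtain t \<sigma>' where
    e: "exec K (poly r (length x)) p (init_store x) t \<sigma>'" "c (scan \<sigma>') \<longleftrightarrow> x \<in> L" by blast
  from machine_of_run[OF e(1) assms(1,2), of c] e(2)
  show "(\<exists>t. fst (run (machine_of S T p c) K x t) = verdict (machine_of S T p c) L x) \<and>
     (\<forall>t. \<forall>(cc, h)\<in>set (snd (run (machine_of S T p c) K x t)). \<bar>h\<bar> \<le> int (poly r (length x)))"
    by (auto simp: verdict_def machine_of_def bounded_tapes_def)
qed

lemma PSPACE_relI:
  assumes "wf_prog S T p" "3 \<le> S" "2 \<le> T"
    and "\<And>x. \<exists>t \<sigma>'. exec K (poly r (length x)) p (init_store x) t \<sigma>' \<and> (c (scan \<sigma>') \<longleftrightarrow> x \<in> L)"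
  shows "L \<in> PSPACE_rel K"
  using oracle_tm_machine_of[OF assms(1-3)] decides_in_space_machine_of[OF assms(1,3,4)]
  unfolding PSPACE_rel_def by blast

lemma PSPACEI:
  assumes "wf_prog S T p" "3 \<le> S" "2 \<le> T" "ask_free p"
    and "\<And>x. \<exists>t \<sigma>'. exec {} (poly r (length x)) p (init_store x) t \<sigma>' \<and> (c (scan \<sigma>') \<longleftrightarrow> x \<in> L)"
  shows "L \<in> PSPACE"
  using plain_tm_machine_of[OF assms(1-4)] decides_in_space_machine_of[OF assms(1,3,5)]
  unfolding PSPACE_def by blast

section \<open>Elementary programs\<close>

text \<open>With the bound on the initial heads as a built-in premise, \<open>exec_heads_le\<close>
  hands it on through a sequence, and it is not proved anew for each part.\<close>

definition runs_in :: "nat set \<Rightarrow> nat \<Rightarrow> prog \<Rightarrow> store \<Rightarrow> nat \<Rightarrow> store \<Rightarrow> bool" where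
  "runs_in K B p \<sigma> t \<sigma>' \<longleftrightarrow> (heads_le B \<sigma> \<longrightarrow> exec K B p \<sigma> t \<sigma>')"

lemma runs_in_Seq: "runs_in K B p \<sigma> t \<sigma>' \<Longrightarrow> runs_in K B q \<sigma>' u \<sigma>'' \<Longrightarrow> t + u \<le> v \<Longrightarrow> runs_in K B (Seq p q) \<sigma> v \<sigma>''"
  unfolding runs_in_def by (meson exec.Seq exec.weaken exec_heads_le)

lemma runs_in_CondT: "runs_in K B p \<sigma> t \<sigma>' \<Longrightarrow> c (scan \<sigma>) \<Longrightarrow> t + 2 \<le> v \<Longrightarrow> runs_in K B (Cond c p q) \<sigma> v \<sigma>'"
  unfolding runs_in_def by (meson exec.CondT exec.weaken)

lemma runs_in_CondF: "runs_in K B q \<sigma> t \<sigma>' \<Longrightarrow> \<not> c (scan \<sigma>) \<Longrightarrow> t + 2 \<le> v \<Longrightarrow> runs_in K B (Cond c p q) \<sigma> v \<sigma>'"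
  unfolding runs_in_def by (meson exec.CondF exec.weaken)

lemma runs_in_LoopF: "\<not> c (scan \<sigma>) \<Longrightarrow> 1 \<le> v \<Longrightarrow> runs_in K B (Loop c p) \<sigma> v \<sigma>"
  unfolding runs_in_def by (meson exec.LoopF exec.weaken)

lemma runs_in_LoopT: "runs_in K B p \<sigma> t \<sigma>' \<Longrightarrow> runs_in K B (Loop c p) \<sigma>' u \<sigma>'' \<Longrightarrow> c (scan \<sigma>) \<Longrightarrow> t + u + 2 \<le> v
   \<Longrightarrow> runs_in K B (Loop c p) \<sigma> v \<sigma>''"
  unfolding runs_in_def by (meson exec.LoopT exec.weaken exec_heads_le)

lemma runs_in_Ask:
  "(answer K \<sigma> \<Longrightarrow> runs_in K B p \<sigma> t \<sigma>') \<Longrightarrow> (\<not> answer K \<sigma> \<Longrightarrow> runs_in K B q \<sigma> t \<sigma>') \<Longrightarrow> t + 2 \<le> v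
   \<Longrightarrow> runs_in K B (Ask p q) \<sigma> v \<sigma>'"
  unfolding runs_in_def by (meson exec.AskT exec.AskF exec.weaken)

lemma runs_in_weaken: "runs_in K B p \<sigma> t \<sigma>' \<Longrightarrow> t \<le> v \<Longrightarrow> runs_in K B p \<sigma> v \<sigma>'"
  unfolding runs_in_def by (meson exec.weaken)

lemma runs_in_eq: "runs_in K B p \<sigma> t \<sigma>' \<Longrightarrow> \<sigma>' = \<sigma>'' \<Longrightarrow> runs_in K B p \<sigma> t \<sigma>''"
  by simp

text \<open>Only tapes on which \<open>f\<close> does something are to be checked; any other head
  stays where the built-in premise already bounds it.\<close>

lemma runs_in_Act:
  assumes "\<sigma>' = (\<lambda>i. act (f (scan \<sigma>) i) (\<sigma> i))"
    and "\<And>i. f (scan \<sigma>) i \<noteq> (scan \<sigma> i, 0) \<Longrightarrow> \<bar>snd (\<sigma>' i)\<bar> \<le> int B"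
  shows "runs_in K B (Act f) \<sigma> 1 \<sigma>'"
  unfolding runs_in_def
proof
  assume h: "heads_le B \<sigma>"
  have "\<bar>snd (\<sigma>' i)\<bar> \<le> int B" for i
    using assms h act_scan[of \<sigma> i] by (cases "f (scan \<sigma>) i = (scan \<sigma> i, 0)") (auto simp: heads_le_def)
  then show "exec K B (Act f) \<sigma> 1 \<sigma>'"
    by (intro exec.Act assms(1)) (simp add: heads_le_def)
qed

text \<open>For space-bounded programs, which may take exponential time, the running time is dropped
  from the account.\<close>

definition runs :: "nat set \<Rightarrow> nat \<Rightarrow> prog \<Rightarrow> store \<Rightarrow> store \<Rightarrow> bool" where
  "runs K B p \<sigma> \<sigma>' \<longleftrightarrow> (\<exists>t. runs_in K B p \<sigma> t \<sigma>')"

lemma runsI: "runs_in K B p \<sigma> t \<sigma>' \<Longrightarrow> runs K B p \<sigma> \<sigma>'"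
  by (auto simp: runs_def)

lemma runs_Seq: "runs K B p \<sigma> \<sigma>' \<Longrightarrow> runs K B q \<sigma>' \<sigma>'' \<Longrightarrow> runs K B (Seq p q) \<sigma> \<sigma>''"
  unfolding runs_def by (meson runs_in_Seq order_refl)

lemma runs_CondT: "runs K B p \<sigma> \<sigma>' \<Longrightarrow> c (scan \<sigma>) \<Longrightarrow> runs K B (Cond c p q) \<sigma> \<sigma>'"
  unfolding runs_def by (meson runs_in_CondT order_refl)

lemma runs_CondF: "runs K B q \<sigma> \<sigma>' \<Longrightarrow> \<not> c (scan \<sigma>) \<Longrightarrow> runs K B (Cond c p q) \<sigma> \<sigma>'"
  unfolding runs_def by (meson runs_in_CondF order_refl)

lemma runs_LoopF: "\<not> c (scan \<sigma>) \<Longrightarrow> runs K B (Loop c p) \<sigma> \<sigma>"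
  unfolding runs_def by (meson runs_in_LoopF order_refl)

lemma runs_LoopT: "runs K B p \<sigma> \<sigma>' \<Longrightarrow> runs K B (Loop c p) \<sigma>' \<sigma>'' \<Longrightarrow> c (scan \<sigma>) \<Longrightarrow> runs K B (Loop c p) \<sigma> \<sigma>''"
  unfolding runs_def by (meson runs_in_LoopT order_refl)

lemma runs_Ask:
  "(answer K \<sigma> \<Longrightarrow> runs K B p \<sigma> \<sigma>') \<Longrightarrow> (\<not> answer K \<sigma> \<Longrightarrow> runs K B q \<sigma> \<sigma>') \<Longrightarrow> runs K B (Ask p q) \<sigma> \<sigma>'"
  unfolding runs_def by (meson runs_in_Ask order_refl)

section \<open>Basic actions on the tapes\<close>

definition skip :: prog where
  "skip = Act (\<lambda>s i. (s i, 0))"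

definition move :: "nat set \<Rightarrow> int \<Rightarrow> prog" where
  "move I d = Act (\<lambda>s i. (s i, if i \<in> I then d else 0))"

definition emit :: "nat \<Rightarrow> ((nat \<Rightarrow> nat) \<Rightarrow> nat) \<Rightarrow> int \<Rightarrow> prog" where
  "emit i g d = Act (\<lambda>s j. if j = i then (g s, d) else (s j, 0))"

definition copy_cell :: "nat set \<Rightarrow> nat \<Rightarrow> nat \<Rightarrow> prog" where
  "copy_cell I i j = Act (\<lambda>s l. if l = j then (s i, 1) else (s l, if l \<in> I then 1 else 0))"

lemma act_split: "act a \<tau> = ((fst \<tau>)(snd \<tau> := fst a), snd \<tau> + snd a)"
  by (cases a; cases \<tau>) (simp add: act_def)

lemma runs_in_skip: "runs_in K B skip \<sigma> 1 \<sigma>"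
  unfolding skip_def by (rule runs_in_Act) (auto simp: act_scan)

lemma runs_in_move:
  assumes "\<And>i. i \<in> I \<Longrightarrow> \<bar>snd (\<sigma> i) + d\<bar> \<le> int B"
  shows "runs_in K B (move I d) \<sigma> 1 (\<lambda>i. if i \<in> I then (fst (\<sigma> i), snd (\<sigma> i) + d) else \<sigma> i)"
  unfolding move_def using assms by (intro runs_in_Act) (auto simp: act_split scan_def fun_eq_iff)

lemma runs_in_move1:
  assumes "\<bar>snd (\<sigma> i) + d\<bar> \<le> int B"
  shows "runs_in K B (move {i} d) \<sigma> 1 (\<sigma>(i := (fst (\<sigma> i), snd (\<sigma> i) + d)))"
  by (rule runs_in_eq[OF runs_in_move]) (use assms in auto)

lemma runs_in_emit:
  assumes "\<bar>snd (\<sigma> i) + d\<bar> \<le> int B"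
  shows "runs_in K B (emit i g d) \<sigma> 1 (\<sigma>(i := ((fst (\<sigma> i))(snd (\<sigma> i) := g (scan \<sigma>)), snd (\<sigma> i) + d)))"
  unfolding emit_def using assms by (intro runs_in_Act) (auto simp: act_split scan_def fun_eq_iff)

lemma runs_in_copy_cell:
  assumes "\<And>l. l \<in> I \<Longrightarrow> \<bar>snd (\<sigma> l) + 1\<bar> \<le> int B" "\<bar>snd (\<sigma> j) + 1\<bar> \<le> int B"
  shows "runs_in K B (copy_cell I i j) \<sigma> 1 (\<lambda>l. if l = j then ((fst (\<sigma> j))(snd (\<sigma> j) := scan \<sigma> i), snd (\<sigma> j) + 1)
     else if l \<in> I then (fst (\<sigma> l), snd (\<sigma> l) + 1) else \<sigma> l)"
  unfolding copy_cell_def using assms by (intro runs_in_Act) (auto simp: act_split scan_def fun_eq_iff)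

lemma wf_skip [simp]: "wf_prog S T skip"
  by (simp add: skip_def)

lemma wf_move [simp]: "I \<subseteq> {..<T} \<Longrightarrow> d \<in> {-1, 0, 1} \<Longrightarrow> wf_prog S T (move I d)"
  by (auto simp: move_def)

lemma wf_emit [simp]:
  "i < T \<Longrightarrow> d \<in> {-1, 0, 1} \<Longrightarrow> (\<And>s. (\<forall>i. s i < S) \<Longrightarrow> g s < S) \<Longrightarrow> wf_prog S T (emit i g d)"
  by (auto simp: emit_def)

lemma wf_copy_cell [simp]: "I \<subseteq> {..<T} \<Longrightarrow> j < T \<Longrightarrow> wf_prog S T (copy_cell I i j)"
  by (auto simp: copy_cell_def)

lemma ask_free_basic [simp]:
  "ask_free skip" "ask_free (move I d)" "ask_free (emit i g d)" "ask_free (copy_cell I i j)"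
  by (auto simp: skip_def move_def emit_def copy_cell_def)

subsection \<open>Tapes holding a word\<close>

definition bit_sym :: "bool \<Rightarrow> nat" where
  "bit_sym b = (if b then 2 else 1)"

definition cells :: "word \<Rightarrow> int \<Rightarrow> nat" where
  "cells u = fst (input_tape u)"

definition word_tape :: "word \<Rightarrow> nat \<Rightarrow> tape" where
  "word_tape u n = (cells u, int n)"

text \<open>A register for a number that is coded as a single symbol, such as a flag or the state of
  a simulated machine. With value \<open>0\<close> it is the blank tape.\<close>

definition mark_tape :: "nat \<Rightarrow> tape" where
  "mark_tape v = ((\<lambda>_. 0)(0 := v), 0)"

lemma bit_sym_pos [simp]: "0 < bit_sym b" "bit_sym b \<noteq> 0" and bit_sym_inj [simp]: "bit_sym b = bit_sym c \<longleftrightarrow> b = c"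
  and bit_sym_lt [simp]: "bit_sym b < 3"
  by (auto simp: bit_sym_def)

lemma cells_nth: "cells u i = (if 0 \<le> i \<and> i < int (length u) then bit_sym (u ! nat i) else 0)"
  by (simp add: cells_def input_tape_def bit_sym_def)

lemma input_tape_word: "input_tape u = word_tape u 0"
  by (simp add: word_tape_def cells_def input_tape_def)

lemma word_tape_Nil: "word_tape [] 0 = blank_tape"
  by (auto simp: word_tape_def blank_tape_def cells_nth)

lemma mark_tape_0: "mark_tape 0 = blank_tape"
  by (auto simp: mark_tape_def blank_tape_def)

lemma fst_word_tape [simp]: "fst (word_tape u n) = cells u" "snd (word_tape u n) = int n"
  by (auto simp: word_tape_def)

lemma mark_tape_simps [simp]: "fst (mark_tape v) 0 = v" "snd (mark_tape v) = 0"
  by (auto simp: mark_tape_def)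

lemma cells_append_at [simp]: "cells (p @ b # s) (int (length p)) = bit_sym b"
  by (simp add: cells_nth)

lemma cells_end [simp]: "cells u (int (length u)) = 0"
  by (simp add: cells_nth)

lemma cells_end_append [simp]: "cells (u @ v) (int (length u + length v)) = 0"
  by (simp add: cells_nth)

lemma cells_neg [simp]: "cells u (-1) = 0"
  by (simp add: cells_nth)

lemma cells_snoc: "(cells u)(int (length u) := bit_sym b) = cells (u @ [b])"
  by (auto simp: cells_nth fun_eq_iff nth_append)

lemma cells_drop_last: "u \<noteq> [] \<Longrightarrow> (cells u)(int (length u) - 1 := 0) = cells (butlast u)"
  by (auto simp: cells_nth fun_eq_iff nth_butlast)

lemma runs_in_set_mark:
  assumes "\<sigma> i = mark_tape v"
  shows "runs_in K B (emit i g 0) \<sigma> 1 (\<sigma>(i := mark_tape (g (scan \<sigma>))))"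
  by (rule runs_in_eq[OF runs_in_emit]) (use assms in \<open>auto simp: mark_tape_def\<close>)

text \<open>The head may stand on the blank behind the word, where the loop would stop at once;
  hence the first move. The blank in cell \<open>-1\<close> ends the loop, which is why the bound
  \<open>1 \<le> B\<close> appears even for empty words.\<close>

definition rewind :: "nat \<Rightarrow> prog" where
  "rewind i = Seq (move {i} (-1)) (Seq (Loop (\<lambda>s. s i \<noteq> 0) (move {i} (-1))) (move {i} 1))"

lemma runs_in_rewind_loop:
  assumes "\<sigma> i = (cells u, int n - 1)" "n \<le> length u" "1 \<le> B"
  shows "runs_in K B (Loop (\<lambda>s. s i \<noteq> 0) (move {i} (-1))) \<sigma> (3 * n + 1) (\<sigma>(i := (cells u, -1)))"
  using assms
proof (induction n arbitrary: \<sigma>)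
  case 0
  then show ?case
    by (intro runs_in_eq[OF runs_in_LoopF]) (auto simp: scan_def fun_eq_iff)
next
  case (Suc n)
  show ?case
  proof (rule runs_in_LoopT)
    show "scan \<sigma> i \<noteq> 0" using Suc.prems by (auto simp: scan_def cells_nth)
    show "runs_in K B (Loop (\<lambda>s. s i \<noteq> 0) (move {i} (-1))) (\<sigma>(i := (cells u, int n - 1)))
        (3 * n + 1) (\<sigma>(i := (cells u, -1)))"
      by (rule runs_in_eq[OF Suc.IH]) (use Suc.prems in auto)
    have "\<bar>int n - 1\<bar> \<le> int B" if "heads_le B \<sigma>"
      using that Suc.prems unfolding heads_le_def by (auto dest!: spec[of _ i])
    then show "runs_in K B (move {i} (- 1)) \<sigma> 1 (\<sigma>(i := (cells u, int n - 1)))"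
      using runs_in_move1[of \<sigma> i "-1" B K] Suc.prems by (auto simp: runs_in_def)
  qed auto
qed

lemma runs_in_heads: "(heads_le B \<sigma> \<Longrightarrow> runs_in K B p \<sigma> t \<sigma>') \<Longrightarrow> runs_in K B p \<sigma> t \<sigma>'"
  by (auto simp: runs_in_def)

lemma runs_in_rewind:
  assumes "\<sigma> i = word_tape u n" "n \<le> length u" "1 \<le> B"
  shows "runs_in K B (rewind i) \<sigma> (3 * n + 3) (\<sigma>(i := word_tape u 0))"
proof (rule runs_in_heads)
  assume h: "heads_le B \<sigma>"
  then have n: "int n \<le> int B" using assms(1) unfolding heads_le_def by (auto dest!: spec[of _ i])
  define \<sigma>1 where "\<sigma>1 = \<sigma>(i := (cells u, int n - 1))"
  define \<sigma>2 where "\<sigma>2 = \<sigma>(i := (cells u, -1))"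
  have 1: "runs_in K B (move {i} (-1)) \<sigma> 1 \<sigma>1"
    by (rule runs_in_eq[OF runs_in_move1]) (use n assms in \<open>auto simp: \<sigma>1_def\<close>)
  have 2: "runs_in K B (Loop (\<lambda>s. s i \<noteq> 0) (move {i} (-1))) \<sigma>1 (3 * n + 1) \<sigma>2"
    by (rule runs_in_eq[OF runs_in_rewind_loop]) (use assms in \<open>auto simp: \<sigma>1_def \<sigma>2_def\<close>)
  have 3: "runs_in K B (move {i} 1) \<sigma>2 1 (\<sigma>(i := word_tape u 0))"
    by (rule runs_in_eq[OF runs_in_move1]) (use assms in \<open>auto simp: \<sigma>2_def word_tape_def\<close>)
  show ?thesis unfolding rewind_def
    by (rule runs_in_Seq[OF 1 runs_in_Seq[OF 2 3 order_refl]]) simp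
qed

definition copy :: "nat \<Rightarrow> nat \<Rightarrow> prog" where
  "copy i j = Loop (\<lambda>s. s i \<noteq> 0) (copy_cell {i} i j)"

lemma runs_in_copy:
  assumes "\<sigma> i = word_tape (p @ s) (length p)" "\<sigma> j = word_tape v (length v)" "i \<noteq> j"
    "length (p @ s) \<le> B" "length (v @ s) \<le> B"
  shows "runs_in K B (copy i j) \<sigma> (3 * length s + 1)
    (\<sigma>(i := word_tape (p @ s) (length (p @ s)), j := word_tape (v @ s) (length (v @ s))))"
  using assms unfolding copy_def
proof (induction s arbitrary: p v \<sigma>)
  case Nil
  then show ?case by (intro runs_in_eq[OF runs_in_LoopF]) (auto simp: scan_def fun_eq_iff)
next
  case (Cons b s)
  let ?\<sigma>' = "\<sigma>(i := word_tape (p @ b # s) (length (p @ [b])), j := word_tape (v @ [b]) (length (v @ [b])))"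
  show ?case
  proof (rule runs_in_LoopT)
    show "scan \<sigma> i \<noteq> 0" using Cons.prems by (simp add: scan_def)
    show "runs_in K B (copy_cell {i} i j) \<sigma> 1 ?\<sigma>'"
      by (rule runs_in_eq[OF runs_in_copy_cell])
        (use Cons.prems in \<open>auto simp: scan_def fun_eq_iff word_tape_def cells_snoc[symmetric]\<close>)
    show "runs_in K B (Loop (\<lambda>s. s i \<noteq> 0) (copy_cell {i} i j)) ?\<sigma>' (3 * length s + 1)
       (\<sigma>(i := word_tape (p @ b # s) (length (p @ b # s)), j := word_tape (v @ b # s) (length (v @ b # s))))"
      by (rule runs_in_eq[OF Cons.IH[where p = "p @ [b]" and v = "v @ [b]"]])
        (use Cons.prems in \<open>auto simp: fun_eq_iff\<close>)
  qed auto
qed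

text \<open>Erasing proceeds leftwards from the end of the word, so that the blank in cell
  \<open>-1\<close> ends it and the head can finish at cell \<open>0\<close>.\<close>

definition clear :: "nat \<Rightarrow> prog" where
  "clear i = Seq (Loop (\<lambda>s. s i \<noteq> 0) (move {i} 1)) (Seq (move {i} (-1))
     (Seq (Loop (\<lambda>s. s i \<noteq> 0) (emit i (\<lambda>_. 0) (-1))) (move {i} 1)))"

lemma runs_in_to_end:
  assumes "\<sigma> i = word_tape (p @ s) (length p)" "length (p @ s) \<le> B"
  shows "runs_in K B (Loop (\<lambda>s. s i \<noteq> 0) (move {i} 1)) \<sigma> (3 * length s + 1)
    (\<sigma>(i := word_tape (p @ s) (length (p @ s))))"
  using assms
proof (induction s arbitrary: p \<sigma>)
  case Nil
  then show ?case by (intro runs_in_eq[OF runs_in_LoopF]) (auto simp: scan_def fun_eq_iff)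
next
  case (Cons b s)
  let ?\<sigma>' = "\<sigma>(i := word_tape (p @ b # s) (length (p @ [b])))"
  show ?case
  proof (rule runs_in_LoopT)
    show "scan \<sigma> i \<noteq> 0" using Cons.prems by (simp add: scan_def)
    show "runs_in K B (move {i} 1) \<sigma> 1 ?\<sigma>'"
      by (rule runs_in_eq[OF runs_in_move1]) (use Cons.prems in \<open>auto simp: word_tape_def\<close>)
    show "runs_in K B (Loop (\<lambda>s. s i \<noteq> 0) (move {i} 1)) ?\<sigma>' (3 * length s + 1)
       (\<sigma>(i := word_tape (p @ b # s) (length (p @ b # s))))"
      by (rule runs_in_eq[OF Cons.IH[where p = "p @ [b]"]]) (use Cons.prems in auto)
  qed auto
qed

lemma runs_in_erase_left:
  assumes "\<sigma> i = (cells u, int (length u) - 1)" "length u \<le> B" "1 \<le> B"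
  shows "runs_in K B (Loop (\<lambda>s. s i \<noteq> 0) (emit i (\<lambda>_. 0) (-1))) \<sigma> (3 * length u + 1)
    (\<sigma>(i := (cells [], -1)))"
  using assms
proof (induction "length u" arbitrary: u \<sigma>)
  case 0
  then show ?case by (intro runs_in_eq[OF runs_in_LoopF]) (auto simp: scan_def fun_eq_iff)
next
  case (Suc n)
  let ?\<sigma>' = "\<sigma>(i := (cells (butlast u), int (length (butlast u)) - 1))"
  have ne: "u \<noteq> []" using Suc by auto
  show ?case
  proof (rule runs_in_LoopT)
    show "scan \<sigma> i \<noteq> 0" using Suc.prems Suc.hyps(2)[symmetric] by (simp add: scan_def cells_nth)
    show "runs_in K B (emit i (\<lambda>_. 0) (-1)) \<sigma> 1 ?\<sigma>'"
      by (rule runs_in_eq[OF runs_in_emit])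
        (use Suc.prems ne Suc.hyps(2)[symmetric] in \<open>auto simp: cells_drop_last[symmetric] fun_eq_iff\<close>)
    show "runs_in K B (Loop (\<lambda>s. s i \<noteq> 0) (emit i (\<lambda>_. 0) (-1))) ?\<sigma>' (3 * length (butlast u) + 1)
       (\<sigma>(i := (cells [], -1)))"
      by (rule runs_in_eq[OF Suc.hyps(1)]) (use Suc.prems Suc.hyps(2)[symmetric] in auto)
  qed (use Suc.hyps(2)[symmetric] in auto)
qed

lemma runs_in_clear:
  assumes "\<sigma> i = word_tape u n" "n \<le> length u" "length u \<le> B" "1 \<le> B"
  shows "runs_in K B (clear i) \<sigma> (6 * length u + 4) (\<sigma>(i := blank_tape))"
proof -
  define \<sigma>1 where "\<sigma>1 = \<sigma>(i := word_tape u (length u))"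
  define \<sigma>2 where "\<sigma>2 = \<sigma>(i := (cells u, int (length u) - 1))"
  define \<sigma>3 where "\<sigma>3 = \<sigma>(i := (cells [], -1))"
  have 1: "runs_in K B (Loop (\<lambda>s. s i \<noteq> 0) (move {i} 1)) \<sigma> (3 * length u + 1) \<sigma>1"
    using runs_in_weaken[OF runs_in_to_end[of \<sigma> i "take n u" "drop n u" B K], of "3 * length u + 1"] assms
    by (simp add: \<sigma>1_def)
  have 2: "runs_in K B (move {i} (-1)) \<sigma>1 1 \<sigma>2"
    by (rule runs_in_eq[OF runs_in_move1]) (use assms in \<open>auto simp: \<sigma>1_def \<sigma>2_def\<close>)
  have 3: "runs_in K B (Loop (\<lambda>s. s i \<noteq> 0) (emit i (\<lambda>_. 0) (-1))) \<sigma>2 (3 * length u + 1) \<sigma>3"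
    by (rule runs_in_eq[OF runs_in_erase_left[where u = u]]) (use assms in \<open>auto simp: \<sigma>3_def \<sigma>2_def\<close>)
  have 4: "runs_in K B (move {i} 1) \<sigma>3 1 (\<sigma>(i := blank_tape))"
    by (rule runs_in_eq[OF runs_in_move1])
      (use assms in \<open>auto simp: \<sigma>3_def word_tape_def word_tape_Nil[symmetric]\<close>)
  show ?thesis unfolding clear_def
    by (rule runs_in_Seq[OF 1 runs_in_Seq[OF 2 runs_in_Seq[OF 3 4 order_refl] order_refl]]) simp
qed

lemma wf_word_progs [simp]:
  "i < T \<Longrightarrow> wf_prog S T (rewind i)"
  "i < T \<Longrightarrow> j < T \<Longrightarrow> wf_prog S T (copy i j)"
  "i < T \<Longrightarrow> 0 < S \<Longrightarrow> wf_prog S T (clear i)"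
  by (auto simp: rewind_def copy_def clear_def)

lemma ask_free_word_progs [simp]: "ask_free (rewind i)" "ask_free (copy i j)" "ask_free (clear i)"
  by (auto simp: rewind_def copy_def clear_def)

subsection \<open>Pairing\<close>

text \<open>Total on purpose: any two unequal bits count as the separator, and a word without one
  has an empty second component. Guessed words need not be pairs, and what follows is stated for
  arbitrary words in terms of \<open>unpair\<close>.\<close>

fun unpair :: "word \<Rightarrow> word \<times> word" where
  "unpair (b # c # w) = (if b = c then (b # fst (unpair w), snd (unpair w)) else ([], w))"
| "unpair w = ([], [])"

lemma unpair_pair [simp]: "unpair (pair x y) = (x, y)"
  by (induction x) (auto simp: pair_def)

lemma length_pair: "length (pair x y) = 2 * length x + 2 + length y"
  by (induction x) (auto simp: pair_def)

lemma unpair_suffix: "\<exists>p. w = p @ snd (unpair w)"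
  by (induction w rule: unpair.induct) (auto, metis append_Cons)

lemma length_unpair: "length (fst (unpair w)) + length (snd (unpair w)) \<le> length w"
  by (induction w rule: unpair.induct) auto

lemma length_snd_unpair: "w \<noteq> [] \<Longrightarrow> length (snd (unpair w)) < length w"
proof (cases w rule: unpair.cases)
  case (1 b c w')
  then show ?thesis using length_unpair[of w'] by auto
qed auto

text \<open>The first bit of each block of two is put into the next free cell of tape
  \<open>j\<close> and compared with the second. If they agree, it stays; otherwise it is erased and
  the flag \<open>f\<close> ends the loop. A last single bit is compared with a blank and so ends
  the loop in the same way.\<close>

definition decode_fst :: "nat \<Rightarrow> nat \<Rightarrow> nat \<Rightarrow> prog" where
  "decode_fst i j f =
     Seq (Loop (\<lambda>s. s i \<noteq> 0 \<and> s f = 0)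
       (Seq (Act (\<lambda>s l. if l = j then (s i, 0) else (s l, if l = i then 1 else 0)))
         (Cond (\<lambda>s. s i = s j) (move {i, j} 1)
           (Act (\<lambda>s l. if l = j then (0, 0) else if l = f then (1, 0)
              else (s l, if l = i \<and> s i \<noteq> 0 then 1 else 0))))))
     (emit f (\<lambda>_. 0) 0)"

lemma runs_in_decode_fst:
  assumes "\<sigma> i = word_tape (p @ s) (length p)" "\<sigma> j = word_tape v (length v)" "\<sigma> f = blank_tape"
    "i \<noteq> j" "i \<noteq> f" "j \<noteq> f" "length (p @ s) \<le> B" "length (v @ s) \<le> B"
  shows "runs_in K B (decode_fst i j f) \<sigma> (7 * length s + 10)
    (\<sigma>(i := word_tape (p @ s) (length (p @ s) - length (snd (unpair s))),
       j := word_tape (v @ fst (unpair s)) (length (v @ fst (unpair s)))))"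
proof -
  define body where "body = (Seq (Act (\<lambda>s l. if l = j then (s i, 0) else (s l, if l = i then 1 else 0)))
         (Cond (\<lambda>s. s i = s j) (move {i, j} 1)
           (Act (\<lambda>s l. if l = j then (0, 0) else if l = f then (1, 0)
              else (s l, if l = i \<and> s i \<noteq> 0 then 1 else 0)))))"
  \<comment> \<open>\<open>m\<close> is the final flag: \<open>1\<close> after a block of unequal
    symbols, \<open>0\<close> if the word was used up before. It is reset after the loop.\<close>
  have "\<exists>m. runs_in K B (Loop (\<lambda>s. s i \<noteq> 0 \<and> s f = 0) body) \<sigma> (7 * length s + 8)
    (\<sigma>(i := word_tape (p @ s) (length (p @ s) - length (snd (unpair s))),
       j := word_tape (v @ fst (unpair s)) (length (v @ fst (unpair s))), f := mark_tape m))"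
    using assms
  proof (induction s arbitrary: p v \<sigma> rule: unpair.induct)
    case (1 b c w)
    let ?\<sigma>1 = "\<sigma>(i := word_tape (p @ b # c # w) (length p + 1),
       j := ((cells v)(int (length v) := bit_sym b), int (length v)))"
    have a1: "runs_in K B (Act (\<lambda>s l. if l = j then (s i, 0) else (s l, if l = i then 1 else 0))) \<sigma> 1 ?\<sigma>1"
      by (rule runs_in_Act) (use "1.prems" in \<open>auto simp: act_split scan_def fun_eq_iff word_tape_def\<close>)
    have si: "scan ?\<sigma>1 i = bit_sym c" "scan ?\<sigma>1 j = bit_sym b" "scan ?\<sigma>1 f = 0"
      using "1.prems" cells_append_at[of "p @ [b]" c w]
      by (auto simp: scan_def add.commute blank_tape_def)
    have gd: "scan \<sigma> i \<noteq> 0 \<and> scan \<sigma> f = 0" using "1.prems" by (simp add: scan_def blank_tape_def)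
    show ?case
    proof (cases "b = c")
      case True
      let ?\<sigma>2 = "\<sigma>(i := word_tape (p @ b # c # w) (length (p @ [b, c])),
         j := word_tape (v @ [b]) (length (v @ [b])))"
      have a2: "runs_in K B (move {i, j} 1) ?\<sigma>1 1 ?\<sigma>2"
        by (rule runs_in_eq[OF runs_in_move]) (use "1.prems" True in \<open>auto simp: word_tape_def cells_snoc\<close>)
      have a3: "runs_in K B body \<sigma> 4 ?\<sigma>2" unfolding body_def
        by (rule runs_in_Seq[OF a1 runs_in_CondT[OF a2]]) (use si True in auto)
      have "\<exists>m. runs_in K B (Loop (\<lambda>s. s i \<noteq> 0 \<and> s f = 0) body) ?\<sigma>2 (7 * length w + 8)
         (?\<sigma>2(i := word_tape ((p @ [b, c]) @ w) (length ((p @ [b, c]) @ w) - length (snd (unpair w))),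
           j := word_tape ((v @ [b]) @ fst (unpair w)) (length ((v @ [b]) @ fst (unpair w))), f := mark_tape m))"
        by (rule "1.IH") (use "1.prems" True in auto)
      then obtain m where m: "runs_in K B (Loop (\<lambda>s. s i \<noteq> 0 \<and> s f = 0) body) ?\<sigma>2 (7 * length w + 8)
         (?\<sigma>2(i := word_tape ((p @ [b, c]) @ w) (length ((p @ [b, c]) @ w) - length (snd (unpair w))),
           j := word_tape ((v @ [b]) @ fst (unpair w)) (length ((v @ [b]) @ fst (unpair w))), f := mark_tape m))"
        by blast
      show ?thesis
        by (rule exI[of _ m], rule runs_in_LoopT[OF a3 runs_in_eq[OF m]]) (use gd True "1.prems" in \<open>auto simp: fun_eq_iff\<close>)
    next
      case False
      let ?\<sigma>2 = "\<sigma>(i := word_tape (p @ b # c # w) (length p + 2),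
         j := word_tape v (length v), f := mark_tape 1)"
      have a2: "runs_in K B (Act (\<lambda>s l. if l = j then (0, 0) else if l = f then (1, 0)
              else (s l, if l = i \<and> s i \<noteq> 0 then 1 else 0))) ?\<sigma>1 1 ?\<sigma>2"
        by (rule runs_in_Act) (use "1.prems" si in \<open>auto simp: act_split scan_def fun_eq_iff word_tape_def blank_tape_def mark_tape_def\<close>)
      have a3: "runs_in K B body \<sigma> 4 ?\<sigma>2" unfolding body_def
        by (rule runs_in_Seq[OF a1 runs_in_CondF[OF a2]]) (use si False in auto)
      have "runs_in K B (Loop (\<lambda>s. s i \<noteq> 0 \<and> s f = 0) body) ?\<sigma>2 1 ?\<sigma>2"
        by (rule runs_in_LoopF) (use "1.prems" in \<open>auto simp: scan_def mark_tape_def\<close>)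
      then show ?thesis
        by (intro exI[of _ 1], intro runs_in_LoopT[OF a3 runs_in_eq]) (use gd False in \<open>auto simp: fun_eq_iff\<close>)
    qed
  next
    case "2_1"
    have "runs_in K B (Loop (\<lambda>s. s i \<noteq> 0 \<and> s f = 0) body) \<sigma> 8 \<sigma>"
      by (rule runs_in_LoopF) (use "2_1" in \<open>auto simp: scan_def\<close>)
    then show ?case using "2_1" by (intro exI[of _ 0]) (auto simp: mark_tape_0 fun_upd_idem)
  next
    case ("2_2" b)
    let ?\<sigma>1 = "\<sigma>(i := word_tape (p @ [b]) (length p + 1),
       j := ((cells v)(int (length v) := bit_sym b), int (length v)))"
    let ?\<sigma>2 = "\<sigma>(i := word_tape (p @ [b]) (length p + 1), j := word_tape v (length v), f := mark_tape 1)"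
    have a1: "runs_in K B (Act (\<lambda>s l. if l = j then (s i, 0) else (s l, if l = i then 1 else 0))) \<sigma> 1 ?\<sigma>1"
      by (rule runs_in_Act) (use "2_2" in \<open>auto simp: act_split scan_def fun_eq_iff word_tape_def\<close>)
    have si: "scan ?\<sigma>1 i = 0" "scan ?\<sigma>1 j = bit_sym b" "scan ?\<sigma>1 f = 0"
      using "2_2" cells_end[of "p @ [b]"]
      by (auto simp: scan_def add.commute blank_tape_def)
    have gd: "scan \<sigma> i \<noteq> 0 \<and> scan \<sigma> f = 0" using "2_2" by (simp add: scan_def blank_tape_def)
    have a2: "runs_in K B (Act (\<lambda>s l. if l = j then (0, 0) else if l = f then (1, 0)
              else (s l, if l = i \<and> s i \<noteq> 0 then 1 else 0))) ?\<sigma>1 1 ?\<sigma>2"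
      by (rule runs_in_Act) (use "2_2" si in \<open>auto simp: act_split scan_def fun_eq_iff word_tape_def blank_tape_def mark_tape_def\<close>)
    have a3: "runs_in K B body \<sigma> 4 ?\<sigma>2" unfolding body_def
      by (rule runs_in_Seq[OF a1 runs_in_CondF[OF a2]]) (use si in auto)
    have "runs_in K B (Loop (\<lambda>s. s i \<noteq> 0 \<and> s f = 0) body) ?\<sigma>2 1 ?\<sigma>2"
      by (rule runs_in_LoopF) (use "2_2" in \<open>auto simp: scan_def mark_tape_def\<close>)
    then show ?case
      by (intro exI[of _ 1], intro runs_in_LoopT[OF a3 runs_in_eq]) (use gd in \<open>auto simp: fun_eq_iff\<close>)
  qed
  then obtain m where m: "runs_in K B (Loop (\<lambda>s. s i \<noteq> 0 \<and> s f = 0) body) \<sigma> (7 * length s + 8)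
    (\<sigma>(i := word_tape (p @ s) (length (p @ s) - length (snd (unpair s))),
       j := word_tape (v @ fst (unpair s)) (length (v @ fst (unpair s))), f := mark_tape m))" by auto
  show ?thesis
    unfolding decode_fst_def body_def[symmetric]
    by (rule runs_in_Seq[OF m runs_in_eq[OF runs_in_set_mark]]) (use assms in \<open>auto simp: mark_tape_0 fun_eq_iff\<close>)
qed

definition decode_pair :: "nat \<Rightarrow> nat \<Rightarrow> nat \<Rightarrow> nat \<Rightarrow> prog" where
  "decode_pair i j l f = Seq (decode_fst i j f) (Seq (copy i l)
     (Seq (rewind i) (Seq (rewind j) (rewind l))))"

lemma runs_in_decode_pair:
  assumes "\<sigma> i = word_tape w 0" "\<sigma> j = blank_tape" "\<sigma> l = blank_tape" "\<sigma> f = blank_tape"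
    "distinct [i, j, l, f]" "length w \<le> B" "1 \<le> B"
  shows "runs_in K B (decode_pair i j l f) \<sigma> (19 * length w + 20)
    (\<sigma>(j := word_tape (fst (unpair w)) 0, l := word_tape (snd (unpair w)) 0))"
proof -
  \<comment> \<open>\<open>p\<close> is the part consumed by \<open>decode_fst\<close>; the head is
    left just behind it, so that \<open>copy\<close> transfers the second component.\<close>
  obtain p where p: "w = p @ snd (unpair w)" using unpair_suffix by blast
  then have lp: "length w - length (snd (unpair w)) = length p"
    by (metis add_diff_cancel_right' length_append)
  have le: "length (fst (unpair w)) + length (snd (unpair w)) \<le> length w" by (rule length_unpair)
  let ?f = "fst (unpair w)" and ?s = "snd (unpair w)"
  define \<sigma>1 where "\<sigma>1 = \<sigma>(i := word_tape w (length p), j := word_tape ?f (length ?f))"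
  define \<sigma>2 where "\<sigma>2 = \<sigma>(i := word_tape w (length w), j := word_tape ?f (length ?f), l := word_tape ?s (length ?s))"
  define \<sigma>3 where "\<sigma>3 = \<sigma>(j := word_tape ?f (length ?f), l := word_tape ?s (length ?s))"
  define \<sigma>4 where "\<sigma>4 = \<sigma>(j := word_tape ?f 0, l := word_tape ?s (length ?s))"
  have 1: "runs_in K B (decode_fst i j f) \<sigma> (7 * length w + 10) \<sigma>1"
    using runs_in_decode_fst[of \<sigma> i "[]" w j "[]" f B K] assms lp
    by (simp add: word_tape_Nil \<sigma>1_def)
  have 2: "runs_in K B (copy i l) \<sigma>1 (3 * length ?s + 1) \<sigma>2"
    by (rule runs_in_eq[OF runs_in_copy[where p = p and s = ?s and v = "[]"]])
      (use assms le in \<open>auto simp: \<sigma>1_def \<sigma>2_def word_tape_Nil p[symmetric]\<close>)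
  have 3: "runs_in K B (rewind i) \<sigma>2 (3 * length w + 3) \<sigma>3"
    by (rule runs_in_eq[OF runs_in_rewind]) (use assms in \<open>auto simp: \<sigma>2_def \<sigma>3_def fun_eq_iff\<close>)
  have 4: "runs_in K B (rewind j) \<sigma>3 (3 * length ?f + 3) \<sigma>4"
    by (rule runs_in_eq[OF runs_in_rewind]) (use assms in \<open>auto simp: \<sigma>3_def \<sigma>4_def fun_eq_iff\<close>)
  have 5: "runs_in K B (rewind l) \<sigma>4 (3 * length ?s + 3) (\<sigma>(j := word_tape ?f 0, l := word_tape ?s 0))"
    by (rule runs_in_eq[OF runs_in_rewind]) (use assms in \<open>auto simp: \<sigma>4_def fun_eq_iff\<close>)
  show ?thesis unfolding decode_pair_def
    by (rule runs_in_Seq[OF 1 runs_in_Seq[OF 2 runs_in_Seq[OF 3 runs_in_Seq[OF 4 5 order_refl] order_refl] order_refl]])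
      (use le in simp)
qed

lemma wf_decode [simp]:
  "i < T \<Longrightarrow> j < T \<Longrightarrow> f < T \<Longrightarrow> 1 < S \<Longrightarrow> wf_prog S T (decode_fst i j f)"
  "i < T \<Longrightarrow> j < T \<Longrightarrow> l < T \<Longrightarrow> f < T \<Longrightarrow> 1 < S \<Longrightarrow> wf_prog S T (decode_pair i j l f)"
  by (auto simp: decode_fst_def decode_pair_def)

lemma ask_free_decode [simp]: "ask_free (decode_fst i j f)" "ask_free (decode_pair i j l f)"
  by (auto simp: decode_fst_def decode_pair_def)

section \<open>Runs of oracle machines\<close>

definition wf_config :: "machine \<Rightarrow> config \<Rightarrow> bool" where
  "wf_config M cf \<longleftrightarrow> fst cf < states M \<and> length (snd cf) = tapes M \<and>
     (\<forall>(c, h) \<in> set (snd cf). \<forall>i. c i < symbols M)"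

definition halted :: "machine \<Rightarrow> nat \<Rightarrow> bool" where
  "halted M q \<longleftrightarrow> q = accept M \<or> q = reject M"

definition zero_outside :: "nat \<Rightarrow> tape list \<Rightarrow> bool" where
  "zero_outside D ts \<longleftrightarrow> (\<forall>(c, h) \<in> set ts. \<forall>i. int D < \<bar>i\<bar> \<longrightarrow> c i = 0)"

lemma bounded_tapes_nth: "bounded_tapes B ts \<longleftrightarrow> (\<forall>i<length ts. \<bar>snd (ts ! i)\<bar> \<le> int B)"
  by (force simp: bounded_tapes_def in_set_conv_nth case_prod_beta)

lemma zero_outside_nth:
  "zero_outside D ts \<longleftrightarrow> (\<forall>j<length ts. \<forall>i. int D < \<bar>i\<bar> \<longrightarrow> fst (ts ! j) i = 0)"
  by (force simp: zero_outside_def in_set_conv_nth case_prod_beta)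

lemma wf_config_nth:
  "wf_config M cf \<longleftrightarrow> fst cf < states M \<and> length (snd cf) = tapes M \<and>
     (\<forall>j<tapes M. \<forall>i. fst (snd cf ! j) i < symbols M)"
  by (force simp: wf_config_def in_set_conv_nth case_prod_beta)

lemma wf_config_init: "oracle_tm M \<Longrightarrow> wf_config M (init M x)"
  by (auto simp: wf_config_def init_def oracle_tm_def input_tape_def blank_tape_def)

lemma bounded_init: "bounded_tapes B (snd (init M x))"
  by (auto simp: bounded_tapes_def init_def input_tape_def blank_tape_def)

lemma zero_outside_init: "length x \<le> D \<Longrightarrow> zero_outside D (snd (init M x))"
  by (auto simp: zero_outside_def init_def input_tape_def blank_tape_def)

lemma step_halted1: "halted M q \<Longrightarrow> step M K (q, ts) = (q, ts)"
  by (auto simp: step_def halted_def)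

lemma step_query:
  "\<not> halted M q \<Longrightarrow> query M q = Some (y, n) \<Longrightarrow>
   step M K (q, ts) = (if nat_of_word (query_word (fst (ts ! 1))) \<in> K then y else n, ts)"
  by (auto simp: step_def halted_def)

lemma step_trans:
  "\<not> halted M q \<Longrightarrow> query M q = None \<Longrightarrow>
   step M K (q, ts) = (fst (trans M q (map (\<lambda>(c, h). c h) ts)), map2 act (snd (trans M q (map (\<lambda>(c, h). c h) ts))) ts)"
  by (auto simp: step_def halted_def Let_def split: prod.splits)

lemma trans_wf:
  assumes "oracle_tm M" "wf_config M (q, ts)"
  defines "r \<equiv> trans M q (map (\<lambda>(c, h). c h) ts)"
  shows "fst r < states M" "length (snd r) = tapes M"
    "\<And>i. i < tapes M \<Longrightarrow> fst (snd r ! i) < symbols M \<and> snd (snd r ! i) \<in> {-1, 0, 1}"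
proof -
  have "length (map (\<lambda>(c, h). c h) ts) = tapes M" "\<forall>s\<in>set (map (\<lambda>(c, h). c h) ts). s < symbols M" "q < states M"
    using assms(2) by (auto simp: wf_config_def)
  with assms(1) have *: "fst r < states M \<and> length (snd r) = tapes M \<and>
      (\<forall>(s, d) \<in> set (snd r). s < symbols M \<and> d \<in> {-1, 0, 1})"
    unfolding oracle_tm_def r_def by blast
  then show "fst r < states M" "length (snd r) = tapes M" by auto
  fix i assume "i < tapes M"
  with * have "snd r ! i \<in> set (snd r)" by simp
  with * show "fst (snd r ! i) < symbols M \<and> snd (snd r ! i) \<in> {-1, 0, 1}"
    by (auto simp: case_prod_beta)
qed

text \<open>Halting and query states leave the tapes alone, and all others perform one action per
  tape. The invariants of runs are checked against these two cases.\<close>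

lemma step_cases:
  assumes "oracle_tm M" "wf_config M (q, ts)"
  obtains (same) q' where "step M K (q, ts) = (q', ts)" "q' < states M"
  | (trans) r where "step M K (q, ts) = (fst r, map2 act (snd r) ts)" "fst r < states M"
      "length (snd r) = tapes M"
      "\<And>i. i < tapes M \<Longrightarrow> fst (snd r ! i) < symbols M \<and> snd (snd r ! i) \<in> {-1, 0, 1}"
proof (cases "halted M q")
  case True
  then show ?thesis using same assms by (auto simp: step_halted1 wf_config_def)
next
  case False
  show ?thesis
  proof (cases "query M q")
    case None
    show ?thesis by (rule trans[OF step_trans[OF False None]]) (use trans_wf[OF assms] in auto)
  next
    case (Some a)
    then obtain y n where a: "query M q = Some (y, n)" by (cases a) auto
    have "q < states M" using assms by (auto simp: wf_config_def)
    then have "y < states M" "n < states M" using assms(1) a unfolding oracle_tm_def by blast+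
    with step_query[OF False a, of K ts] show ?thesis
      using same[of "if nat_of_word (query_word (fst (ts ! 1))) \<in> K then y else n"] by auto
  qed
qed

lemma wf_config_step:
  assumes "oracle_tm M" "wf_config M cf"
  shows "wf_config M (step M K cf)"
proof -
  obtain q ts where cf: "cf = (q, ts)" by force
  show ?thesis
  proof (rule step_cases[of M q ts K])
    fix q' assume "step M K (q, ts) = (q', ts)" "q' < states M"
    then show ?thesis using assms cf by (auto simp: wf_config_def)
  next
    fix r assume "step M K (q, ts) = (fst r, map2 act (snd r) ts)" "fst r < states M"
      "length (snd r) = tapes M"
      "\<And>i. i < tapes M \<Longrightarrow> fst (snd r ! i) < symbols M \<and> snd (snd r ! i) \<in> {-1, 0, 1}"
    then show ?thesis using assms cf by (auto simp: wf_config_nth act_split)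
  qed (use assms cf in auto)
qed

lemma bounded_step:
  assumes "oracle_tm M" "wf_config M cf" "bounded_tapes B (snd cf)"
  shows "bounded_tapes (Suc B) (snd (step M K cf))"
proof -
  obtain q ts where cf: "cf = (q, ts)" by force
  show ?thesis
  proof (rule step_cases[of M q ts K])
    fix q' assume "step M K (q, ts) = (q', ts)" "q' < states M"
    then show ?thesis using assms cf by (force simp: bounded_tapes_def)
  next
    fix r assume r: "step M K (q, ts) = (fst r, map2 act (snd r) ts)" "fst r < states M"
      "length (snd r) = tapes M"
      "\<And>i. i < tapes M \<Longrightarrow> fst (snd r ! i) < symbols M \<and> snd (snd r ! i) \<in> {-1, 0, 1}"
    have l: "length ts = tapes M" using assms cf by (auto simp: wf_config_def)
    have "\<bar>snd (ts ! i) + snd (snd r ! i)\<bar> \<le> int (Suc B)" if "i < length ts" for i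
    proof -
      have "\<bar>snd (ts ! i)\<bar> \<le> int B" using assms(3) that cf by (simp add: bounded_tapes_nth)
      with r(4)[of i] that l show ?thesis by auto
    qed
    then show ?thesis using cf r(1,3) l by (auto simp: bounded_tapes_nth act_split)
  qed (use assms cf in auto)
qed

text \<open>A step writes only under the heads, and these are within distance \<open>D\<close>
  before the step.\<close>

lemma zero_outside_step:
  assumes "oracle_tm M" "wf_config M cf" "bounded_tapes D (snd cf)" "zero_outside D (snd cf)"
  shows "zero_outside D (snd (step M K cf))"
proof -
  obtain q ts where cf: "cf = (q, ts)" by force
  show ?thesis
  proof (rule step_cases[of M q ts K])
    fix q' assume "step M K (q, ts) = (q', ts)" "q' < states M"
    then show ?thesis using assms cf by (force simp: zero_outside_def)
  next
    fix r assume r: "step M K (q, ts) = (fst r, map2 act (snd r) ts)" "fst r < states M"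
      "length (snd r) = tapes M"
      "\<And>i. i < tapes M \<Longrightarrow> fst (snd r ! i) < symbols M \<and> snd (snd r ! i) \<in> {-1, 0, 1}"
    have l: "length ts = tapes M" using assms cf by (auto simp: wf_config_def)
    have "int D \<ge> \<bar>snd (ts ! i)\<bar>" if "i < length ts" for i
      using assms(3) that cf by (simp add: bounded_tapes_nth)
    then show ?thesis using assms(4) cf r(1,3) l by (force simp: zero_outside_nth act_split)
  qed (use assms cf in auto)
qed

lemma run_Suc: "run M K x (Suc t) = step M K (run M K x t)"
  by (simp add: run_def)

lemma wf_config_run: "oracle_tm M \<Longrightarrow> wf_config M (run M K x t)"
  by (induction t) (auto simp: run_def wf_config_init wf_config_step)

lemma bounded_run: "oracle_tm M \<Longrightarrow> bounded_tapes t (snd (run M K x t))"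
proof (induction t)
  case 0 then show ?case by (simp add: run_def bounded_init)
next
  case (Suc t) then show ?case by (simp add: run_Suc bounded_step wf_config_run)
qed

lemma zero_outside_run:
  assumes "oracle_tm M" "length x \<le> D" "\<And>u. u < t \<Longrightarrow> bounded_tapes D (snd (run M K x u))"
  shows "zero_outside D (snd (run M K x t))"
  using assms(3)
proof (induction t)
  case 0 then show ?case using assms(2) by (simp add: run_def zero_outside_init)
next
  case (Suc t) then show ?case using assms(1) by (simp add: run_Suc zero_outside_step wf_config_run)
qed

lemma run_halted:
  assumes "halted M (fst (run M K x t))" "t \<le> u"
  shows "run M K x u = run M K x t"
proof -
  have "run M K x (v + t) = run M K x t" for v
    using step_halted[of _ M v K] assms(1)
    unfolding run_def funpow_add o_def halted_def by (metis prod.collapse)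
  from this[of "u - t"] assms(2) show ?thesis by simp
qed

section \<open>Time bounds as space bounds; complements\<close>

lemma bounded_tapes_mono: "bounded_tapes B ts \<Longrightarrow> B \<le> C \<Longrightarrow> bounded_tapes C ts"
  by (force simp: bounded_tapes_def)

text \<open>A head moves at most one cell per step and rests after halting, so the polynomial for
  the time also bounds the space.\<close>

lemma P_rel_subset_PSPACE_rel: "P_rel K \<subseteq> PSPACE_rel K"
proof
  fix L assume "L \<in> P_rel K"
  then obtain M p where M: "oracle_tm M" "decides_in_time M K L (poly p)" by (auto simp: P_rel_def)
  have "decides_in_space M K L (poly p)"
    unfolding decides_in_space_def
  proof
    fix x
    obtain t where t: "t \<le> poly p (length x)" "fst (run M K x t) = verdict M L x"
      using M(2) unfolding decides_in_time_def by blast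
    have h: "halted M (fst (run M K x t))" by (simp add: t(2) halted_def verdict_def)
    have "bounded_tapes (poly p (length x)) (snd (run M K x u))" for u
    proof (cases "t \<le> u")
      case True
      then show ?thesis using run_halted[OF h True] bounded_run[OF M(1), of t K x] t(1)
        by (auto intro: bounded_tapes_mono)
    next
      case False
      then show ?thesis using bounded_run[OF M(1), of u K x] t(1) by (auto intro: bounded_tapes_mono)
    qed
    with t(2) show "(\<exists>t. fst (run M K x t) = verdict M L x) \<and>
         (\<forall>t. \<forall>(c, h)\<in>set (snd (run M K x t)). \<bar>h\<bar> \<le> int (poly p (length x)))"
      by (auto simp: bounded_tapes_def)
  qed
  with M(1) show "L \<in> PSPACE_rel K" unfolding PSPACE_rel_def by blast
qed

text \<open>Exchanging the accepting and the rejecting state leaves all runs unchanged, because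
  \<open>step\<close> treats the two alike.\<close>

lemma PSPACE_rel_uminus:
  assumes "L \<in> PSPACE_rel K"
  shows "- L \<in> PSPACE_rel K"
proof -
  obtain M p where M: "oracle_tm M" "decides_in_space M K L (poly p)"
    using assms by (auto simp: PSPACE_rel_def)
  define N where "N = M\<lparr>accept := reject M, reject := accept M\<rparr>"
  have N: "trans N = trans M" "query N = query M" "accept N = reject M" "reject N = accept M"
    "states N = states M" "symbols N = symbols M" "tapes N = tapes M" "start N = start M"
    by (simp_all add: N_def)
  then have "step N K = step M K" by (simp only: step_def disj_commute)
  moreover have "init N = init M" by (auto simp: N_def init_def fun_eq_iff)
  ultimately have r: "run N K x t = run M K x t" for x t by (simp add: run_def)
  have "oracle_tm N" using M(1) unfolding oracle_tm_def N
    by (elim conjE, intro conjI) (assumption | erule not_sym)+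
  moreover have "verdict N (- L) x = verdict M L x" for x by (simp add: verdict_def N)
  then have "decides_in_space N K (- L) (poly p)"
    using M(2) unfolding decides_in_space_def r by simp
  ultimately show ?thesis unfolding PSPACE_rel_def by blast
qed

subsection \<open>Simulating a machine by a program\<close>

text \<open>
  A configuration of a machine with \<open>k\<close> tapes is stored on tapes \<open>0, \<dots>, k - 1\<close>, its state on
  tape \<open>2 * k\<close>.  Tape \<open>k + i\<close> has a fixed inscription \<open>R\<close>; its head moves with that of tape \<open>i\<close>.
\<close>

definition sim_store :: "machine \<Rightarrow> (int \<Rightarrow> nat) \<Rightarrow> config \<Rightarrow> store \<Rightarrow> store" where
  "sim_store M R cf \<sigma> = (\<lambda>i. if i < tapes M then snd cf ! i
     else if i < 2 * tapes M then (R, snd (snd cf ! (i - tapes M)))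
     else if i = 2 * tapes M then mark_tape (fst cf) else \<sigma> i)"

text \<open>The common alphabet of a program is larger than that of the simulated machine, and
  \<open>oracle_tm\<close> says nothing about \<open>trans\<close> on foreign symbols. With this
  guard \<open>sim_step\<close> satisfies \<open>wf_prog\<close> on all scans.\<close>

definition valid_scan :: "machine \<Rightarrow> (nat \<Rightarrow> nat) \<Rightarrow> bool" where
  "valid_scan M s \<longleftrightarrow> s (2 * tapes M) < states M \<and> (\<forall>i<tapes M. s i < symbols M)"

definition sim_step :: "machine \<Rightarrow> prog" where
  "sim_step M = Act (\<lambda>s i.
     let k = tapes M; r = trans M (s (2 * k)) (map s [0..<k]) in
     if \<not> valid_scan M s then (s i, 0)
     else if i < k then snd r ! i
     else if i < 2 * k then (s i, snd (snd r ! (i - k)))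
     else if i = 2 * k then (fst r, 0)
     else (s i, 0))"

lemma ask_free_sim_step [simp]: "ask_free (sim_step M)"
  by (simp add: sim_step_def)

lemma wf_sim_step [simp]:
  assumes "oracle_tm M" "states M \<le> S" "symbols M \<le> S" "2 * tapes M < T"
  shows "wf_prog S T (sim_step M)"
  unfolding sim_step_def wf_prog.simps Let_def
proof (intro conjI allI impI)
  fix s i
  let ?r = "trans M (s (2 * tapes M)) (map s [0..<tapes M])"
  assume s: "\<forall>i. s i < S"
  have *: "fst ?r < states M \<and> length (snd ?r) = tapes M \<and>
      (\<forall>(s, d) \<in> set (snd ?r). s < symbols M \<and> d \<in> {-1, 0, 1})" if "valid_scan M s"
  proof -
    have "length (map s [0..<tapes M]) = tapes M \<and> (\<forall>x\<in>set (map s [0..<tapes M]). x < symbols M)"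
      "s (2 * tapes M) < states M" using that by (auto simp: valid_scan_def)
    with assms(1) show ?thesis unfolding oracle_tm_def by blast
  qed
  have nth: "fst (snd ?r ! j) < symbols M \<and> snd (snd ?r ! j) \<in> {-1, 0, 1}" if "valid_scan M s" "j < tapes M" for j
    using *[OF that(1)] that(2) nth_mem[of j "snd ?r"] by (auto simp: case_prod_beta)
  show "fst (if \<not> valid_scan M s then (s i, 0)
             else if i < tapes M then snd ?r ! i
                  else if i < 2 * tapes M then (s i, snd (snd ?r ! (i - tapes M)))
                       else if i = 2 * tapes M then (fst ?r, 0) else (s i, 0)) < S"
    using s * nth[of i] assms by (auto intro: less_le_trans)
  show "snd (if \<not> valid_scan M s then (s i, 0)
             else if i < tapes M then snd ?r ! i
                  else if i < 2 * tapes M then (s i, snd (snd ?r ! (i - tapes M)))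
                       else if i = 2 * tapes M then (fst ?r, 0) else (s i, 0)) \<in> {- 1, 0, 1}"
    using nth[of i] nth[of "i - tapes M"] by auto
qed (use assms in auto)

text \<open>\<open>K\<close> is the oracle of the simulating program and \<open>K'\<close> that of
  the simulated machine; they are independent because \<open>q\<close> is not a query state.\<close>

lemma runs_in_sim_step:
  assumes M: "oracle_tm M" "wf_config M (q, ts)" "\<not> halted M q" "query M q = None"
    and B: "bounded_tapes B (snd (step M K' (q, ts)))"
  shows "runs_in K B (sim_step M) (sim_store M R (q, ts) \<sigma>) 1 (sim_store M R (step M K' (q, ts)) \<sigma>)"
proof -
  let ?\<sigma> = "sim_store M R (q, ts) \<sigma>" and ?\<sigma>' = "sim_store M R (step M K' (q, ts)) \<sigma>"
  let ?r = "trans M q (map (\<lambda>(c, h). c h) ts)"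
  have l: "length ts = tapes M" and q: "q < states M"
    and sy: "\<And>j i. j < tapes M \<Longrightarrow> fst (ts ! j) i < symbols M"
    using M(2) by (auto simp: wf_config_nth)
  have sc: "scan ?\<sigma> (2 * tapes M) = q" "\<And>i. i < tapes M \<Longrightarrow> scan ?\<sigma> i = fst (ts ! i) (snd (ts ! i))"
    by (auto simp: scan_def sim_store_def)
  have ss: "map (scan ?\<sigma>) [0..<tapes M] = map (\<lambda>(c, h). c h) ts"
    by (rule nth_equalityI) (auto simp: l sc case_prod_beta)
  have v: "valid_scan M (scan ?\<sigma>)"
    using q sy by (auto simp: valid_scan_def sc)
  note tw = trans_wf[OF M(1,2)]
  note st = step_trans[OF M(3,4), of K' ts]
  have l': "length (snd (step M K' (q, ts))) = tapes M" using tw l by (simp add: st)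
  have b: "\<bar>snd (snd (step M K' (q, ts)) ! i)\<bar> \<le> int B" if "i < tapes M" for i
    using B that l' by (simp add: bounded_tapes_nth)
  show ?thesis unfolding sim_step_def Let_def sc(1) ss
  proof (rule runs_in_Act)
    show "?\<sigma>' = (\<lambda>i. act (if \<not> valid_scan M (scan ?\<sigma>) then (scan ?\<sigma> i, 0)
             else if i < tapes M then snd (trans M (scan ?\<sigma> (2 * tapes M)) (map (scan ?\<sigma>) [0..<tapes M])) ! i
             else if i < 2 * tapes M then (scan ?\<sigma> i, snd (snd (trans M (scan ?\<sigma> (2 * tapes M)) (map (scan ?\<sigma>) [0..<tapes M])) ! (i - tapes M)))
                  else if i = 2 * tapes M then (fst (trans M (scan ?\<sigma> (2 * tapes M)) (map (scan ?\<sigma>) [0..<tapes M])), 0) else (scan ?\<sigma> i, 0))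
            (?\<sigma> i))"
      unfolding ss sc(1) using v tw l
      by (intro ext) (auto simp: st sim_store_def act_split scan_def mark_tape_def)
    fix i
    assume "(if \<not> valid_scan M (scan ?\<sigma>) then (scan ?\<sigma> i, 0)
             else if i < tapes M then snd (trans M (scan ?\<sigma> (2 * tapes M)) (map (scan ?\<sigma>) [0..<tapes M])) ! i
             else if i < 2 * tapes M then (scan ?\<sigma> i, snd (snd (trans M (scan ?\<sigma> (2 * tapes M)) (map (scan ?\<sigma>) [0..<tapes M])) ! (i - tapes M)))
                  else if i = 2 * tapes M then (fst (trans M (scan ?\<sigma> (2 * tapes M)) (map (scan ?\<sigma>) [0..<tapes M])), 0) else (scan ?\<sigma> i, 0))
         \<noteq> (scan ?\<sigma> i, 0)"
    then have "i \<le> 2 * tapes M" using v by (auto split: if_splits)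
    then show "\<bar>snd (?\<sigma>' i)\<bar> \<le> int B"
      using b[of i] b[of "i - tapes M"] by (auto simp: sim_store_def)
  qed
qed

definition sim_plain :: "machine \<Rightarrow> prog" where
  "sim_plain M = Loop (\<lambda>s. \<not> halted M (s (2 * tapes M))) (sim_step M)"

text \<open>Induction on \<open>t\<close>, where the head bound \<open>b\<close> grows by one per
  step. If the machine halts before time \<open>t\<close>, the loop stops early and the
  configuration no longer changes.\<close>

lemma runs_in_sim_plain:
  assumes "plain_tm M" "wf_config M cf" "bounded_tapes b (snd cf)" "b + t \<le> B"
    and "halted M (fst ((step M K' ^^ t) cf))"
  shows "\<exists>ts'. runs_in K B (sim_plain M) (sim_store M R cf \<sigma>) (3 * t + 1)
    (sim_store M R (fst ((step M K' ^^ t) cf), ts') \<sigma>)"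
  using assms(2-)
proof (induction t arbitrary: cf b)
  case 0
  then show ?case unfolding sim_plain_def
    by (intro exI[of _ "snd cf"] runs_in_eq[OF runs_in_LoopF]) (auto simp: scan_def sim_store_def)
next
  case (Suc t)
  obtain q ts where cf: "cf = (q, ts)" by force
  have M: "oracle_tm M" "query M q = None" using assms(1) by (auto simp: plain_tm_def)
  show ?case
  proof (cases "halted M q")
    case True
    then show ?thesis unfolding sim_plain_def cf using step_halted[of q M "Suc t" K' ts]
      by (intro exI[of _ ts] runs_in_eq[OF runs_in_LoopF]) (auto simp: scan_def sim_store_def halted_def)
  next
    case False
    let ?cf = "step M K' cf"
    have "bounded_tapes (Suc b) (snd ?cf)" using bounded_step[OF M(1) Suc.prems(1,2)] .
    moreover have "wf_config M ?cf" using wf_config_step[OF M(1) Suc.prems(1)] .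
    moreover have "halted M (fst ((step M K' ^^ t) ?cf))"
      using Suc.prems(4) by (simp add: funpow_swap1)
    ultimately obtain ts' where
      2: "runs_in K B (sim_plain M) (sim_store M R ?cf \<sigma>) (3 * t + 1)
        (sim_store M R (fst ((step M K' ^^ t) ?cf), ts') \<sigma>)"
      using Suc.IH[of ?cf "Suc b"] Suc.prems(3) by auto
    have 1: "runs_in K B (sim_step M) (sim_store M R cf \<sigma>) 1 (sim_store M R ?cf \<sigma>)"
      unfolding cf
      by (rule runs_in_sim_step[OF M(1) Suc.prems(1)[unfolded cf] False M(2)])
        (use \<open>bounded_tapes (Suc b) (snd ?cf)\<close> Suc.prems(3) in \<open>auto simp: cf intro: bounded_tapes_mono\<close>)
    have "runs_in K B (sim_plain M) (sim_store M R cf \<sigma>) (3 * Suc t + 1)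
        (sim_store M R (fst ((step M K' ^^ t) ?cf), ts') \<sigma>)"
      unfolding sim_plain_def
      by (rule runs_in_LoopT[OF 1 2[unfolded sim_plain_def]]) (use False in \<open>auto simp: cf scan_def sim_store_def\<close>)
    then show ?thesis by (auto simp: funpow_swap1)
  qed
qed

lemma query_word_cells: "query_word (cells u) = u"
proof -
  have L: "(LEAST n. cells u (int n) \<notin> {1, 2}) = length u"
  proof (rule Least_equality)
    show "cells u (int (length u)) \<notin> {1, 2}" by simp
    fix n assume "cells u (int n) \<notin> {1, 2}"
    then show "length u \<le> n"
      by (rule contrapos_np) (simp add: cells_nth bit_sym_def)
  qed
  show ?thesis unfolding query_word_def L
    by (rule nth_equalityI) (auto simp: cells_nth bit_sym_def)
qed

section \<open>Combining an oracle query with a level of the polynomial hierarchy\<close>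

text \<open>The first bit of \<open>v\<close> claims an answer to the query given by the remaining bits.\<close>

definition claim :: "nat set \<Rightarrow> word \<Rightarrow> bool" where
  "claim K v \<longleftrightarrow> v \<noteq> [] \<and> (hd v \<longleftrightarrow> nat_of_word (tl v) \<in> K)"

text \<open>Each quantifier of a level pairs one more witness to the right of the word. Below
  \<open>j\<close> quantifiers the original word is therefore the \<open>j\<close>-fold first
  component, and its own second component is the claim.\<close>

fun iterate_fst :: "nat \<Rightarrow> word \<Rightarrow> word" where
  "iterate_fst 0 w = w"
| "iterate_fst (Suc j) w = iterate_fst j (fst (unpair w))"

lemma length_iterate_fst: "length (iterate_fst j w) \<le> length w"
proof (induction j arbitrary: w)
  case (Suc j)
  from Suc[of "fst (unpair w)"] length_unpair[of w] show ?case by simp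
qed simp

definition nested_claim :: "nat set \<Rightarrow> nat \<Rightarrow> word \<Rightarrow> bool" where
  "nested_claim K j w \<longleftrightarrow> claim K (snd (unpair (iterate_fst j w)))"

lemma nested_claim_pair: "nested_claim K (Suc j) (pair w y) = nested_claim K j w"
  by (simp add: nested_claim_def)

text \<open>Every first component goes to a fresh tape, \<open>e + 1\<close>, \<open>e + 2\<close>
  and so on, and the word it came from stays behind; \<open>l\<close> only receives second
  components that are thrown away.\<close>

fun strip :: "nat \<Rightarrow> nat \<Rightarrow> nat \<Rightarrow> nat \<Rightarrow> prog" where
  "strip l f e 0 = skip"
| "strip l f e (Suc m) = Seq (decode_pair e (e + 1) l f) (Seq (clear l) (strip l f (e + 1) m))"

lemma wf_strip [simp]: "l < T \<Longrightarrow> f < T \<Longrightarrow> e + m < T \<Longrightarrow> 1 < S \<Longrightarrow> wf_prog S T (strip l f e m)"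
  by (induction m arbitrary: e) auto

lemma runs_in_strip:
  assumes "\<sigma> e = word_tape w 0" "\<And>i. e < i \<Longrightarrow> \<sigma> i = blank_tape" "\<sigma> l = blank_tape" "\<sigma> f = blank_tape"
    "l \<noteq> f" "l < e" "f < e" "length w \<le> B" "1 \<le> B"
  shows "\<exists>\<sigma>'. runs_in K B (strip l f e m) \<sigma> (m * (25 * length w + 24) + 1) \<sigma>' \<and> (\<forall>i<e. \<sigma>' i = \<sigma> i) \<and>
     \<sigma>' (e + m) = word_tape (iterate_fst m w) 0 \<and> (\<forall>i>e + m. \<sigma>' i = blank_tape)"
  using assms
proof (induction m arbitrary: w \<sigma> e)
  case 0
  have "runs_in K B (strip l f e 0) \<sigma> (0 * (25 * length w + 24) + 1) \<sigma>"
    unfolding strip.simps by (rule runs_in_weaken[OF runs_in_skip]) simp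
  with 0 show ?case by (intro exI[of _ \<sigma>]) simp
next
  case (Suc m)
  have le: "length (fst (unpair w)) \<le> length w" "length (snd (unpair w)) \<le> length w"
    using length_unpair[of w] by auto
  let ?\<sigma>1 = "\<sigma>(e + 1 := word_tape (fst (unpair w)) 0, l := word_tape (snd (unpair w)) 0)"
  let ?\<sigma>2 = "\<sigma>(e + 1 := word_tape (fst (unpair w)) 0)"
  have 1: "runs_in K B (decode_pair e (e + 1) l f) \<sigma> (19 * length w + 20) ?\<sigma>1"
    by (rule runs_in_decode_pair) (use Suc.prems in auto)
  have 2: "runs_in K B (clear l) ?\<sigma>1 (6 * length w + 4) ?\<sigma>2"
    by (rule runs_in_weaken[OF runs_in_eq[OF runs_in_clear[where u = "snd (unpair w)" and n = 0]]]) (use Suc.prems le in \<open>auto simp: fun_eq_iff\<close>)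
  have "\<exists>\<sigma>'. runs_in K B (strip l f (e + 1) m) ?\<sigma>2 (m * (25 * length (fst (unpair w)) + 24) + 1) \<sigma>' \<and>
     (\<forall>i<e + 1. \<sigma>' i = ?\<sigma>2 i) \<and>
     \<sigma>' (e + 1 + m) = word_tape (iterate_fst m (fst (unpair w))) 0 \<and> (\<forall>i>e + 1 + m. \<sigma>' i = blank_tape)"
    by (rule Suc.IH) (use Suc.prems le in auto)
  then obtain \<sigma>' where 3: "runs_in K B (strip l f (e + 1) m) ?\<sigma>2 (m * (25 * length (fst (unpair w)) + 24) + 1) \<sigma>'"
    "\<forall>i<e + 1. \<sigma>' i = ?\<sigma>2 i"
    "\<sigma>' (e + 1 + m) = word_tape (iterate_fst m (fst (unpair w))) 0"
    "\<forall>i>e + 1 + m. \<sigma>' i = blank_tape" by blast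
  have 4: "runs_in K B (strip l f (e + 1) m) ?\<sigma>2 (m * (25 * length w + 24) + 1) \<sigma>'"
    by (rule runs_in_weaken[OF 3(1)]) (use le in simp)
  have "runs_in K B (strip l f e (Suc m)) \<sigma> (Suc m * (25 * length w + 24) + 1) \<sigma>'"
    unfolding strip.simps by (rule runs_in_Seq[OF 1 runs_in_Seq[OF 2 4 order_refl]]) simp
  then show ?case using 3 by (intro exI[of _ \<sigma>']) auto
qed

text \<open>The claim is settled before the simulation of \<open>N\<close>, because tape
  \<open>1\<close> is the query tape and also a work tape of \<open>N\<close>. It is cleared after
  the query, the outcome waits in register \<open>a\<close>, and \<open>N\<close> is then run on all
  of \<open>w\<close>. The connective \<open>f\<close> is applied by the final test.\<close>

lemma base_level:
  assumes "L \<in> PTIME"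
  shows "{w. f (nested_claim K j w) (w \<in> L)} \<in> P_rel K"
proof -
  obtain N p where N: "plain_tm N" "decides_in_time N {} L (poly p)"
    using assms unfolding PTIME_def by blast
  have orN: "oracle_tm N" using N(1) by (simp add: plain_tm_def)
  define k where "k = tapes N"
  have k2: "2 \<le> k" and an: "accept N \<noteq> reject N" and "start N < states N"
    using orN by (auto simp: k_def oracle_tm_def)
  define a where "a = 2 * k + 1"
  define fl where "fl = 2 * k + 2"
  define l where "l = 2 * k + 3"
  define e where "e = 2 * k + 4"
  define T where "T = e + j + 2"
  \<comment> \<open>Besides the symbols of \<open>N\<close>, the alphabet contains the states of
    \<open>N\<close>, which are kept in a register, and the mark \<open>3\<close> of register
    \<open>a\<close>.\<close>
  define S where "S = states N + symbols N + 4"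
  note defs = a_def fl_def l_def e_def T_def
  \<comment> \<open>Register \<open>a\<close> first holds the claimed bit as symbol \<open>1\<close>
    or \<open>2\<close>; after the query, \<open>3\<close> stands for a correct claim and
    \<open>1\<close> for a false one. For an empty claim it stays blank, in agreement with
    \<open>claim\<close>, which is false there.\<close>
  define ask where "ask = Cond (\<lambda>s. s l = 0) skip
    (Seq (emit a (\<lambda>s. s l) 0) (Seq (move {l} 1) (Seq (copy l 1)
      (Seq (Ask (emit a (\<lambda>s. if s a = 2 then 3 else 1) 0) (emit a (\<lambda>s. if s a = 2 then 1 else 3) 0))
        (clear 1)))))"
  define prog where "prog = Seq (copy 0 e) (Seq (rewind 0) (Seq (rewind e)
     (Seq (strip l fl e j) (Seq (decode_pair (e + j) (e + j + 1) l fl)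
       (Seq ask (Seq (emit (2 * k) (\<lambda>_. start N) 0) (sim_plain N)))))))"
  define fin where "fin = (\<lambda>s :: nat \<Rightarrow> nat. f (s a = 3) (s (2 * k) = accept N))"
  have wf: "wf_prog S T prog"
    unfolding prog_def ask_def sim_plain_def using k2 orN \<open>start N < states N\<close>
    by (simp add: S_def defs k_def[symmetric])
  \<comment> \<open>The terms in \<open>j\<close> come from \<open>strip\<close>, the factor
    \<open>3\<close> from the cost of a loop round per simulated step; the rest is generous.\<close>
  define r where "r = [:24 * j + 100:] + [:0, 25 * j + 100:] + [:3:] * p"
  show ?thesis
  proof (rule P_relI[OF wf, where r = r and c = fin])
    fix w :: word
    define n where "n = length w"
    obtain t where t: "t \<le> poly p n" "fst (run N {} w t) = verdict N L w"
      using N(2) unfolding decides_in_time_def n_def by blast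
    define B where "B = n + t + 2"
    define u where "u = iterate_fst j w"
    define v where "v = snd (unpair u)"
    have lu: "length u \<le> n" unfolding u_def n_def by (rule length_iterate_fst)
    have lv: "length v \<le> n" unfolding v_def using length_unpair[of u] lu by simp
    have B: "n \<le> B" "1 \<le> B" by (auto simp: B_def)
    let ?i = "init_store w"
    define \<sigma>1 where "\<sigma>1 = ?i(0 := word_tape w n, e := word_tape w n)"
    define \<sigma>2 where "\<sigma>2 = ?i(e := word_tape w n)"
    define \<sigma>3 where "\<sigma>3 = ?i(e := word_tape w 0)"
    have 1: "runs_in K B (copy 0 e) ?i (3 * n + 1) \<sigma>1"
      using runs_in_copy[of ?i 0 "[]" w e "[]" B K] B
      by (simp add: init_store_def input_tape_word word_tape_Nil e_def \<sigma>1_def n_def)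
    have 2: "runs_in K B (rewind 0) \<sigma>1 (3 * n + 3) \<sigma>2"
      by (rule runs_in_eq[OF runs_in_rewind]) (use B in \<open>auto simp: \<sigma>1_def \<sigma>2_def n_def e_def init_store_def input_tape_word\<close>)
    have 3: "runs_in K B (rewind e) \<sigma>2 (3 * n + 3) \<sigma>3"
      by (rule runs_in_eq[OF runs_in_rewind]) (use B in \<open>auto simp: \<sigma>2_def \<sigma>3_def n_def\<close>)
    have "\<exists>\<sigma>'. runs_in K B (strip l fl e j) \<sigma>3 (j * (25 * length w + 24) + 1) \<sigma>' \<and> (\<forall>i<e. \<sigma>' i = \<sigma>3 i) \<and>
       \<sigma>' (e + j) = word_tape (iterate_fst j w) 0 \<and> (\<forall>i>e + j. \<sigma>' i = blank_tape)"
      by (rule runs_in_strip) (use B in \<open>auto simp: \<sigma>3_def defs init_store_def n_def\<close>)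
    then obtain \<sigma>4 where 4: "runs_in K B (strip l fl e j) \<sigma>3 (j * (25 * n + 24) + 1) \<sigma>4"
      and \<sigma>4: "\<And>i. i < e \<Longrightarrow> \<sigma>4 i = ?i i" "\<sigma>4 (e + j) = word_tape u 0" "\<And>i. i > e + j \<Longrightarrow> \<sigma>4 i = blank_tape"
      by (auto simp: \<sigma>3_def u_def n_def)
    define \<sigma>5 where "\<sigma>5 = \<sigma>4(e + j + 1 := word_tape (fst (unpair u)) 0, l := word_tape v 0)"
    have 5: "runs_in K B (decode_pair (e + j) (e + j + 1) l fl) \<sigma>4 (19 * n + 20) \<sigma>5"
      by (rule runs_in_weaken[OF runs_in_eq[OF runs_in_decode_pair]])
        (use \<sigma>4 B lu in \<open>auto simp: \<sigma>5_def v_def defs init_store_def\<close>)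
    have "\<exists>\<sigma>6 b. runs_in K B ask \<sigma>5 (9 * n + 20) \<sigma>6 \<and> (\<forall>i<a. \<sigma>6 i = ?i i) \<and>
        \<sigma>6 a = mark_tape b \<and> (b = 3 \<longleftrightarrow> claim K v)"
    proof (cases v)
      case Nil
      have "runs_in K B ask \<sigma>5 (9 * n + 20) \<sigma>5" unfolding ask_def
        by (rule runs_in_CondT[OF runs_in_skip]) (simp_all add: \<sigma>5_def Nil scan_def word_tape_Nil blank_tape_def)
      then show ?thesis using \<sigma>4 Nil
        by (intro exI[of _ \<sigma>5] exI[of _ 0]) (auto simp: claim_def \<sigma>5_def defs init_store_def mark_tape_0)
    next
      case (Cons c z)
      have k1: "1 < e" "1 \<noteq> l" "1 \<noteq> a" using k2 by (auto simp: defs)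
      have zn: "length z + 1 \<le> n" using lv Cons by simp
      have dis: "a \<noteq> l" "l \<noteq> e + j + 1" "a \<noteq> e + j + 1" "1 \<noteq> e + j + 1" "l < e" "a < e" "l \<noteq> 0" "a \<noteq> 0" "l > a"
        by (auto simp: defs)
      define b where "b = (if claim K v then 3 else 1 :: nat)"
      define \<tau>1 where "\<tau>1 = \<sigma>5(a := mark_tape (bit_sym c))"
      define \<tau>2 where "\<tau>2 = \<tau>1(l := word_tape (c # z) 1)"
      define \<tau>3 where "\<tau>3 = \<tau>1(l := word_tape (c # z) (length (c # z)), 1 := word_tape z (length z))"
      define \<tau>4 where "\<tau>4 = \<tau>3(a := mark_tape b)"
      have \<sigma>5l: "\<sigma>5 l = word_tape (c # z) 0" using dis by (simp add: \<sigma>5_def Cons)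
      have \<sigma>5a: "\<sigma>5 a = mark_tape 0" "\<sigma>5 1 = blank_tape" using dis k1 \<sigma>4 by (auto simp: \<sigma>5_def init_store_def mark_tape_0)
      have t1: "runs_in K B (emit a (\<lambda>s. s l) 0) \<sigma>5 1 \<tau>1"
        by (rule runs_in_eq[OF runs_in_set_mark[where v = 0]]) (simp_all add: \<tau>1_def scan_def \<sigma>5a \<sigma>5l cells_nth)
      have t2: "runs_in K B (move {l} 1) \<tau>1 1 \<tau>2"
        by (rule runs_in_eq[OF runs_in_move1]) (use dis B \<sigma>5l in \<open>auto simp: \<tau>1_def \<tau>2_def word_tape_def\<close>)
      have t3: "runs_in K B (copy l 1) \<tau>2 (3 * length z + 1) \<tau>3"
        by (rule runs_in_eq[OF runs_in_copy[where p = "[c]" and v = "[]" and s = z]])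
          (use dis k1 \<sigma>5a zn B in \<open>auto simp: \<tau>1_def \<tau>2_def \<tau>3_def word_tape_Nil\<close>)
      have an3: "answer K \<tau>3 \<longleftrightarrow> nat_of_word z \<in> K"
        by (simp add: answer_def \<tau>3_def query_word_cells)
      have a3: "\<tau>3 a = mark_tape (bit_sym c)" using dis k1 by (simp add: \<tau>3_def \<tau>1_def)
      then have s3: "scan \<tau>3 a = bit_sym c" by (simp add: scan_def)
      have t4: "runs_in K B (Ask (emit a (\<lambda>s. if s a = 2 then 3 else 1) 0) (emit a (\<lambda>s. if s a = 2 then 1 else 3) 0)) \<tau>3 3 \<tau>4"
        by (rule runs_in_Ask, rule_tac[1-2] runs_in_eq[OF runs_in_set_mark[where v = "bit_sym c"]])
          (auto simp: a3 \<tau>4_def b_def claim_def Cons an3 s3 bit_sym_def split: if_splits)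
      have t5: "runs_in K B (clear 1) \<tau>4 (6 * length z + 4) (\<tau>4(1 := blank_tape))"
        by (rule runs_in_clear) (use k1 zn B in \<open>auto simp: \<tau>4_def \<tau>3_def\<close>)
      have t: "runs_in K B ask \<sigma>5 (9 * n + 20) (\<tau>4(1 := blank_tape))"
        unfolding ask_def
        by (rule runs_in_CondF[OF runs_in_Seq[OF t1 runs_in_Seq[OF t2 runs_in_Seq[OF t3 runs_in_Seq[OF t4 t5 order_refl] order_refl] order_refl] order_refl]])
          (use zn \<sigma>5l in \<open>auto simp: scan_def cells_nth\<close>)
      have "(\<tau>4(1 := blank_tape)) i = ?i i" if "i < a" for i
        using that dis \<sigma>4 k1 by (auto simp: \<tau>4_def \<tau>3_def \<tau>1_def \<sigma>5_def init_store_def)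
      with t k1 show ?thesis
        by (intro exI[of _ "\<tau>4(1 := blank_tape)"] exI[of _ b]) (auto simp: \<tau>4_def b_def)
    qed
    then obtain \<sigma>6 b where 6: "runs_in K B ask \<sigma>5 (9 * n + 20) \<sigma>6" "\<And>i. i < a \<Longrightarrow> \<sigma>6 i = ?i i"
      "\<sigma>6 a = mark_tape b" "b = 3 \<longleftrightarrow> claim K v" by blast
    have sa: "scan \<sigma>6 a = 3 \<longleftrightarrow> claim K v" using 6(3,4) by (simp add: scan_def)
    define \<sigma>7 where "\<sigma>7 = \<sigma>6(2 * k := mark_tape (start N))"
    have 7: "runs_in K B (emit (2 * k) (\<lambda>_. start N) 0) \<sigma>6 1 \<sigma>7"
      unfolding \<sigma>7_def using k2 by (intro runs_in_set_mark[where v = 0]) (simp add: 6 a_def init_store_def mark_tape_0)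
    \<comment> \<open>The companion tapes are blank here: \<open>N\<close> has a time bound of its
      own and needs no rulers.\<close>
    have \<sigma>7: "\<sigma>7 = sim_store N (\<lambda>_. 0) (init N w) \<sigma>7"
      using k2 by (auto simp: fun_eq_iff sim_store_def init_def \<sigma>7_def k_def[symmetric] 6 a_def init_store_def
          blank_tape_def nth_Cons' input_tape_def)
    have "\<exists>ts'. runs_in K B (sim_plain N) (sim_store N (\<lambda>_. 0) (init N w) \<sigma>7) (3 * t + 1)
          (sim_store N (\<lambda>_. 0) (fst ((step N {} ^^ t) (init N w)), ts') \<sigma>7)"
      by (rule runs_in_sim_plain[OF N(1) wf_config_init[OF orN] bounded_init, where b = 0])
        (use t in \<open>auto simp: B_def run_def[symmetric] halted_def verdict_def\<close>)
    then obtain ts' where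
      8: "runs_in K B (sim_plain N) \<sigma>7 (3 * t + 1) (sim_store N (\<lambda>_. 0) (verdict N L w, ts') \<sigma>7)"
      using t(2) \<sigma>7 by (auto simp: run_def)
    let ?\<sigma>8 = "sim_store N (\<lambda>_. 0) (verdict N L w, ts') \<sigma>7"
    have "runs_in K B prog ?i (poly r n) ?\<sigma>8"
      unfolding prog_def
      by (rule runs_in_Seq[OF 1 runs_in_Seq[OF 2 runs_in_Seq[OF 3 runs_in_Seq[OF 4 runs_in_Seq[OF 5 runs_in_Seq[OF 6(1) runs_in_Seq[OF 7 8
        order_refl] order_refl] order_refl] order_refl] order_refl] order_refl]])
        (use t(1) in \<open>auto simp: r_def algebra_simps\<close>)
    moreover have "heads_le B ?i"
      by (auto simp: heads_le_def init_store_def input_tape_def blank_tape_def)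
    moreover have "fin (scan ?\<sigma>8) \<longleftrightarrow> w \<in> {w. f (nested_claim K j w) (w \<in> L)}"
    proof -
      have "scan ?\<sigma>8 a = scan \<sigma>6 a" by (auto simp: scan_def sim_store_def k_def[symmetric] a_def \<sigma>7_def)
      moreover have "scan ?\<sigma>8 (2 * k) = verdict N L w" by (auto simp: scan_def sim_store_def k_def[symmetric])
      ultimately show ?thesis using an
        by (simp add: fin_def sa nested_claim_def u_def[symmetric] v_def[symmetric] verdict_def)
    qed
    ultimately show "\<exists>B \<sigma>'. exec K B prog ?i (poly r (length w)) \<sigma>' \<and> (fin (scan \<sigma>') \<longleftrightarrow> w \<in> {w. f (nested_claim K j w) (w \<in> L)})"
      unfolding runs_in_def n_def by blast
  qed (use k2 in \<open>auto simp: S_def T_def e_def\<close>)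
qed

text \<open>The two forms are proved together because the complement in each level exchanges them:
  \<open>claim \<longrightarrow> (\<exists>y. y \<notin> R)\<close> is the existence of
  \<open>y\<close> with \<open>\<not> (claim \<and> y \<in> R)\<close>, and dually. The depth
  \<open>j\<close> grows by one with each quantifier removed, since the claim moves one pairing
  further inside.\<close>

lemma level_with_claim:
  assumes "L \<in> Sigma_level PTIME k"
  shows "{w. nested_claim K j w \<longrightarrow> w \<in> L} \<in> Sigma_level (P_rel K) k \<and>
    {w. nested_claim K j w \<and> w \<in> L} \<in> Sigma_level (P_rel K) k"
  using assms
proof (induction k arbitrary: L j)
  case 0
  then show ?case using base_level[of L "(\<longrightarrow>)" K j] base_level[of L "(\<and>)" K j] by simp
next
  case (Suc k)
  then obtain p R where R: "R \<in> Sigma_level PTIME k"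
    "\<And>x. x \<in> L \<longleftrightarrow> (\<exists>y. length y \<le> poly p (length x) \<and> pair x y \<notin> R)"
    by auto
  note IH = Suc.IH[OF R(1), of "Suc j"]
  have SucI: "{x. Q x} \<in> Sigma_level (P_rel K) (Suc k)"
    if "R' \<in> Sigma_level (P_rel K) k"
      "\<And>x. Q x \<longleftrightarrow> (\<exists>y. length y \<le> poly p (length x) \<and> pair x y \<in> - R')" for Q R'
    unfolding Sigma_level.simps using that by blast
  have "{w. nested_claim K j w \<longrightarrow> w \<in> L} \<in> Sigma_level (P_rel K) (Suc k)"
  proof (rule SucI[OF IH[THEN conjunct2]])
    fix x
    show "(nested_claim K j x \<longrightarrow> x \<in> L) \<longleftrightarrow> (\<exists>y. length y \<le> poly p (length x) \<and>
        pair x y \<in> - {w. nested_claim K (Suc j) w \<and> w \<in> R})"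
      \<comment> \<open>If the claim fails, any witness will do; the empty word shows that the range
        of the quantifier is not empty.\<close>
      unfolding R(2)[of x] using exI[of "\<lambda>y. length y \<le> poly p (length x)" "[]"]
      by (auto simp: nested_claim_pair)
  qed
  moreover have "{w. nested_claim K j w \<and> w \<in> L} \<in> Sigma_level (P_rel K) (Suc k)"
    by (rule SucI[OF IH[THEN conjunct1]]) (auto simp: R(2) nested_claim_pair)
  ultimately show ?case by simp
qed

section \<open>Counters, pairs and rulers\<close>

lemma runs_eq: "runs K B p \<sigma> \<sigma>' \<Longrightarrow> \<sigma>' = \<sigma>'' \<Longrightarrow> runs K B p \<sigma> \<sigma>''"
  by simp

lemma runs_skip: "runs K B skip \<sigma> \<sigma>"
  by (rule runsI[OF runs_in_skip])

lemma runs_set_mark: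
  assumes "\<sigma> i = mark_tape v" "\<sigma>' = \<sigma>(i := mark_tape (g (scan \<sigma>)))"
  shows "runs K B (emit i g 0) \<sigma> \<sigma>'"
  unfolding assms(2) by (rule runsI[OF runs_in_set_mark[of \<sigma> i v]]) (rule assms(1))

lemma runs_emit:
  assumes "\<sigma> i = (c, h)" "\<bar>h + d\<bar> \<le> int B" "\<sigma>' = \<sigma>(i := (c(h := g (scan \<sigma>)), h + d))"
  shows "runs K B (emit i g d) \<sigma> \<sigma>'"
  unfolding assms(3) using assms runs_in_emit[of \<sigma> i d B K g] by (intro runsI[of _ _ _ _ 1]) simp

lemma runs_move1:
  assumes "\<sigma> i = (c, h)" "\<bar>h + d\<bar> \<le> int B" "\<sigma>' = \<sigma>(i := (c, h + d))"
  shows "runs K B (move {i} d) \<sigma> \<sigma>'"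
  unfolding assms(3) using assms runs_in_move1[of \<sigma> i d B K] by (intro runsI[of _ _ _ _ 1]) simp

lemma runs_rewind:
  assumes "\<sigma> i = word_tape u n" "n \<le> length u" "1 \<le> B" "\<sigma>' = \<sigma>(i := word_tape u 0)"
  shows "runs K B (rewind i) \<sigma> \<sigma>'"
  unfolding assms(4) by (rule runsI[OF runs_in_rewind]) (use assms in auto)

lemma runs_clear:
  assumes "\<sigma> i = word_tape u n" "n \<le> length u" "length u \<le> B" "1 \<le> B" "\<sigma>' = \<sigma>(i := blank_tape)"
  shows "runs K B (clear i) \<sigma> \<sigma>'"
  unfolding assms(5) by (rule runsI[OF runs_in_clear]) (use assms in auto)

lemma runs_copy:
  assumes "\<sigma> i = word_tape (p @ s) (length p)" "\<sigma> j = word_tape v (length v)" "i \<noteq> j"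
    "length (p @ s) \<le> B" "length (v @ s) \<le> B"
    "\<sigma>' = \<sigma>(i := word_tape (p @ s) (length (p @ s)), j := word_tape (v @ s) (length (v @ s)))"
  shows "runs K B (copy i j) \<sigma> \<sigma>'"
  unfolding assms(6) by (rule runsI[OF runs_in_copy]) (use assms in auto)

text \<open>The heads in \<open>I\<close> move in lockstep, but tape \<open>i\<close> alone decides
  when to stop; \<open>n\<close> is the number of cells passed until \<open>P\<close> fails
  there.\<close>

lemma runs_seek:
  assumes "i \<in> I" "\<And>j. j < n \<Longrightarrow> P (fst (\<sigma> i) (snd (\<sigma> i) + d * int j))"
    "\<not> P (fst (\<sigma> i) (snd (\<sigma> i) + d * int n))"
    "\<And>l j. l \<in> I \<Longrightarrow> j \<le> n \<Longrightarrow> \<bar>snd (\<sigma> l) + d * int j\<bar> \<le> int B"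
    "\<sigma>' = (\<lambda>l. if l \<in> I then (fst (\<sigma> l), snd (\<sigma> l) + d * int n) else \<sigma> l)"
  shows "runs K B (Loop (\<lambda>s. P (s i)) (move I d)) \<sigma> \<sigma>'"
  using assms(2-)
proof (induction n arbitrary: \<sigma>)
  case 0
  have "\<sigma>' = \<sigma>" using 0(4) by auto
  then show ?case using 0 by (simp add: runs_LoopF scan_def)
next
  case (Suc n)
  let ?\<sigma> = "\<lambda>l. if l \<in> I then (fst (\<sigma> l), snd (\<sigma> l) + d) else \<sigma> l"
  have 1: "runs K B (move I d) \<sigma> ?\<sigma>"
    by (rule runsI[OF runs_in_move]) (use Suc.prems(3)[where j = 1] in simp)
  have d: "d * int (Suc j) = d + d * int j" for j by (simp add: algebra_simps)
  have 2: "runs K B (Loop (\<lambda>s. P (s i)) (move I d)) ?\<sigma> \<sigma>'"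
  proof (rule Suc.IH)
    show "P (fst (?\<sigma> i) (snd (?\<sigma> i) + d * int j))" if "j < n" for j
      using Suc.prems(1)[of "Suc j"] that assms(1) unfolding d by (simp add: add.assoc)
    show "\<not> P (fst (?\<sigma> i) (snd (?\<sigma> i) + d * int n))"
      using Suc.prems(2) assms(1) unfolding d by (simp add: add.assoc)
    show "\<bar>snd (?\<sigma> l) + d * int j\<bar> \<le> int B" if "l \<in> I" "j \<le> n" for l j
      using Suc.prems(3)[of l "Suc j"] that unfolding d by (simp add: add.assoc)
    show "\<sigma>' = (\<lambda>l. if l \<in> I then (fst (?\<sigma> l), snd (?\<sigma> l) + d * int n) else ?\<sigma> l)"
      unfolding Suc.prems(4) d by (auto simp: add.assoc)
  qed
  show ?case
    by (rule runs_LoopT[OF 1 2]) (use Suc.prems(1)[of 0] in \<open>simp add: scan_def\<close>)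
qed

fun repeat :: "nat \<Rightarrow> prog \<Rightarrow> prog" where
  "repeat 0 p = skip"
| "repeat (Suc n) p = Seq (repeat n p) p"

fun seq_upto :: "(nat \<Rightarrow> prog) \<Rightarrow> nat \<Rightarrow> prog" where
  "seq_upto p 0 = skip"
| "seq_upto p (Suc n) = Seq (seq_upto p n) (p n)"

lemma runs_seq_upto:
  "(\<And>i. i < n \<Longrightarrow> runs K B (p i) (g i) (g (Suc i))) \<Longrightarrow> runs K B (seq_upto p n) (g 0) (g n)"
  by (induction n) (auto intro: runs_skip runs_Seq)

lemma wf_seq_upto [simp]: "wf_prog S T (seq_upto p n) \<longleftrightarrow> (\<forall>i<n. wf_prog S T (p i))"
  by (induction n) (auto simp: less_Suc_eq)

lemma ask_free_seq_upto [simp]: "ask_free (seq_upto p n) \<longleftrightarrow> (\<forall>i<n. ask_free (p i))"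
  by (induction n) (auto simp: less_Suc_eq)

lemma wf_repeat [simp]: "wf_prog S T p \<Longrightarrow> wf_prog S T (repeat n p)"
  by (induction n) auto

lemma ask_free_repeat [simp]: "ask_free p \<Longrightarrow> ask_free (repeat n p)"
  by (induction n) auto

definition for_each :: "nat \<Rightarrow> prog \<Rightarrow> prog" where
  "for_each b p = Seq (Loop (\<lambda>s. s b \<noteq> 0) (Seq p (move {b} 1))) (rewind b)"

text \<open>The word on tape \<open>b\<close> serves as a unary number. \<open>F m\<close> is the
  content of tape \<open>r\<close> after \<open>m\<close> units of progress, in the uses a unary
  word or a ruler; the cap \<open>M\<close> limits the demands on \<open>p\<close> to results that
  fit within the head bound.\<close>

lemma runs_for_each:
  assumes b: "\<sigma> b = word_tape x 0" "r \<noteq> b"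
    and p: "\<And>m h. m + c \<le> M \<Longrightarrow> h < length x \<Longrightarrow>
       runs K B p (\<sigma>(b := word_tape x h, r := F m)) (\<sigma>(b := word_tape x h, r := F (m + c)))"
    and B: "length x \<le> B" "1 \<le> B" and m: "\<sigma> r = F m" "m + length x * c \<le> M"
  shows "runs K B (for_each b p) \<sigma> (\<sigma>(r := F (m + length x * c)))"
proof -
  \<comment> \<open>Generalized to the suffix \<open>z\<close> of cells still to be visited.\<close>
  have loop: "runs K B (Loop (\<lambda>s. s b \<noteq> 0) (Seq p (move {b} 1)))
      (\<sigma>(b := word_tape x (length y), r := F m')) (\<sigma>(b := word_tape x (length x), r := F (m' + length z * c)))"
    if "x = y @ z" "m' + length z * c \<le> M" for y z m'
    using that
  proof (induction z arbitrary: y m')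
    case Nil
    then show ?case using b by (intro runs_eq[OF runs_LoopF]) (auto simp: scan_def)
  next
    case (Cons a z)
    have h: "length y < length x" using Cons.prems by simp
    have 1: "runs K B p (\<sigma>(b := word_tape x (length y), r := F m')) (\<sigma>(b := word_tape x (length y), r := F (m' + c)))"
      by (rule p[OF _ h]) (use Cons.prems in simp)
    have 2: "runs K B (move {b} 1) (\<sigma>(b := word_tape x (length y), r := F (m' + c)))
       (\<sigma>(b := word_tape x (length (y @ [a])), r := F (m' + c)))"
      by (rule runs_move1[where c = "cells x" and h = "int (length y)"])
        (use b B h in \<open>auto simp: word_tape_def fun_eq_iff\<close>)
    have 3: "runs K B (Loop (\<lambda>s. s b \<noteq> 0) (Seq p (move {b} 1)))
      (\<sigma>(b := word_tape x (length (y @ [a])), r := F (m' + c)))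
      (\<sigma>(b := word_tape x (length x), r := F (m' + c + length z * c)))"
      by (rule Cons.IH) (use Cons.prems in auto)
    show ?case
      by (rule runs_eq[OF runs_LoopT[OF runs_Seq[OF 1 2] 3]])
        (use b Cons.prems in \<open>auto simp: scan_def algebra_simps\<close>)
  qed
  have 1: "runs K B (Loop (\<lambda>s. s b \<noteq> 0) (Seq p (move {b} 1))) \<sigma>
     (\<sigma>(b := word_tape x (length x), r := F (m + length x * c)))"
    using loop[of "[]" x m] m b by (simp add: fun_upd_idem)
  have 2: "runs K B (rewind b) (\<sigma>(b := word_tape x (length x), r := F (m + length x * c)))
     (\<sigma>(r := F (m + length x * c)))"
    by (rule runs_rewind[where u = x and n = "length x"]) (use b B in \<open>auto simp: fun_eq_iff\<close>)
  show ?thesis unfolding for_each_def by (rule runs_Seq[OF 1 2])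
qed

text \<open>
  The body is executed \<open>p(n)\<close> times, where \<open>p\<close> has the coefficient list \<open>cs\<close> and the tapes
  \<open>b, b + 1, \<dots>\<close> hold words of length \<open>n\<close>: one nested loop per degree, as in Horner's scheme.
\<close>

fun for_poly :: "nat list \<Rightarrow> nat \<Rightarrow> prog \<Rightarrow> prog" where
  "for_poly [] b p = skip"
| "for_poly (c # cs) b p = Seq (repeat c p) (for_each b (for_poly cs (b + 1) p))"

fun horner :: "nat list \<Rightarrow> nat \<Rightarrow> nat" where
  "horner [] n = 0"
| "horner (c # cs) n = c + n * horner cs n"

lemma horner_coeffs: "horner (coeffs p) n = poly p n"
  by (induction p) (auto simp: cCons_def coeffs_eq_Nil[symmetric] simp del: coeffs_eq_Nil)

lemma runs_repeat:
  assumes p: "\<And>m \<sigma>. m < M \<Longrightarrow> \<sigma> r = F m \<Longrightarrow> runs K B p \<sigma> (\<sigma>(r := F (Suc m)))"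
    and "\<sigma> r = F m" "m + c \<le> M"
  shows "runs K B (repeat c p) \<sigma> (\<sigma>(r := F (m + c)))"
  using assms(3)
proof (induction c)
  case 0
  then show ?case using assms(2) runs_skip[of K B \<sigma>] by (simp add: fun_upd_idem)
next
  case (Suc c)
  have 1: "runs K B (repeat c p) \<sigma> (\<sigma>(r := F (m + c)))"
    by (rule Suc.IH) (use Suc.prems in simp)
  have 2: "runs K B p (\<sigma>(r := F (m + c))) (\<sigma>(r := F (m + c), r := F (Suc (m + c))))"
    by (rule p) (use Suc.prems in auto)
  show ?case
    unfolding repeat.simps by (rule runs_eq[OF runs_Seq[OF 1 2]]) (simp add: fun_eq_iff)
qed

text \<open>Nested loops need independent heads, hence one tape per coefficient. The body is assumed
  to work from every store with the right content on tape \<open>r\<close>, since it is reached with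
  the counter heads in varying positions.\<close>

lemma runs_for_poly:
  assumes p: "\<And>m \<sigma>. m < M \<Longrightarrow> \<sigma> r = F m \<Longrightarrow> runs K B p \<sigma> (\<sigma>(r := F (Suc m)))"
    and B: "length x \<le> B" "1 \<le> B"
    and "\<And>i. i < length cs \<Longrightarrow> \<sigma> (b + i) = word_tape x 0" "r < b" "\<sigma> r = F m"
    "m + horner cs (length x) \<le> M"
  shows "runs K B (for_poly cs b p) \<sigma> (\<sigma>(r := F (m + horner cs (length x))))"
  using assms(4-)
proof (induction cs arbitrary: b m \<sigma>)
  case Nil
  then show ?case using runs_skip[of K B \<sigma>] by (simp add: fun_upd_idem)
next
  case (Cons c cs)
  let ?h = "horner cs (length x)"
  let ?\<sigma>1 = "\<sigma>(r := F (m + c))"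
  have 1: "runs K B (repeat c p) \<sigma> ?\<sigma>1"
    by (rule runs_repeat[where M = M and F = F]) (use p Cons.prems in auto)
  have 2: "runs K B (for_each b (for_poly cs (b + 1) p)) ?\<sigma>1 (?\<sigma>1(r := F (m + c + length x * ?h)))"
  proof (rule runs_for_each[where M = M and F = F])
    fix m' h assume m': "m' + ?h \<le> M" "h < length x"
    let ?\<tau> = "?\<sigma>1(b := word_tape x h, r := F m')"
    have "runs K B (for_poly cs (b + 1) p) ?\<tau> (?\<tau>(r := F (m' + ?h)))"
      by (rule Cons.IH) (use Cons.prems(1)[of "Suc _"] Cons.prems m' in auto)
    then show "runs K B (for_poly cs (b + 1) p) ?\<tau> (?\<sigma>1(b := word_tape x h, r := F (m' + ?h)))"
      using Cons.prems by simp
  qed (use Cons.prems(1)[of 0] Cons.prems B in \<open>auto simp: algebra_simps\<close>)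
  show ?case
    unfolding for_poly.simps by (rule runs_eq[OF runs_Seq[OF 1 2]]) (simp add: add.assoc fun_eq_iff)
qed

lemma wf_for_each [simp]: "b < T \<Longrightarrow> wf_prog S T p \<Longrightarrow> wf_prog S T (for_each b p)"
  by (auto simp: for_each_def)

lemma ask_free_for_each [simp]: "ask_free p \<Longrightarrow> ask_free (for_each b p)"
  by (auto simp: for_each_def)

lemma wf_for_poly [simp]: "b + length cs \<le> T \<Longrightarrow> wf_prog S T p \<Longrightarrow> wf_prog S T (for_poly cs b p)"
  by (induction cs arbitrary: b) auto

definition unary_tape :: "nat \<Rightarrow> tape" where
  "unary_tape m = word_tape (replicate m False) 0"

definition append_mark :: "nat \<Rightarrow> prog" where
  "append_mark r = Seq (Loop (\<lambda>s. s r \<noteq> 0) (move {r} 1)) (Seq (emit r (\<lambda>_. 1) 0) (rewind r))"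

lemma runs_to_end:
  assumes "\<sigma> i = word_tape u 0" "length u \<le> B" "\<sigma>' = \<sigma>(i := word_tape u (length u))"
  shows "runs K B (Loop (\<lambda>s. s i \<noteq> 0) (move {i} 1)) \<sigma> \<sigma>'"
  unfolding assms(3) using runs_in_to_end[of \<sigma> i "[]" u B K] assms by (intro runsI) auto

lemma runs_append_mark:
  assumes "\<sigma> r = unary_tape m" "m < B"
  shows "runs K B (append_mark r) \<sigma> (\<sigma>(r := unary_tape (Suc m)))"
proof -
  let ?u = "replicate m False"
  have u: "replicate (Suc m) False = ?u @ [False]" by (simp add: replicate_append_same)
  have 1: "runs K B (Loop (\<lambda>s. s r \<noteq> 0) (move {r} 1)) \<sigma> (\<sigma>(r := word_tape ?u m))"
    by (rule runs_to_end[where u = ?u]) (use assms in \<open>auto simp: unary_tape_def\<close>)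
  have 2: "runs K B (emit r (\<lambda>_. 1) 0) (\<sigma>(r := word_tape ?u m)) (\<sigma>(r := word_tape (?u @ [False]) m))"
    by (rule runs_emit[where c = "cells ?u" and h = "int m"])
      (use assms cells_snoc[of ?u False] in \<open>auto simp: word_tape_def bit_sym_def\<close>)
  have 3: "runs K B (rewind r) (\<sigma>(r := word_tape (?u @ [False]) m)) (\<sigma>(r := unary_tape (Suc m)))"
    by (rule runs_rewind[where u = "?u @ [False]" and n = m])
      (use assms in \<open>auto simp: unary_tape_def u simp del: replicate.simps\<close>)
  show ?thesis unfolding append_mark_def by (rule runs_Seq[OF 1 runs_Seq[OF 2 3]])
qed

lemma wf_append_mark [simp]: "r < T \<Longrightarrow> 1 < S \<Longrightarrow> wf_prog S T (append_mark r)"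
  and ask_free_append_mark [simp]: "ask_free (append_mark r)"
  by (auto simp: append_mark_def)

subsection \<open>Counting through all words up to a given length\<close>

text \<open>The successor in the numeration by \<open>nat_of_word\<close>: digit 2 turns into digit
  1 with a carry. Starting from the empty word it runs through all words in order of length, which
  serves both the clock and the search for witnesses.\<close>

fun inc :: "word \<Rightarrow> word" where
  "inc [] = [False]"
| "inc (b # u) = (if b then False # inc u else True # u)"

lemma nat_of_word_inc: "nat_of_word (inc u) = Suc (nat_of_word u)"
  by (induction u) auto

lemma nat_of_word_bounds: "2 ^ length u \<le> Suc (nat_of_word u)" "nat_of_word u + 2 \<le> 2 ^ Suc (length u)"
  by (induction u) auto

text \<open>These words form an initial segment of the enumeration; the largest, \<open>m\<close>
  times digit 2, has number \<open>2 ^ Suc m - 2\<close>.\<close>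

lemma length_le_iff: "length u \<le> m \<longleftrightarrow> nat_of_word u + 2 \<le> 2 ^ Suc m"
proof
  assume "length u \<le> m"
  then have "(2::nat) ^ Suc (length u) \<le> 2 ^ Suc m" by (intro power_increasing) auto
  with nat_of_word_bounds(2)[of u] show "nat_of_word u + 2 \<le> 2 ^ Suc m" by linarith
next
  assume *: "nat_of_word u + 2 \<le> 2 ^ Suc m"
  show "length u \<le> m"
  proof (rule ccontr)
    assume "\<not> length u \<le> m"
    then have "(2::nat) ^ Suc m \<le> 2 ^ length u" by (intro power_increasing) auto
    with nat_of_word_bounds(1)[of u] * show False by linarith
  qed
qed

fun ones :: "word \<Rightarrow> nat" where
  "ones [] = 0"
| "ones (b # u) = (if b then Suc (ones u) else 0)"

lemma ones_le: "ones u \<le> length u"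
  by (induction u) auto

lemma inc_split: "inc u = (case drop (ones u) u of [] \<Rightarrow> replicate (length u) False @ [False]
   | b # v \<Rightarrow> replicate (ones u) False @ True # v)"
proof (induction u)
  case (Cons b u)
  then show ?case by (cases b; cases "drop (ones u) u") simp_all
qed simp

text \<open>Tape \<open>r\<close> bears a unary limit and its head accompanies that of tape
  \<open>i\<close>. If both heads see a blank after the carries, the new digit would exceed the
  limit and \<open>overflow\<close> is run instead. The way back is controlled by tape
  \<open>r\<close>, which has marks in all cells passed.\<close>

definition inc_word :: "nat \<Rightarrow> nat \<Rightarrow> prog \<Rightarrow> prog" where
  "inc_word i r overflow =
     Seq (Loop (\<lambda>s. s i = 2) (Act (\<lambda>s l. if l = i then (1, 1) else (s l, if l = r then 1 else 0))))
     (Seq (Cond (\<lambda>s. s i = 0 \<and> s r = 0) overflow (emit i (\<lambda>s. if s i = 0 then 1 else 2) 0))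
     (Seq (move {i, r} (-1)) (Seq (Loop (\<lambda>s. s r \<noteq> 0) (move {i, r} (-1))) (move {i, r} 1))))"

lemma wf_inc_word [simp]:
  "i < T \<Longrightarrow> r < T \<Longrightarrow> 2 < S \<Longrightarrow> wf_prog S T p \<Longrightarrow> wf_prog S T (inc_word i r p)"
  and ask_free_inc_word [simp]: "ask_free p \<Longrightarrow> ask_free (inc_word i r p)"
  by (auto simp: inc_word_def)

lemma runs_inc_carry:
  assumes "\<sigma> i = word_tape (p @ u) (length p)" "\<sigma> r = (c, int (length p))" "i \<noteq> r"
    "length (p @ u) \<le> B"
  shows "runs K B (Loop (\<lambda>s. s i = 2) (Act (\<lambda>s l. if l = i then (1, 1) else (s l, if l = r then 1 else 0)))) \<sigma>
    (\<sigma>(i := word_tape (p @ replicate (ones u) False @ drop (ones u) u)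
          (length p + ones u),
       r := (c, int (length p + ones u))))"
  using assms
proof (induction u arbitrary: p \<sigma>)
  case Nil
  then show ?case by (intro runs_eq[OF runs_LoopF]) (auto simp: scan_def fun_eq_iff)
next
  case (Cons b u)
  show ?case
  proof (cases b)
    case False
    with Cons.prems show ?thesis by (intro runs_eq[OF runs_LoopF]) (auto simp: scan_def bit_sym_def fun_eq_iff)
  next
    case True
    let ?\<sigma> = "\<sigma>(i := word_tape ((p @ [False]) @ u) (length (p @ [False])), r := (c, int (length (p @ [False]))))"
    have up: "(cells (p @ b # u))(int (length p) := 1) = cells ((p @ [False]) @ u)"
      by (auto simp: cells_nth fun_eq_iff nth_append nth_Cons' bit_sym_def)
    have 1: "runs K B (Act (\<lambda>s l. if l = i then (1, 1) else (s l, if l = r then 1 else 0))) \<sigma> ?\<sigma>"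
      by (rule runsI[OF runs_in_Act]) (use Cons.prems up in \<open>auto simp: act_split scan_def word_tape_def intro!: ext\<close>)
    show ?thesis
      by (rule runs_LoopT[OF 1 runs_eq[OF Cons.IH[where p = "p @ [False]"]]])
        (use Cons.prems True in \<open>auto simp: scan_def bit_sym_def fun_eq_iff\<close>)
  qed
qed

text \<open>Overflow can occur only if \<open>u\<close> consists of \<open>m\<close> digits
  \<open>True\<close>. All of them have carried by then, so \<open>m\<close> digits
  \<open>False\<close> are left behind; \<open>overflow\<close> acts at an intermediate store, of
  which it may use the content of its own tape \<open>o'\<close> only.\<close>

lemma runs_inc_word:
  assumes "\<sigma> i = word_tape u 0" "\<sigma> r = unary_tape m" "i \<noteq> r" "length u \<le> m" "m < B"
  shows "length (inc u) \<le> m \<Longrightarrow> runs K B (inc_word i r p) \<sigma> (\<sigma>(i := word_tape (inc u) 0))"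
    and "m < length (inc u) \<Longrightarrow> (\<And>\<tau>. \<tau> o' = \<sigma> o' \<Longrightarrow> runs K B p \<tau> (\<tau>(o' := x))) \<Longrightarrow> o' \<noteq> i \<Longrightarrow> o' \<noteq> r
      \<Longrightarrow> runs K B (inc_word i r p) \<sigma> (\<sigma>(i := word_tape (replicate m False) 0, o' := x))"
proof -
  let ?m = "replicate m False"
  define n where "n = ones u"
  define v where "v = replicate n False @ drop (ones u) u"
  define \<sigma>1 where "\<sigma>1 = \<sigma>(i := word_tape v n, r := word_tape ?m n)"
  have lv: "length v = length u"
    using ones_le[of u] by (simp add: v_def n_def)
  have n: "n \<le> length u" by (simp add: n_def ones_le)
  have 1: "runs K B (Loop (\<lambda>s. s i = 2) (Act (\<lambda>s l. if l = i then (1, 1) else (s l, if l = r then 1 else 0)))) \<sigma> \<sigma>1"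
    using runs_inc_carry[of \<sigma> i "[]" u r "cells ?m" B K] assms
    by (simp add: \<sigma>1_def unary_tape_def word_tape_def v_def n_def)
  have ret: "runs K B (Seq (move {i, r} (-1)) (Seq (Loop (\<lambda>s. s r \<noteq> 0) (move {i, r} (-1))) (move {i, r} 1))) \<tau>
     (\<tau>(i := (c, 0), r := unary_tape m))" if \<tau>: "\<tau> i = (c, int n)" "\<tau> r = word_tape ?m n" for \<tau> c
  proof -
    define \<tau>1 where "\<tau>1 = \<tau>(i := (c, int n - 1), r := (cells ?m, int n - 1))"
    define \<tau>2 where "\<tau>2 = \<tau>(i := (c, -1), r := (cells ?m, -1))"
    have a: "runs K B (move {i, r} (-1)) \<tau> \<tau>1"
      by (rule runs_eq[OF runsI[OF runs_in_move]]) (use \<tau> assms n in \<open>auto simp: \<tau>1_def word_tape_def\<close>)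
    have b: "runs K B (Loop (\<lambda>s. s r \<noteq> 0) (move {i, r} (-1))) \<tau>1 \<tau>2"
      by (rule runs_seek[where n = n])
        (use assms n in \<open>auto simp: \<tau>1_def \<tau>2_def cells_nth fun_eq_iff\<close>)
    have d: "runs K B (move {i, r} 1) \<tau>2 (\<tau>(i := (c, 0), r := unary_tape m))"
      by (rule runs_eq[OF runsI[OF runs_in_move]]) (use assms in \<open>auto simp: \<tau>2_def word_tape_def unary_tape_def\<close>)
    show ?thesis by (rule runs_Seq[OF a runs_Seq[OF b d]])
  qed
  have sr: "scan \<sigma>1 r = (if n < m then 1 else 0)" by (simp add: \<sigma>1_def scan_def cells_nth bit_sym_def)
  have si: "scan \<sigma>1 i = cells v (int n)" using assms by (simp add: \<sigma>1_def scan_def)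
  have dw: "n = length u \<longleftrightarrow> drop (ones u) u = []"
    using ones_le[of u] by (auto simp: n_def)
  {
    assume le: "length (inc u) \<le> m"
    have c: "\<not> (scan \<sigma>1 i = 0 \<and> scan \<sigma>1 r = 0)"
    proof
      assume *: "scan \<sigma>1 i = 0 \<and> scan \<sigma>1 r = 0"
      then have "n = length u" using lv n by (auto simp: si cells_nth split: if_splits)
      then have "length (inc u) = Suc (length u)" using dw by (simp add: inc_split)
      with le * sr \<open>n = length u\<close> show False by (auto split: if_splits)
    qed
    let ?\<sigma>2 = "\<sigma>1(i := word_tape (inc u) n)"
    have up: "(cells v)(int n := (if cells v (int n) = 0 then 1 else 2)) = cells (inc u)"
    proof (cases "drop (ones u) u")
      case Nil
      then have nu: "n = length u" using dw by simp
      then have "cells v (int n) = 0" using lv by (simp add: cells_nth)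
      then show ?thesis using cells_snoc[of v False] lv Nil nu by (simp add: inc_split v_def bit_sym_def)
    next
      case (Cons b w)
      then show ?thesis unfolding v_def inc_split
        by (auto simp: cells_nth fun_eq_iff nth_append nth_Cons' bit_sym_def n_def)
    qed
    have 2: "runs K B (Cond (\<lambda>s. s i = 0 \<and> s r = 0) p (emit i (\<lambda>s. if s i = 0 then 1 else 2) 0)) \<sigma>1 ?\<sigma>2"
      by (rule runs_CondF[OF runs_emit[where c = "cells v" and h = "int n"]])
        (use assms n c up si in \<open>auto simp: \<sigma>1_def word_tape_def\<close>)
    have 3: "runs K B (Seq (move {i, r} (-1)) (Seq (Loop (\<lambda>s. s r \<noteq> 0) (move {i, r} (-1))) (move {i, r} 1))) ?\<sigma>2
       (\<sigma>(i := word_tape (inc u) 0))"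
      by (rule runs_eq[OF ret[where c = "cells (inc u)"]])
        (use assms in \<open>auto simp: \<sigma>1_def word_tape_def fun_eq_iff\<close>)
    show "runs K B (inc_word i r p) \<sigma> (\<sigma>(i := word_tape (inc u) 0))"
      unfolding inc_word_def by (rule runs_Seq[OF 1 runs_Seq[OF 2 3]])
  }
  {
    assume lt: "m < length (inc u)" and p: "\<And>\<tau>. \<tau> o' = \<sigma> o' \<Longrightarrow> runs K B p \<tau> (\<tau>(o' := x))"
      and o: "o' \<noteq> i" "o' \<noteq> r"
    \<comment> \<open>The length grows only if every digit carries.\<close>
    have nil: "drop (ones u) u = []"
    proof (rule ccontr)
      assume ne: "drop (ones u) u \<noteq> []"
      then have "length (inc u) = length u"
        unfolding inc_split using ones_le[of u]
        by (cases "drop (ones u) u") (auto dest!: arg_cong[where f = length])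
      with lt assms show False by simp
    qed
    then have nu: "n = length u" using dw by simp
    then have "length (inc u) = Suc (length u)" using nil by (simp add: inc_split)
    with lt assms(4) nu have m: "n = m" by simp
    have v: "v = ?m" using nil m by (simp add: v_def)
    let ?\<sigma>2 = "\<sigma>1(o' := x)"
    have 2: "runs K B (Cond (\<lambda>s. s i = 0 \<and> s r = 0) p (emit i (\<lambda>s. if s i = 0 then 1 else 2) 0)) \<sigma>1 ?\<sigma>2"
      by (rule runs_CondT[OF p])
        (use assms m v o in \<open>auto simp: \<sigma>1_def sr si cells_nth scan_def\<close>)
    have 3: "runs K B (Seq (move {i, r} (-1)) (Seq (Loop (\<lambda>s. s r \<noteq> 0) (move {i, r} (-1))) (move {i, r} 1))) ?\<sigma>2
       (\<sigma>(i := word_tape ?m 0, o' := x))"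
      by (rule runs_eq[OF ret[where c = "cells ?m"]])
        (use assms o v in \<open>auto simp: \<sigma>1_def word_tape_def fun_eq_iff\<close>)
    show "runs K B (inc_word i r p) \<sigma> (\<sigma>(i := word_tape ?m 0, o' := x))"
      unfolding inc_word_def by (rule runs_Seq[OF 1 runs_Seq[OF 2 3]])
  }
qed

subsection \<open>Writing a pair\<close>

definition double :: "nat \<Rightarrow> nat \<Rightarrow> prog" where
  "double i j = Loop (\<lambda>s. s i \<noteq> 0) (Seq (emit j (\<lambda>s. s i) 1) (copy_cell {i} i j))"

definition write_pair :: "nat \<Rightarrow> nat \<Rightarrow> nat \<Rightarrow> prog" where
  "write_pair i j l = Seq (double i l) (Seq (emit l (\<lambda>_. 1) 1) (Seq (emit l (\<lambda>_. 2) 1)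
     (Seq (copy j l) (Seq (rewind i) (Seq (rewind j) (rewind l))))))"

lemma wf_write_pair [simp]: "i < T \<Longrightarrow> j < T \<Longrightarrow> l < T \<Longrightarrow> 2 < S \<Longrightarrow> wf_prog S T (write_pair i j l)"
  by (auto simp: write_pair_def double_def)

lemma runs_double:
  assumes "\<sigma> i = word_tape (p @ x) (length p)" "\<sigma> j = word_tape v (length v)" "i \<noteq> j"
    "length (p @ x) \<le> B" "length v + 2 * length x \<le> B"
  shows "runs K B (double i j) \<sigma> (\<sigma>(i := word_tape (p @ x) (length (p @ x)),
      j := word_tape (v @ concat (map (\<lambda>b. [b, b]) x)) (length v + 2 * length x)))"
  using assms unfolding double_def
proof (induction x arbitrary: p v \<sigma>)
  case Nil
  then show ?case by (intro runs_eq[OF runs_LoopF]) (auto simp: scan_def fun_eq_iff)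
next
  case (Cons b x)
  let ?\<sigma>1 = "\<sigma>(j := word_tape (v @ [b]) (length (v @ [b])))"
  let ?\<sigma>2 = "\<sigma>(i := word_tape ((p @ [b]) @ x) (length (p @ [b])), j := word_tape ((v @ [b]) @ [b]) (length ((v @ [b]) @ [b])))"
  have 1: "runs K B (emit j (\<lambda>s. s i) 1) \<sigma> ?\<sigma>1"
    by (rule runs_emit[where c = "cells v" and h = "int (length v)"])
      (use Cons.prems in \<open>auto simp: word_tape_def scan_def cells_snoc\<close>)
  have 2: "runs K B (copy_cell {i} i j) ?\<sigma>1 ?\<sigma>2"
    by (rule runs_eq[OF runsI[OF runs_in_copy_cell]])
      (use Cons.prems cells_snoc[of "v @ [b]" b] in \<open>auto simp: word_tape_def scan_def intro!: ext\<close>)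
  show ?case
    by (rule runs_LoopT[OF runs_Seq[OF 1 2] runs_eq[OF Cons.IH[where p = "p @ [b]" and v = "(v @ [b]) @ [b]"]]])
      (use Cons.prems in \<open>auto simp: scan_def fun_eq_iff\<close>)
qed

lemma runs_write_pair:
  assumes "\<sigma> i = word_tape x 0" "\<sigma> j = word_tape y 0" "\<sigma> l = blank_tape" "distinct [i, j, l]"
    "length (pair x y) \<le> B"
  shows "runs K B (write_pair i j l) \<sigma> (\<sigma>(l := word_tape (pair x y) 0))"
proof -
  have B: "2 * length x + 2 + length y \<le> B" using assms(5) by (simp add: length_pair)
  let ?d = "concat (map (\<lambda>b. [b, b]) x)"
  have ld: "length ?d = 2 * length x" by (induction x) auto
  let ?p = "?d @ [False] @ [True]"
  define \<sigma>1 where "\<sigma>1 = \<sigma>(i := word_tape x (length x), l := word_tape ?d (length ?d))"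
  define \<sigma>2 where "\<sigma>2 = \<sigma>(i := word_tape x (length x), l := word_tape (?d @ [False]) (length (?d @ [False])))"
  define \<sigma>3 where "\<sigma>3 = \<sigma>(i := word_tape x (length x), l := word_tape ?p (length ?p))"
  define \<sigma>4 where "\<sigma>4 = \<sigma>(i := word_tape x (length x), j := word_tape y (length y), l := word_tape (?p @ y) (length (?p @ y)))"
  define \<sigma>5 where "\<sigma>5 = \<sigma>(j := word_tape y (length y), l := word_tape (?p @ y) (length (?p @ y)))"
  define \<sigma>6 where "\<sigma>6 = \<sigma>(l := word_tape (?p @ y) (length (?p @ y)))"
  have p: "?p @ y = pair x y" by (simp add: pair_def)
  have 1: "runs K B (double i l) \<sigma> \<sigma>1"
    using runs_double[of \<sigma> i "[]" x l "[]" B K] assms B by (simp add: \<sigma>1_def ld word_tape_Nil)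
  have 2: "runs K B (emit l (\<lambda>_. 1) 1) \<sigma>1 \<sigma>2"
    by (rule runs_emit[where c = "cells ?d" and h = "int (length ?d)"])
      (use assms B ld cells_snoc[of ?d False] in \<open>auto simp: \<sigma>1_def \<sigma>2_def word_tape_def bit_sym_def\<close>)
  have 3: "runs K B (emit l (\<lambda>_. 2) 1) \<sigma>2 \<sigma>3"
    by (rule runs_emit[where c = "cells (?d @ [False])" and h = "int (length (?d @ [False]))"])
      (use assms B ld cells_snoc[of "?d @ [False]" True] in \<open>auto simp: \<sigma>2_def \<sigma>3_def word_tape_def bit_sym_def\<close>)
  have 4: "runs K B (copy j l) \<sigma>3 \<sigma>4"
    by (rule runs_copy[where p = "[]" and s = y and v = ?p])
      (use assms B ld in \<open>auto simp: \<sigma>3_def \<sigma>4_def fun_eq_iff\<close>)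
  have 5: "runs K B (rewind i) \<sigma>4 \<sigma>5"
    by (rule runs_rewind[where u = x and n = "length x"])
      (use assms B in \<open>auto simp: \<sigma>4_def \<sigma>5_def fun_eq_iff\<close>)
  have 6: "runs K B (rewind j) \<sigma>5 \<sigma>6"
    by (rule runs_rewind[where u = y and n = "length y"])
      (use assms B in \<open>auto simp: \<sigma>5_def \<sigma>6_def fun_eq_iff\<close>)
  have 7: "runs K B (rewind l) \<sigma>6 (\<sigma>(l := word_tape (pair x y) 0))"
    by (rule runs_rewind[where u = "?p @ y" and n = "length (?p @ y)"])
      (use assms B in \<open>auto simp: \<sigma>6_def p[symmetric]\<close>)
  show ?thesis unfolding write_pair_def
    by (rule runs_Seq[OF 1 runs_Seq[OF 2 runs_Seq[OF 3 runs_Seq[OF 4 runs_Seq[OF 5 runs_Seq[OF 6 7]]]]]])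
qed

subsection \<open>Rulers\<close>

text \<open>A head moving along with a work head reads off the position that matters:
  \<open>2\<close> marks the origin, \<open>3\<close> and \<open>4\<close> the ends of the permitted
  range, and \<open>1\<close> its interior. For \<open>m = 0\<close> the ends would be hidden by the
  origin, so only \<open>1 \<le> m\<close> occurs.\<close>

definition ruler :: "nat \<Rightarrow> int \<Rightarrow> nat" where
  "ruler m i = (if i = 0 then 2 else if i = - int m then 3 else if i = int m then 4
     else if \<bar>i\<bar> < int m then 1 else 0)"

definition new_ruler :: "nat \<Rightarrow> prog" where
  "new_ruler r = Seq (emit r (\<lambda>_. 2) (-1)) (Seq (emit r (\<lambda>_. 3) 1) (Seq (move {r} 1) (emit r (\<lambda>_. 4) (-1))))"

definition extend_ruler :: "nat \<Rightarrow> prog" where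
  "extend_ruler r = Seq (Loop (\<lambda>s. s r \<noteq> 4) (move {r} 1)) (Seq (emit r (\<lambda>_. 1) 1) (Seq (emit r (\<lambda>_. 4) (-1))
     (Seq (Loop (\<lambda>s. s r \<noteq> 3) (move {r} (-1))) (Seq (emit r (\<lambda>_. 1) (-1)) (Seq (emit r (\<lambda>_. 3) 1)
     (Loop (\<lambda>s. s r \<noteq> 2) (move {r} 1)))))))"

lemma wf_ruler_progs [simp]:
  "r < T \<Longrightarrow> 4 < S \<Longrightarrow> wf_prog S T (new_ruler r)"
  "r < T \<Longrightarrow> 4 < S \<Longrightarrow> wf_prog S T (extend_ruler r)"
  and ask_free_ruler_progs [simp]: "ask_free (new_ruler r)" "ask_free (extend_ruler r)"
  by (auto simp: new_ruler_def extend_ruler_def)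

lemma runs_new_ruler:
  assumes "\<sigma> r = blank_tape" "1 \<le> B"
  shows "runs K B (new_ruler r) \<sigma> (\<sigma>(r := (ruler 1, 0)))"
proof -
  let ?a = "(\<lambda>_. 0)(0 := 2 :: nat) :: int \<Rightarrow> nat"
  let ?b = "?a(-1 := 3)"
  have 1: "runs K B (emit r (\<lambda>_. 2) (-1)) \<sigma> (\<sigma>(r := (?a, -1)))"
    by (rule runs_emit[where c = "\<lambda>_. 0" and h = 0]) (use assms in \<open>auto simp: blank_tape_def\<close>)
  have 2: "runs K B (emit r (\<lambda>_. 3) 1) (\<sigma>(r := (?a, -1))) (\<sigma>(r := (?b, 0)))"
    by (rule runs_emit[where c = ?a and h = "-1"]) (use assms in auto)
  have 3: "runs K B (move {r} 1) (\<sigma>(r := (?b, 0))) (\<sigma>(r := (?b, 1)))"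
    by (rule runs_move1[where c = ?b and h = 0]) (use assms in auto)
  have r: "?b(1 := 4) = ruler 1" by (auto simp: ruler_def fun_eq_iff)
  have 4: "runs K B (emit r (\<lambda>_. 4) (-1)) (\<sigma>(r := (?b, 1))) (\<sigma>(r := (ruler 1, 0)))"
    by (rule runs_emit[where c = ?b and h = 1]) (use assms r in auto)
  show ?thesis unfolding new_ruler_def by (rule runs_Seq[OF 1 runs_Seq[OF 2 runs_Seq[OF 3 4]]])
qed

lemma runs_seek1:
  assumes "\<sigma> i = (c, h)" "\<And>j. j < n \<Longrightarrow> c (h + d * int j) \<noteq> v" "c (h + d * int n) = v"
    "\<And>j. j \<le> n \<Longrightarrow> \<bar>h + d * int j\<bar> \<le> int B" "\<sigma>' = \<sigma>(i := (c, h + d * int n))"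
  shows "runs K B (Loop (\<lambda>s. s i \<noteq> v) (move {i} d)) \<sigma> \<sigma>'"
  by (rule runs_seek[where n = n]) (use assms in auto)

lemma runs_extend_ruler:
  assumes "\<sigma> r = (ruler m, 0)" "1 \<le> m" "m < B"
  shows "runs K B (extend_ruler r) \<sigma> (\<sigma>(r := (ruler (Suc m), 0)))"
proof -
  let ?a = "(ruler m)(int m := 1)"
  let ?b = "?a(int m + 1 := 4)"
  let ?c = "?b(- int m := 1)"
  have 1: "runs K B (Loop (\<lambda>s. s r \<noteq> 4) (move {r} 1)) \<sigma> (\<sigma>(r := (ruler m, int m)))"
    by (rule runs_seek1[where c = "ruler m" and h = 0 and n = m]) (use assms in \<open>auto simp: ruler_def\<close>)
  have 2: "runs K B (emit r (\<lambda>_. 1) 1) (\<sigma>(r := (ruler m, int m))) (\<sigma>(r := (?a, int m + 1)))"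
    by (rule runs_emit[where c = "ruler m" and h = "int m"]) (use assms in auto)
  have 3: "runs K B (emit r (\<lambda>_. 4) (-1)) (\<sigma>(r := (?a, int m + 1))) (\<sigma>(r := (?b, int m)))"
    by (rule runs_emit[where c = ?a and h = "int m + 1"]) (use assms in auto)
  have 4: "runs K B (Loop (\<lambda>s. s r \<noteq> 3) (move {r} (-1))) (\<sigma>(r := (?b, int m))) (\<sigma>(r := (?b, - int m)))"
    by (rule runs_seek1[where c = ?b and h = "int m" and n = "2 * m"])
      (use assms in \<open>auto simp: ruler_def\<close>)
  have 5: "runs K B (emit r (\<lambda>_. 1) (-1)) (\<sigma>(r := (?b, - int m))) (\<sigma>(r := (?c, - int m - 1)))"
    by (rule runs_emit[where c = ?b and h = "- int m"]) (use assms in auto)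
  have c: "?c(- int m - 1 := 3) = ruler (Suc m)"
    using assms(2) by (auto simp: ruler_def fun_eq_iff)
  have 6: "runs K B (emit r (\<lambda>_. 3) 1) (\<sigma>(r := (?c, - int m - 1))) (\<sigma>(r := (ruler (Suc m), - int m)))"
    by (rule runs_emit[where c = ?c and h = "- int m - 1"]) (use assms in \<open>auto simp: c[symmetric]\<close>)
  have 7: "runs K B (Loop (\<lambda>s. s r \<noteq> 2) (move {r} 1)) (\<sigma>(r := (ruler (Suc m), - int m))) (\<sigma>(r := (ruler (Suc m), 0)))"
    by (rule runs_seek1[where c = "ruler (Suc m)" and h = "- int m" and n = m])
      (use assms in \<open>auto simp: ruler_def\<close>)
  show ?thesis unfolding extend_ruler_def
    by (rule runs_Seq[OF 1 runs_Seq[OF 2 runs_Seq[OF 3 runs_Seq[OF 4 runs_Seq[OF 5 runs_Seq[OF 6 7]]]]]])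
qed

text \<open>The heads of tape \<open>i\<close> and of the ruler \<open>r\<close> are assumed to be at the same position.\<close>

definition clean :: "nat \<Rightarrow> nat \<Rightarrow> prog" where
  "clean i r = Seq (Loop (\<lambda>s. s r \<noteq> 4) (move {i, r} 1))
     (Seq (Loop (\<lambda>s. s r \<noteq> 3) (Act (\<lambda>s l. if l = i then (0, -1) else (s l, if l = r then -1 else 0))))
     (Seq (emit i (\<lambda>_. 0) 0) (Loop (\<lambda>s. s r \<noteq> 2) (move {i, r} 1))))"

lemma wf_clean [simp]: "i < T \<Longrightarrow> r < T \<Longrightarrow> 0 < S \<Longrightarrow> wf_prog S T (clean i r)"
  by (auto simp: clean_def)

lemma runs_clean:
  assumes "\<sigma> i = (f, h)" "\<sigma> r = (ruler m, h)" "\<bar>h\<bar> \<le> int m" "1 \<le> m" "m \<le> B" "i \<noteq> r"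
    "\<And>x. int m < \<bar>x\<bar> \<Longrightarrow> f x = 0"
  shows "runs K B (clean i r) \<sigma> (\<sigma>(i := blank_tape, r := (ruler m, 0)))"
proof -
  define \<sigma>1 where "\<sigma>1 = \<sigma>(i := (f, int m), r := (ruler m, int m))"
  \<comment> \<open>The leftward sweep has reached cell \<open>- m + n\<close>: everything to its
    right is erased, and the cell under the head not yet.\<close>
  let ?g = "\<lambda>n x. if x > - int m + int n then 0 else f x"
  define \<tau> where "\<tau> = (\<lambda>n::nat. \<sigma>(i := (?g n, - int m + int n), r := (ruler m, - int m + int n)))"
  have 1: "runs K B (Loop (\<lambda>s. s r \<noteq> 4) (move {i, r} 1)) \<sigma> \<sigma>1"
    by (rule runs_seek[where n = "nat (int m - h)"])
      (use assms in \<open>auto simp: \<sigma>1_def ruler_def fun_eq_iff\<close>)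
  have \<sigma>1: "\<sigma>1 = \<tau> (2 * m)"
    using assms(7) by (auto simp: \<sigma>1_def \<tau>_def fun_eq_iff)
  have 2: "runs K B (Loop (\<lambda>s. s r \<noteq> 3) (Act (\<lambda>s l. if l = i then (0, -1) else (s l, if l = r then -1 else 0)))) (\<tau> n) (\<tau> 0)"
    if "n \<le> 2 * m" for n
    using that
  proof (induction n)
    case 0
    then show ?case by (intro runs_LoopF) (use assms in \<open>auto simp: \<tau>_def scan_def ruler_def\<close>)
  next
    case (Suc n)
    have 1: "runs K B (Act (\<lambda>s l. if l = i then (0, -1) else (s l, if l = r then -1 else 0))) (\<tau> (Suc n)) (\<tau> n)"
      by (rule runsI[OF runs_in_Act])
        (use assms Suc.prems in \<open>auto simp: \<tau>_def act_split scan_def fun_eq_iff\<close>)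
    have "scan (\<tau> (Suc n)) r \<noteq> 3"
      using Suc.prems assms by (auto simp: \<tau>_def scan_def ruler_def)
    moreover have "n \<le> 2 * m" using Suc.prems by simp
    ultimately show ?case by (intro runs_LoopT[OF 1 Suc.IH])
  qed
  define \<sigma>2 where "\<sigma>2 = \<sigma>(i := ((\<lambda>_. 0), - int m), r := (ruler m, - int m))"
  have 3: "runs K B (emit i (\<lambda>_. 0) 0) (\<tau> 0) \<sigma>2"
    by (rule runs_emit[where c = "?g 0" and h = "- int m"])
      (use assms in \<open>auto simp: \<tau>_def \<sigma>2_def fun_eq_iff\<close>)
  have 4: "runs K B (Loop (\<lambda>s. s r \<noteq> 2) (move {i, r} 1)) \<sigma>2 (\<sigma>(i := blank_tape, r := (ruler m, 0)))"
    by (rule runs_seek[where n = m])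
      (use assms in \<open>auto simp: \<sigma>2_def ruler_def blank_tape_def fun_eq_iff\<close>)
  show ?thesis unfolding clean_def
    by (rule runs_Seq[OF 1 runs_Seq[OF 2[of "2 * m", folded \<sigma>1] runs_Seq[OF 3 4]]]) simp
qed

section \<open>Clocked and space-bounded simulation\<close>

text \<open>Strict, because the end symbols of the rulers are tested before a step: heads that are
  properly inside still lie on the ruler after one more move.\<close>

definition heads_within :: "nat \<Rightarrow> tape list \<Rightarrow> bool" where
  "heads_within m ts \<longleftrightarrow> (\<forall>(c, h) \<in> set ts. \<bar>h\<bar> < int m)"

lemma heads_within_nth: "heads_within m ts \<longleftrightarrow> (\<forall>i<length ts. \<bar>snd (ts ! i)\<bar> < int m)"
  by (force simp: heads_within_def in_set_conv_nth case_prod_beta)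

lemma heads_within_bounded: "heads_within m ts \<Longrightarrow> bounded_tapes m ts"
  by (force simp: heads_within_def bounded_tapes_def)

lemma bounded_heads_within: "bounded_tapes D ts \<Longrightarrow> D < m \<Longrightarrow> heads_within m ts"
  by (force simp: heads_within_def bounded_tapes_def)

lemma heads_within_step:
  assumes "oracle_tm M" "wf_config M cf" "heads_within m (snd cf)" "1 \<le> m"
  shows "bounded_tapes m (snd (step M K cf))"
proof -
  have "bounded_tapes (m - 1) (snd cf)"
    using assms(3,4) by (force simp: heads_within_def bounded_tapes_def)
  from bounded_step[OF assms(1,2) this] assms(4) show ?thesis by simp
qed

text \<open>The default \<open>start M\<close> keeps the value below \<open>states M\<close> on all
  arguments, as a symbol written by a program has to be in the alphabet for every scan.\<close>

definition query_target :: "machine \<Rightarrow> bool \<Rightarrow> nat \<Rightarrow> nat" where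
  "query_target M b q = (case query M q of
     Some (y, n) \<Rightarrow> if q < states M then if b then y else n else start M | None \<Rightarrow> start M)"

lemma oracle_tmD:
  assumes "oracle_tm M"
  shows "3 \<le> symbols M" "2 \<le> tapes M" "start M < states M" "accept M < states M" "reject M < states M"
    "accept M \<noteq> reject M" "query M q = Some (y, n) \<Longrightarrow> q < states M \<Longrightarrow> y < states M \<and> n < states M"
  using assms unfolding oracle_tm_def by blast+

lemma query_target_lt: "oracle_tm M \<Longrightarrow> query_target M b q < states M"
  using oracle_tmD(3,7)[of M] by (auto simp: query_target_def split: option.splits)

text \<open>Each round first advances the clock \<open>cl\<close>, limited by \<open>cu\<close>;
  running out of time puts the machine into its rejecting state. The test for this state keeps the
  round from making a further step, and a head at an end of its ruler is answered by rejection as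
  well.\<close>

definition sim :: "machine \<Rightarrow> nat \<Rightarrow> nat \<Rightarrow> prog \<Rightarrow> prog" where
  "sim M cl cu Q = (let k = tapes M in
     Loop (\<lambda>s. \<not> halted M (s (2 * k)))
       (Seq (inc_word cl cu (emit (2 * k) (\<lambda>_. reject M) 0))
         (Cond (\<lambda>s. s (2 * k) = reject M \<or> (\<exists>i<k. s (k + i) \<in> {3, 4})) (emit (2 * k) (\<lambda>_. reject M) 0)
           (Cond (\<lambda>s. query M (s (2 * k)) \<noteq> None) Q (sim_step M)))))"

lemma wf_sim [simp]:
  assumes "oracle_tm M" "states M \<le> S" "symbols M \<le> S" "2 * tapes M < T" "cl < T" "cu < T" "4 < S"
    "wf_prog S T Q"
  shows "wf_prog S T (sim M cl cu Q)"
proof -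
  have "reject M < S" using assms(2) oracle_tmD(5)[OF assms(1)] by simp
  with assms show ?thesis by (simp add: sim_def Let_def)
qed

lemma ask_free_sim [simp]: "ask_free Q \<Longrightarrow> ask_free (sim M cl cu Q)"
  by (simp add: sim_def Let_def)

lemma sim_store_state [simp]: "(sim_store M R (q, ts) \<sigma>)(2 * tapes M := mark_tape q') = sim_store M R (q', ts) \<sigma>"
  by (auto simp: sim_store_def fun_eq_iff)

lemma sim_store_at_state [simp]: "sim_store M R cf \<sigma> (2 * tapes M) = mark_tape (fst cf)"
  by (simp add: sim_store_def)

lemma sim_store_at_other [simp]: "2 * tapes M < i \<Longrightarrow> sim_store M R cf \<sigma> i = \<sigma> i"
  by (simp add: sim_store_def)

lemma sim_store_at_ruler [simp]: "i < tapes M \<Longrightarrow> sim_store M R cf \<sigma> (tapes M + i) = (R, snd (snd cf ! i))"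
  by (simp add: sim_store_def)

lemma sim_store_at_main [simp]: "i < tapes M \<Longrightarrow> sim_store M R cf \<sigma> i = snd cf ! i"
  by (simp add: sim_store_def)

lemma sim_store_upd: "2 * tapes M < i \<Longrightarrow> sim_store M R cf (\<sigma>(i := x)) = (sim_store M R cf \<sigma>)(i := x)"
  by (auto simp: sim_store_def fun_eq_iff)

text \<open>\<open>Q\<close> may be any program that performs one query step for the oracle
  \<open>K'\<close>: a genuine query if \<open>K' = K\<close>, or a search in a list. The clock
  value \<open>u\<close> leaves exactly \<open>j\<close> rounds, and a configuration with heads at
  the ends may still accept but not continue.\<close>

lemma runs_sim:
  fixes \<sigma> :: store
  assumes M: "oracle_tm M" and m: "1 \<le> m" "m \<le> B" "mc < B"
    and cl: "2 * tapes M < cl" "2 * tapes M < cu" "cl \<noteq> cu" "\<sigma> cu = unary_tape mc"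
    and Q: "\<And>q ts u. wf_config M (q, ts) \<Longrightarrow> \<not> halted M q \<Longrightarrow> query M q \<noteq> None \<Longrightarrow> heads_within m ts \<Longrightarrow>
      zero_outside m ts \<Longrightarrow> runs K B Q (sim_store M (ruler m) (q, ts) (\<sigma>(cl := word_tape u 0)))
       (sim_store M (ruler m) (step M K' (q, ts)) (\<sigma>(cl := word_tape u 0)))"
    and cf: "wf_config M cf" "bounded_tapes m (snd cf)" "zero_outside m (snd cf)" "length u \<le> mc"
      "nat_of_word u + j + 2 = 2 ^ Suc mc"
  shows "\<exists>q' ts' u'. runs K B (sim M cl cu Q) (sim_store M (ruler m) cf (\<sigma>(cl := word_tape u 0)))
       (sim_store M (ruler m) (q', ts') (\<sigma>(cl := word_tape u' 0))) \<and> halted M q' \<and>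
     wf_config M (q', ts') \<and> bounded_tapes m ts' \<and> zero_outside m ts' \<and> length u' \<le> mc \<and>
     (q' = accept M \<longleftrightarrow> (\<exists>t\<le>j. fst ((step M K' ^^ t) cf) = accept M \<and>
        (\<forall>v<t. heads_within m (snd ((step M K' ^^ v) cf)))))"
proof -
  define k where "k = tapes M"
  define St where "St = (\<lambda>cf u. sim_store M (ruler m) cf (\<sigma>(cl := word_tape u 0)))"
  define body where "body = Seq (inc_word cl cu (emit (2 * k) (\<lambda>_. reject M) 0))
         (Cond (\<lambda>s. s (2 * k) = reject M \<or> (\<exists>i<k. s (k + i) \<in> {3, 4})) (emit (2 * k) (\<lambda>_. reject M) 0)
           (Cond (\<lambda>s. query M (s (2 * k)) \<noteq> None) Q (sim_step M)))"
  have simL: "sim M cl cu Q = Loop (\<lambda>s. \<not> halted M (s (2 * k))) body"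
    by (simp add: sim_def Let_def body_def k_def)
  have cl': "2 * k < cl" "2 * k < cu" using cl by (simp_all add: k_def)
  have ne: "accept M \<noteq> reject M" by (rule oracle_tmD(6)[OF M])
  have rej: "reject M < states M" by (rule oracle_tmD(5)[OF M])
  have St_cl: "St cf u cl = word_tape u 0" "St cf u cu = unary_tape mc" "St cf u (2 * k) = mark_tape (fst cf)" for cf u
    using cl by (auto simp: St_def k_def)
  have St_upd: "(St cf u)(cl := word_tape u' 0) = St cf u'" "(St cf u)(2 * k := mark_tape q') = St (q', snd cf) u"
    for cf u u' q'
    using cl sim_store_state[of M "ruler m" "fst cf" "snd cf"]
    by (simp_all add: St_def sim_store_upd[symmetric] k_def)
  have sc: "scan (St cf u) (2 * k) = fst cf" for cf u using St_cl(3) by (simp add: scan_def)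
  \<comment> \<open>As the heads are within distance \<open>m\<close>, an end symbol is seen exactly
    at distance \<open>m\<close>.\<close>
  have chk: "(\<exists>i<k. scan (St cf u) (k + i) \<in> {3, 4}) \<longleftrightarrow> \<not> heads_within m (snd cf)"
    if "wf_config M cf" "bounded_tapes m (snd cf)" for cf u
  proof -
    have "scan (St cf u) (k + i) \<in> {3, 4} \<longleftrightarrow> \<not> \<bar>snd (snd cf ! i)\<bar> < int m" if i: "i < k" for i
    proof -
      have "\<bar>snd (snd cf ! i)\<bar> \<le> int m"
        using \<open>wf_config M cf\<close> \<open>bounded_tapes m (snd cf)\<close> i by (simp add: wf_config_def bounded_tapes_nth k_def)
      with m(1) i show ?thesis by (auto simp: St_def scan_def k_def ruler_def)
    qed
    moreover have "length (snd cf) = k" using that(1) by (simp add: wf_config_def k_def)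
    ultimately show ?thesis by (auto simp: heads_within_nth)
  qed
  have finish: "runs K B (Loop (\<lambda>s. \<not> halted M (s (2 * k))) body) (St cf u) (St cf u)" if "halted M (fst cf)" for cf u
    by (rule runs_LoopF) (simp add: sc that)
  have emit_rej: "runs K B (emit (2 * k) (\<lambda>_. reject M) 0) (St cf u) (St (reject M, snd cf) u)" for cf u
    by (rule runs_set_mark[where v = "fst cf"]) (simp_all add: St_cl St_upd)
  have main: "\<exists>q' ts' u'. runs K B (Loop (\<lambda>s. \<not> halted M (s (2 * k))) body) (St cf u) (St (q', ts') u') \<and> halted M q' \<and>
     wf_config M (q', ts') \<and> bounded_tapes m ts' \<and> zero_outside m ts' \<and> length u' \<le> mc \<and>
     (q' = accept M \<longleftrightarrow> (\<exists>t\<le>j. fst ((step M K' ^^ t) cf) = accept M \<and>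
        (\<forall>v<t. heads_within m (snd ((step M K' ^^ v) cf)))))"
    if "wf_config M cf" "bounded_tapes m (snd cf)" "zero_outside m (snd cf)" "length u \<le> mc"
      "nat_of_word u + j + 2 = 2 ^ Suc mc" for cf u j
    using that
  proof (induction j arbitrary: cf u)
    case (0 cf u)
    show ?case
    proof (cases "halted M (fst cf)")
      case True
      show ?thesis
        by (rule exI[of _ "fst cf"], rule exI[of _ "snd cf"], rule exI[of _ u])
          (use 0 True finish[OF True] in auto)
    next
      case False
      let ?u = "replicate mc False"
      \<comment> \<open>No round is left, so \<open>u\<close> is the last word of length at most
        \<open>mc\<close> and the clock overflows.\<close>
      have "\<not> length (inc u) \<le> mc"
        using "0.prems"(5) unfolding length_le_iff nat_of_word_inc by simp
      then have 1: "runs K B (inc_word cl cu (emit (2 * k) (\<lambda>_. reject M) 0)) (St cf u) (St (reject M, snd cf) ?u)"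
        using runs_inc_word(2)[of "St cf u" cl u cu mc B "2 * k" K "emit (2 * k) (\<lambda>_. reject M) 0" "mark_tape (reject M)"]
          0 m cl cl' St_cl by (simp add: St_upd runs_set_mark)
      have 2: "runs K B body (St cf u) (St (reject M, snd cf) ?u)"
        unfolding body_def
        by (rule runs_Seq[OF 1 runs_CondT]) (use emit_rej[of "(reject M, snd cf)"] in \<open>auto simp: sc\<close>)
      have 3: "runs K B (Loop (\<lambda>s. \<not> halted M (s (2 * k))) body) (St cf u) (St (reject M, snd cf) ?u)"
        by (rule runs_LoopT[OF 2 finish]) (use False in \<open>auto simp: sc halted_def\<close>)
      show ?thesis
        by (rule exI[of _ "reject M"], rule exI[of _ "snd cf"], rule exI[of _ ?u])
          (use 0 3 ne rej False in \<open>auto simp: halted_def wf_config_def\<close>)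
    qed
  next
    case (Suc j cf u)
    show ?case
    proof (cases "halted M (fst cf)")
      case True
      have st: "(step M K' ^^ t) cf = cf" for t
        using step_halted[of "fst cf" M t K' "snd cf"] True by (simp add: halted_def)
      show ?thesis
        by (rule exI[of _ "fst cf"], rule exI[of _ "snd cf"], rule exI[of _ u])
          (use Suc True finish[OF True] in \<open>auto simp: st\<close>)
    next
      case False
      have le: "length (inc u) \<le> mc"
        using Suc.prems(5) unfolding length_le_iff nat_of_word_inc by simp
      then have 1: "runs K B (inc_word cl cu (emit (2 * k) (\<lambda>_. reject M) 0)) (St cf u) (St cf (inc u))"
        using runs_inc_word(1)[of "St cf u" cl u cu mc B K "emit (2 * k) (\<lambda>_. reject M) 0"]
          Suc.prems m cl St_cl by (simp add: St_upd)
      show ?thesis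
      proof (cases "heads_within m (snd cf)")
        case ni: False
        have 2: "runs K B body (St cf u) (St (reject M, snd cf) (inc u))"
          unfolding body_def
          by (rule runs_Seq[OF 1 runs_CondT[OF emit_rej]]) (use chk[OF Suc.prems(1,2)] ni in blast)
        have 3: "runs K B (Loop (\<lambda>s. \<not> halted M (s (2 * k))) body) (St cf u) (St (reject M, snd cf) (inc u))"
          by (rule runs_LoopT[OF 2 finish]) (use False in \<open>auto simp: sc halted_def\<close>)
        \<comment> \<open>Time \<open>0\<close> is not accepting, as the machine has not halted;
          every later time requires the heads to be inside at time \<open>0\<close>.\<close>
        have "\<not> (\<exists>t\<le>Suc j. fst ((step M K' ^^ t) cf) = accept M \<and>
            (\<forall>v<t. heads_within m (snd ((step M K' ^^ v) cf))))"
        proof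
          assume "\<exists>t\<le>Suc j. fst ((step M K' ^^ t) cf) = accept M \<and>
            (\<forall>v<t. heads_within m (snd ((step M K' ^^ v) cf)))"
          then obtain t where t: "fst ((step M K' ^^ t) cf) = accept M"
            "\<forall>v<t. heads_within m (snd ((step M K' ^^ v) cf))" by blast
          then have "t = 0" using ni by (metis funpow_0 gr0I)
          with t False show False by (simp add: halted_def)
        qed
        then show ?thesis
          by (intro exI[of _ "reject M"] exI[of _ "snd cf"] exI[of _ "inc u"])
            (use Suc.prems 3 ne rej le in \<open>auto simp: halted_def wf_config_def\<close>)
      next
        case True
        let ?cf = "step M K' cf"
        obtain q ts where cf: "cf = (q, ts)" by force
        have b: "bounded_tapes m (snd ?cf)" by (rule heads_within_step[OF M Suc.prems(1) True m(1)])
        have qr: "q \<noteq> reject M" using False cf by (auto simp: halted_def)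
        have 2: "runs K B (Cond (\<lambda>s. query M (s (2 * k)) \<noteq> None) Q (sim_step M)) (St cf (inc u)) (St ?cf (inc u))"
        proof (cases "query M q = None")
          case qn: True
          have "runs_in K B (sim_step M) (St cf (inc u)) 1 (St ?cf (inc u))"
            unfolding cf St_def
            by (rule runs_in_sim_step[OF M]) (use Suc.prems False qn b m(2) cf in \<open>auto intro: bounded_tapes_mono\<close>)
          then have s: "runs K B (sim_step M) (St cf (inc u)) (St ?cf (inc u))" by (rule runsI)
          show ?thesis by (rule runs_CondF[OF s]) (use qn cf in \<open>simp add: sc\<close>)
        next
          case qs: False
          have s: "runs K B Q (St cf (inc u)) (St ?cf (inc u))"
            unfolding cf St_def by (rule Q) (use Suc.prems False qs True cf in auto)
          show ?thesis by (rule runs_CondT[OF s]) (use qs cf in \<open>simp add: sc\<close>)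
        qed
        have "\<not> (scan (St cf (inc u)) (2 * k) = reject M \<or> (\<exists>i<k. scan (St cf (inc u)) (k + i) \<in> {3, 4}))"
          unfolding chk[OF Suc.prems(1,2)] sc using True qr cf by simp
        then have 3: "runs K B body (St cf u) (St ?cf (inc u))"
          unfolding body_def by (intro runs_Seq[OF 1] runs_CondF[OF 2])
        have "\<exists>q' ts' u'. runs K B (Loop (\<lambda>s. \<not> halted M (s (2 * k))) body) (St ?cf (inc u)) (St (q', ts') u') \<and> halted M q' \<and>
           wf_config M (q', ts') \<and> bounded_tapes m ts' \<and> zero_outside m ts' \<and> length u' \<le> mc \<and>
           (q' = accept M \<longleftrightarrow> (\<exists>t\<le>j. fst ((step M K' ^^ t) ?cf) = accept M \<and>
              (\<forall>v<t. heads_within m (snd ((step M K' ^^ v) ?cf)))))"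
          by (rule Suc.IH[OF wf_config_step[OF M Suc.prems(1)] b
              zero_outside_step[OF M Suc.prems(1-3)] le]) (use Suc.prems(5) in \<open>simp add: nat_of_word_inc\<close>)
        then obtain q' ts' u' where r: "runs K B (Loop (\<lambda>s. \<not> halted M (s (2 * k))) body) (St ?cf (inc u)) (St (q', ts') u')"
          and r2: "halted M q'" "wf_config M (q', ts')" "bounded_tapes m ts'" "zero_outside m ts'" "length u' \<le> mc"
          and r3: "q' = accept M \<longleftrightarrow> (\<exists>t\<le>j. fst ((step M K' ^^ t) ?cf) = accept M \<and>
              (\<forall>v<t. heads_within m (snd ((step M K' ^^ v) ?cf))))" by blast
        have 4: "runs K B (Loop (\<lambda>s. \<not> halted M (s (2 * k))) body) (St cf u) (St (q', ts') u')"
          by (rule runs_LoopT[OF 3 r]) (use False in \<open>simp add: sc\<close>)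
        have sw: "(step M K' ^^ Suc v) cf = (step M K' ^^ v) ?cf" for v by (simp add: funpow_swap1)
        have "(\<exists>t\<le>j. fst ((step M K' ^^ t) ?cf) = accept M \<and> (\<forall>v<t. heads_within m (snd ((step M K' ^^ v) ?cf)))) \<longleftrightarrow>
          (\<exists>t\<le>Suc j. fst ((step M K' ^^ t) cf) = accept M \<and> (\<forall>v<t. heads_within m (snd ((step M K' ^^ v) cf))))"
          (is "?L \<longleftrightarrow> ?R")
        proof
          assume ?L
          then obtain t where t: "t \<le> j" "fst ((step M K' ^^ t) ?cf) = accept M"
            "\<forall>v<t. heads_within m (snd ((step M K' ^^ v) ?cf))" by blast
          have "heads_within m (snd ((step M K' ^^ v) cf))" if "v < Suc t" for v
            using that t(3) True sw by (cases v) auto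
          with t sw[of t] show ?R by (intro exI[of _ "Suc t"]) simp
        next
          assume ?R
          then obtain t where t: "t \<le> Suc j" "fst ((step M K' ^^ t) cf) = accept M"
            "\<forall>v<t. heads_within m (snd ((step M K' ^^ v) cf))" by blast
          have "t \<noteq> 0" using t(2) False by (metis funpow_0 halted_def)
          then obtain t' where t': "t = Suc t'" by (cases t) auto
          show ?L
          proof (intro exI[of _ t'] conjI allI impI)
            show "t' \<le> j" using t t' by simp
            show "fst ((step M K' ^^ t') ?cf) = accept M" using t(2) by (simp only: t' sw)
            fix v assume "v < t'"
            then have "Suc v < t" using t' by simp
            then show "heads_within m (snd ((step M K' ^^ v) ?cf))" using t(3) sw by metis
          qed
        qed
        with 4 r2 r3 show ?thesis
          by (intro exI[of _ q'] exI[of _ ts'] exI[of _ u']) simp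
      qed
    qed
  qed
  show ?thesis unfolding simL using main[OF cf] unfolding St_def .
qed

text \<open>The clock starts at the empty word, whose number is \<open>0\<close>, and the last word
  of length \<open>mc\<close> has number \<open>2 ^ Suc mc - 2\<close>; this is the number of steps
  available.\<close>

definition sim_accepts :: "machine \<Rightarrow> nat set \<Rightarrow> nat \<Rightarrow> nat \<Rightarrow> word \<Rightarrow> bool" where
  "sim_accepts M K m mc x \<longleftrightarrow> (\<exists>t. t + 2 \<le> 2 ^ Suc mc \<and> fst (run M K x t) = accept M \<and>
     (\<forall>v<t. heads_within m (snd (run M K x v))))"

lemma runs_sim_input:
  fixes \<sigma> :: store
  assumes M: "oracle_tm M" and m: "1 \<le> m" "m \<le> B" "mc < B" "length x \<le> m"
    and cl: "2 * tapes M < cl" "2 * tapes M < cu" "cl \<noteq> cu" "\<sigma> cu = unary_tape mc"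
    and Q: "\<And>q ts u. wf_config M (q, ts) \<Longrightarrow> \<not> halted M q \<Longrightarrow> query M q \<noteq> None \<Longrightarrow> heads_within m ts \<Longrightarrow>
      zero_outside m ts \<Longrightarrow> runs K B Q (sim_store M (ruler m) (q, ts) (\<sigma>(cl := word_tape u 0)))
       (sim_store M (ruler m) (step M K' (q, ts)) (\<sigma>(cl := word_tape u 0)))"
  shows "\<exists>q' ts' u'. runs K B (sim M cl cu Q) (sim_store M (ruler m) (init M x) (\<sigma>(cl := word_tape [] 0)))
       (sim_store M (ruler m) (q', ts') (\<sigma>(cl := word_tape u' 0))) \<and>
     wf_config M (q', ts') \<and> bounded_tapes m ts' \<and> zero_outside m ts' \<and> length u' \<le> mc \<and>
     (q' = accept M \<longleftrightarrow> sim_accepts M K' m mc x)"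
proof -
  have "(2::nat) ^ 1 \<le> 2 ^ Suc mc" by (intro power_increasing) auto
  then have j: "nat_of_word [] + (2 ^ Suc mc - 2) + 2 = 2 ^ Suc mc"
    and t: "t \<le> 2 ^ Suc mc - 2 \<longleftrightarrow> t + 2 \<le> 2 ^ Suc mc" for t :: nat
    unfolding nat_of_word.simps power_one_right by arith+
  have "length [] \<le> mc" by simp
  from runs_sim[OF M m(1-3) cl Q wf_config_init[OF M] bounded_init zero_outside_init[OF m(4)] this j]
  show ?thesis unfolding sim_accepts_def run_def t by blast
qed

section \<open>Counting configurations, and when the bounded simulation is faithful\<close>

definition log_configs :: "machine \<Rightarrow> nat \<Rightarrow> nat" where
  "log_configs M D = states M + tapes M * (symbols M * (2 * D + 1) + (2 * D + 1))"

text \<open>A configuration is a state together with, for each tape, a content of a window of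
  \<open>2 * D + 1\<close> cells and a head position in it. Bounding every factor by
  \<open>n \<le> 2 ^ n\<close> is crude but makes the exponent \<open>log_configs M D\<close> linear
  in \<open>D\<close>, without logarithms, so that programs can compute it as a polynomial.\<close>

lemma configs_card:
  fixes M D
  defines "C \<equiv> {cf. wf_config M cf \<and> bounded_tapes D (snd cf) \<and> zero_outside D (snd cf)}"
  shows "finite C" "card C \<le> 2 ^ log_configs M D"
proof -
  let ?I = "{- int D .. int D}" and ?s = "symbols M" and ?k = "tapes M"
  \<comment> \<open>Contents are recovered from their restriction to the window by filling up with
    blanks.\<close>
  let ?F = "(\<lambda>g i. if i \<in> ?I then g i else 0 :: nat) ` (?I \<rightarrow>\<^sub>E {..<?s})"
  let ?TS = "?F \<times> ?I"
  let ?L = "{ts. set ts \<subseteq> ?TS \<and> length ts = ?k}"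
  have cI: "card ?I = 2 * D + 1" by simp
  have fin: "finite (?I \<rightarrow>\<^sub>E {..<?s})" by (simp add: finite_PiE)
  have finT: "finite ?TS" using fin by simp
  have "card ?F \<le> card (?I \<rightarrow>\<^sub>E {..<?s})" by (rule card_image_le[OF fin])
  also have "\<dots> = ?s ^ (2 * D + 1)" by (simp add: card_PiE cI[simplified])
  also have "\<dots> \<le> (2 ^ ?s) ^ (2 * D + 1)" by (rule power_mono[OF less_imp_le[OF less_exp]]) simp
  finally have cF: "card ?F \<le> 2 ^ (?s * (2 * D + 1))" by (simp only: power_mult)
  have "card ?TS = card ?F * card ?I" by (rule card_cartesian_product)
  also have "\<dots> \<le> 2 ^ (?s * (2 * D + 1)) * 2 ^ (2 * D + 1)"
    unfolding cI by (rule mult_mono[OF cF less_imp_le[OF less_exp]]) simp_all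
  finally have cT: "card ?TS \<le> 2 ^ (?s * (2 * D + 1) + (2 * D + 1))" by (simp only: power_add)
  have cL: "card ?L = card ?TS ^ ?k" "finite ?L"
    using card_lists_length_eq[OF finT] finite_lists_length_eq[OF finT] by auto
  have "C \<subseteq> {..<states M} \<times> ?L"
  proof
    fix cf assume cf: "cf \<in> C"
    have "(c, h) \<in> ?TS" if "(c, h) \<in> set (snd cf)" for c h
    proof -
      have c: "\<And>i. c i < ?s" "\<bar>h\<bar> \<le> int D" "\<And>i. int D < \<bar>i\<bar> \<Longrightarrow> c i = 0"
        using cf that by (auto simp: C_def wf_config_def bounded_tapes_def zero_outside_def)
      have "c = (\<lambda>i. if i \<in> ?I then restrict c ?I i else 0)"
        using c(3) by (auto simp: fun_eq_iff)
      moreover have "restrict c ?I \<in> ?I \<rightarrow>\<^sub>E {..<?s}" using c(1) by auto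
      ultimately have "c \<in> ?F" by (rule image_eqI)
      with c(2) show ?thesis by auto
    qed
    with cf show "cf \<in> {..<states M} \<times> ?L"
      by (cases cf) (auto simp: C_def wf_config_def)
  qed
  moreover have f2: "finite ({..<states M} \<times> ?L)" using cL by simp
  ultimately show "finite C" by (rule finite_subset)
  have "card C \<le> card ({..<states M} \<times> ?L)" by (rule card_mono) fact+
  also have "\<dots> = states M * card ?TS ^ ?k" by (simp only: card_cartesian_product cL card_lessThan)
  also have "\<dots> \<le> 2 ^ states M * (2 ^ (?s * (2 * D + 1) + (2 * D + 1))) ^ ?k"
    by (rule mult_mono[OF less_imp_le[OF less_exp] power_mono[OF cT]]) simp_all
  also have "\<dots> = 2 ^ states M * 2 ^ ((?s * (2 * D + 1) + (2 * D + 1)) * ?k)"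
    by (simp only: power_mult)
  also have "\<dots> = 2 ^ log_configs M D"
    by (simp only: log_configs_def power_add[symmetric] mult.commute[of ?k])
  finally show "card C \<le> 2 ^ log_configs M D" .
qed

lemma run_add: "run M K x (a + b) = (step M K ^^ b) (run M K x a)"
  unfolding run_def by (simp add: add.commute[of a] funpow_add)

text \<open>Up to the first halting time no configuration is repeated, since a repetition would
  allow to cut out a piece of the run and halt earlier. All these configurations are among those
  counted in \<open>configs_card\<close>.\<close>

lemma halting_time:
  assumes M: "oracle_tm M" and b: "\<And>t. bounded_tapes D (snd (run M K x t))" and x: "length x \<le> D"
    and h: "halted M (fst (run M K x t0))"
  shows "\<exists>t \<le> 2 ^ log_configs M D. halted M (fst (run M K x t))"
proof -
  define t where "t = (LEAST t. halted M (fst (run M K x t)))"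
  have t: "halted M (fst (run M K x t))" unfolding t_def by (rule LeastI[of _ t0]) (rule h)
  have least: "\<not> halted M (fst (run M K x s))" if "s < t" for s
    using not_less_Least that unfolding t_def by blast
  have inj: "inj_on (run M K x) {..t}"
  proof (rule linorder_inj_onI)
    fix i j assume ij: "i < j" "j \<in> {..t}"
    show "run M K x i \<noteq> run M K x j"
    proof
      assume "run M K x i = run M K x j"
      \<comment> \<open>Continuing both for \<open>t - j\<close> steps gives a halted configuration
        at the earlier time \<open>i + (t - j)\<close>.\<close>
      then have "run M K x (i + (t - j)) = run M K x (j + (t - j))" by (simp only: run_add)
      moreover have "j + (t - j) = t" and lt: "i + (t - j) < t" using ij by auto
      ultimately show False using t least[OF lt] by simp
    qed
  qed auto
  let ?C = "{cf. wf_config M cf \<and> bounded_tapes D (snd cf) \<and> zero_outside D (snd cf)}"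
  have "run M K x ` {..t} \<subseteq> ?C"
    using wf_config_run[OF M] b zero_outside_run[OF M x] by auto
  then have "card (run M K x ` {..t}) \<le> card ?C" by (rule card_mono[OF configs_card(1)])
  then have "Suc t \<le> 2 ^ log_configs M D"
    using configs_card(2)[of M D] by (simp add: card_image[OF inj])
  with t show ?thesis by (intro exI[of _ t]) simp
qed

text \<open>A halted run does not move on, so the verdict at time \<open>u\<close> and an accepting
  state at time \<open>t\<close> can be compared at \<open>max t u\<close>.\<close>

lemma accept_iff:
  assumes "oracle_tm M" "decides_in_space M K L s"
  shows "(\<exists>t. fst (run M K x t) = accept M) \<longleftrightarrow> x \<in> L"
proof -
  have ne: "accept M \<noteq> reject M" by (rule oracle_tmD(6)[OF assms(1)])
  obtain u where u: "fst (run M K x u) = verdict M L x"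
    using assms(2) unfolding decides_in_space_def by blast
  have "x \<in> L" if t: "fst (run M K x t) = accept M" for t
  proof -
    have "run M K x (max t u) = run M K x t" "run M K x (max t u) = run M K x u"
      by (auto intro!: run_halted simp: halted_def t u verdict_def)
    with t u ne show ?thesis by (auto simp: verdict_def split: if_splits)
  qed
  with u show ?thesis by (auto simp: verdict_def)
qed

text \<open>Acceptance within the bounds is acceptance. Conversely, the first halting time is at
  most \<open>2 ^ log_configs M D\<close>, which the clock reaches, and the heads stay within
  \<open>D\<close>, hence off the ends of the rulers.\<close>

lemma sim_accepts_iff:
  assumes M: "oracle_tm M" "decides_in_space M K L s"
    and D: "s (length x) \<le> D" "length x \<le> D" "D < m" "log_configs M D < mc"
  shows "sim_accepts M K m mc x \<longleftrightarrow> x \<in> L"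
proof
  assume "sim_accepts M K m mc x"
  then show "x \<in> L" using accept_iff[OF M] by (auto simp: sim_accepts_def)
next
  assume x: "x \<in> L"
  have b: "bounded_tapes D (snd (run M K x t))" for t
    using M(2) D(1) unfolding decides_in_space_def bounded_tapes_def by fastforce
  obtain u where u: "fst (run M K x u) = accept M"
    using accept_iff[OF M] x by blast
  then obtain t where t: "t \<le> 2 ^ log_configs M D" "halted M (fst (run M K x t))"
    using halting_time[OF M(1) b D(2), of u] by (auto simp: halted_def)
  have "run M K x (max t u) = run M K x t" "run M K x (max t u) = run M K x u"
    by (auto intro!: run_halted simp: t u) (simp add: halted_def)
  then have a: "fst (run M K x t) = accept M" using u by simp
  have "(2::nat) ^ log_configs M D \<le> 2 ^ mc" using D(4) by (intro power_increasing) auto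
  \<comment> \<open>With \<open>mc \<ge> 1\<close> the offset \<open>2\<close> in
    \<open>sim_accepts\<close> is absorbed by one of the two summands of
    \<open>2 ^ Suc mc\<close>.\<close>
  moreover have "(2::nat) ^ 1 \<le> 2 ^ mc" using D(4) by (intro power_increasing) auto
  ultimately have "t + 2 \<le> 2 ^ Suc mc" using t(1) unfolding power_Suc power_one_right by linarith
  with a b show "sim_accepts M K m mc x"
    unfolding sim_accepts_def by (meson bounded_heads_within D(3))
qed

lemma length_query_word:
  assumes "\<And>i. int m < i \<Longrightarrow> c i = 0"
  shows "length (query_word c) \<le> Suc m"
  unfolding query_word_def by (simp, rule Least_le) (simp add: assms)

text \<open>While the heads are within distance \<open>m\<close>, all cells further away are blank,
  so a query word occupies at most the cells \<open>0\<close> to \<open>m\<close>; this explains the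
  length \<open>Suc m\<close>.\<close>

lemma run_agree:
  assumes M: "oracle_tm M" and x: "length x \<le> m"
    and agree: "\<And>w. length w \<le> Suc m \<Longrightarrow> nat_of_word w \<in> K \<longleftrightarrow> nat_of_word w \<in> K'"
    and heads_within: "\<And>v. v < t \<Longrightarrow> heads_within m (snd (run M K x v))"
  shows "run M K' x t = run M K x t"
  using heads_within
proof (induction t)
  case 0 then show ?case by (simp add: run_def)
next
  case (Suc t)
  have z: "zero_outside m (snd (run M K x t))"
    by (rule zero_outside_run[OF M x]) (use Suc.prems heads_within_bounded in auto)
  obtain q ts where qt: "run M K x t = (q, ts)" by force
  have "1 < length ts"
    using wf_config_run[OF M, of K x t] oracle_tmD(2)[OF M] qt by (simp add: wf_config_def)
  then have "length (query_word (fst (ts ! 1))) \<le> Suc m"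
    using z qt by (intro length_query_word) (auto simp: zero_outside_nth)
  then have "step M K' (q, ts) = step M K (q, ts)"
    using agree by (auto simp: step_def split: option.splits)
  with Suc qt show ?case by (simp add: run_Suc)
qed

text \<open>The head condition of an accepting run under one oracle makes \<open>run_agree\<close>
  applicable, which turns it into the same run under the other.\<close>

lemma sim_accepts_agree:
  assumes M: "oracle_tm M" and x: "length x \<le> m"
    and agree: "\<And>w. length w \<le> Suc m \<Longrightarrow> nat_of_word w \<in> K \<longleftrightarrow> nat_of_word w \<in> K'"
  shows "sim_accepts M K m mc x \<longleftrightarrow> sim_accepts M K' m mc x"
proof -
  have "sim_accepts M K2 m mc x" if s: "sim_accepts M K1 m mc x"
    and ag: "\<And>w. length w \<le> Suc m \<Longrightarrow> nat_of_word w \<in> K1 \<longleftrightarrow> nat_of_word w \<in> K2" for K1 K2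
  proof -
    from s obtain t where t: "t + 2 \<le> 2 ^ Suc mc" "fst (run M K1 x t) = accept M"
      "\<And>v. v < t \<Longrightarrow> heads_within m (snd (run M K1 x v))" by (auto simp: sim_accepts_def)
    have "run M K2 x v = run M K1 x v" if "v \<le> t" for v
      by (rule run_agree[OF M x ag]) (use t(3) that in auto)
    with t show ?thesis unfolding sim_accepts_def by (intro exI[of _ t]) auto
  qed
  from this[of K K'] this[of K' K] agree show ?thesis by blast
qed

section \<open>Closure of relativized polynomial space under bounded existential
  quantification\<close>

lemma poly_nat_mono: "m \<le> n \<Longrightarrow> poly p m \<le> poly p n" for p :: "nat poly"
  by (induction p) (auto intro!: add_mono mult_mono)

text \<open>The tapes have to be reused for the next candidate. A simulation leaves the heads of
  tape \<open>i\<close> and of its ruler in the same position, as \<open>clean\<close>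
  expects.\<close>

lemma runs_clean_all:
  assumes "wf_config M (q, ts)" "bounded_tapes m ts" "zero_outside m ts" "1 \<le> m" "m \<le> B"
  shows "runs K B (seq_upto (\<lambda>i. clean i (tapes M + i)) (tapes M)) (sim_store M (ruler m) (q, ts) \<sigma>)
    (sim_store M (ruler m) (q, replicate (tapes M) blank_tape) \<sigma>)"
proof -
  let ?k = "tapes M"
  have l: "length ts = ?k" using assms(1) by (simp add: wf_config_def)
  define g where "g = (\<lambda>n. sim_store M (ruler m) (q, replicate n blank_tape @ drop n ts) \<sigma>)"
  have "runs K B (seq_upto (\<lambda>i. clean i (?k + i)) ?k) (g 0) (g ?k)"
  proof (rule runs_seq_upto)
    fix i assume i: "i < ?k"
    obtain f h where fh: "ts ! i = (f, h)" by force
    have nth: "(replicate i blank_tape @ drop i ts) ! i = (f, h)" using i l fh by (simp add: nth_append)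
    have h: "\<bar>h\<bar> \<le> int m" using assms(2) i l fh by (auto simp: bounded_tapes_nth)
    have z: "f y = 0" if "int m < \<bar>y\<bar>" for y
      using assms(3) that i l fh by (auto simp: zero_outside_nth dest!: spec[of _ i])
    have eq: "(g i)(i := blank_tape, ?k + i := (ruler m, 0)) = g (Suc i)"
    proof
      fix j
      have "(replicate i blank_tape @ drop i ts) ! j = (replicate (Suc i) blank_tape @ drop (Suc i) ts) ! j"
        if "j \<noteq> i" "j < ?k" for j
        using that i l by (auto simp: nth_append simp del: replicate.simps)
      moreover have "(replicate (Suc i) blank_tape @ drop (Suc i) ts) ! i = blank_tape"
        using nth_append[of "replicate (Suc i) blank_tape" _ i] by (simp del: replicate.simps)
      moreover have "snd (blank_tape) = 0" by (simp add: blank_tape_def)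
      ultimately show "((g i)(i := blank_tape, ?k + i := (ruler m, 0))) j = g (Suc i) j"
        using i by (auto simp: g_def sim_store_def simp del: replicate.simps)
    qed
    have "runs K B (clean i (?k + i)) (g i) ((g i)(i := blank_tape, ?k + i := (ruler m, 0)))"
      by (rule runs_clean[where f = f and h = h])
        (use i nth h z assms(4,5) in \<open>auto simp: g_def\<close>)
    then show "runs K B (clean i (?k + i)) (g i) (g (Suc i))" by (simp only: eq)
  qed
  then show ?thesis by (simp add: g_def l)
qed

text \<open>The copies of the input supply the separate counter tapes of
  \<open>for_poly\<close>.\<close>

lemma runs_copies:
  assumes B: "length x \<le> B" "1 \<le> B" and X: "0 < X"
  shows "runs K B (seq_upto (\<lambda>i. Seq (copy 0 (X + i)) (Seq (rewind 0) (rewind (X + i)))) d) (init_store x)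
    (\<lambda>l. if l = 0 \<or> X \<le> l \<and> l < X + d then word_tape x 0 else blank_tape)"
proof -
  define g where "g = (\<lambda>i l. if l = 0 \<or> X \<le> l \<and> l < X + i then word_tape x 0 else blank_tape)"
  have "runs K B (seq_upto (\<lambda>i. Seq (copy 0 (X + i)) (Seq (rewind 0) (rewind (X + i)))) d) (g 0) (g d)"
  proof (rule runs_seq_upto)
    fix i
    let ?n = "length x"
    have 1: "runs K B (copy 0 (X + i)) (g i) ((g i)(0 := word_tape x ?n, X + i := word_tape x ?n))"
      by (rule runs_copy[where p = "[]" and s = x and v = "[]"])
        (use B X in \<open>auto simp: g_def word_tape_Nil\<close>)
    have 2: "runs K B (rewind 0) ((g i)(0 := word_tape x ?n, X + i := word_tape x ?n)) ((g i)(X + i := word_tape x ?n))"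
      by (rule runs_rewind[where u = x and n = ?n]) (use B X in \<open>auto simp: g_def fun_eq_iff\<close>)
    have 3: "runs K B (rewind (X + i)) ((g i)(X + i := word_tape x ?n)) (g (Suc i))"
      by (rule runs_rewind[where u = x and n = ?n]) (use B X in \<open>auto simp: g_def fun_eq_iff\<close>)
    show "runs K B (Seq (copy 0 (X + i)) (Seq (rewind 0) (rewind (X + i)))) (g i) (g (Suc i))"
      by (rule runs_Seq[OF 1 runs_Seq[OF 2 3]])
  qed
  moreover have "g 0 = init_store x" by (auto simp: g_def init_store_def input_tape_word fun_eq_iff)
  ultimately show ?thesis by (simp only: g_def)
qed

text \<open>All candidates \<open>y\<close> are tried in the order of the enumeration, each by a
  clocked simulation on the same tapes. The clock and the rulers cut off nothing here, since their
  sizes are computed from the space bound of \<open>M\<close>.\<close>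

lemma PSPACE_rel_bounded_ex:
  assumes "R \<in> PSPACE_rel K"
  shows "{x. \<exists>y. length y \<le> poly p (length x) \<and> pair x y \<in> R} \<in> PSPACE_rel K"
proof -
  obtain M s where M: "oracle_tm M" "decides_in_space M K R (poly s)"
    using assms unfolding PSPACE_rel_def by blast
  define k where "k = tapes M"
  note orM = oracle_tmD[OF M(1)]
  have k2: "2 \<le> k" unfolding k_def by (rule orM(2))
  define cl cu yt yu fl X where
    lay: "cl = 2 * k + 1" "cu = 2 * k + 2" "yt = 2 * k + 3" "yu = 2 * k + 4" "fl = 2 * k + 5" "X = 2 * k + 6"
  \<comment> \<open>A bound on the length \<open>2 * length x + 2 + length y\<close> of the
    simulated input.\<close>
  define N where "N = [:2, 2:] + p"
  define D where "D = pcompose s N + N"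
  \<comment> \<open>This is \<open>D + log_configs M D + 1\<close> as a polynomial in the length of
    \<open>x\<close>, made to satisfy both bounds of \<open>sim_accepts_iff\<close>.\<close>
  define r where "r = D + [:states M:] + [:tapes M:] * ([:symbols M:] * ([:2:] * D + 1) + ([:2:] * D + 1)) + 1"
  define cs where "cs = coeffs r"
  define ps where "ps = coeffs p"
  \<comment> \<open>Enough counters for either polynomial; the summand \<open>1\<close> guarantees
    that tape \<open>X\<close> is among the copies, since \<open>write_pair\<close> reads
    \<open>x\<close> from it.\<close>
  define d where "d = length cs + length ps + 1"
  define T where "T = X + d"
  define S where "S = states M + symbols M + 5"
  define Q where "Q = Ask (emit (2 * k) (\<lambda>s. query_target M True (s (2 * k))) 0)
     (emit (2 * k) (\<lambda>s. query_target M False (s (2 * k))) 0)"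
  \<comment> \<open>The flag \<open>fl\<close> tells the outer loop what to do: \<open>0\<close> to
    go on, \<open>1\<close> a witness has been found, \<open>2\<close> the candidates are
    exhausted.\<close>
  define advance where "advance = Cond (\<lambda>s. s (2 * k) = accept M) (emit fl (\<lambda>_. 1) 0) (inc_word yt yu (emit fl (\<lambda>_. 2) 0))"
  define body where "body = Seq (write_pair X yt 0) (Seq (emit (2 * k) (\<lambda>_. start M) 0) (Seq (sim M cl cu Q)
    (Seq advance
      (Seq (clear cl) (seq_upto (\<lambda>i. clean i (k + i)) k)))))"
  define prog where "prog = Seq (seq_upto (\<lambda>i. Seq (copy 0 (X + i)) (Seq (rewind 0) (rewind (X + i)))) d)
    (Seq (clear 0) (Seq (seq_upto (\<lambda>i. Seq (new_ruler (k + i)) (for_poly cs X (extend_ruler (k + i)))) k)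
    (Seq (for_poly cs X (append_mark cu)) (Seq (for_poly ps X (append_mark yu))
      (Loop (\<lambda>s. s fl = 0) body)))))"
  have lt: "start M < S" "query_target M b q < S" for b q
    using orM(3) query_target_lt[OF M(1), of b q] by (auto simp: S_def)
  have wf: "wf_prog S T prog"
    unfolding prog_def body_def advance_def Q_def using k2 M(1) lt
    by (simp add: S_def lay T_def d_def k_def[symmetric])
  define b where "b = 2 * r + p + [:20, 2:]"
  show ?thesis
  proof (rule PSPACE_relI[OF wf, where r = b and c = "\<lambda>s. s fl = 1"])
    fix x :: word
    define n where "n = length x"
    define mc where "mc = poly r n"
    define m where "m = Suc mc"
    define P where "P = poly p n"
    define B where "B = poly b n"
    have B: "m + mc + P + 2 * n + 10 \<le> B" by (simp add: B_def b_def mc_def m_def P_def)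
    have hor: "horner cs n = mc" "horner ps n = P"
      by (simp_all add: cs_def ps_def horner_coeffs mc_def P_def)
    have Dm: "poly D n < m" "log_configs M (poly D n) < mc"
      by (simp_all add: m_def mc_def r_def log_configs_def)
    define base where "base = (\<lambda>l. if X \<le> l \<and> l < X + d then word_tape x 0 else blank_tape)(cu := unary_tape mc, yu := unary_tape P)"
    define \<beta> where "\<beta> = (\<lambda>y f. base(yt := word_tape y 0, fl := mark_tape f))"
    \<comment> \<open>The store between two candidates. The state \<open>q\<close> is left over from
      the previous simulation and is overwritten by \<open>start M\<close> in the next
      round.\<close>
    define Z where "Z = (\<lambda>q y f. sim_store M (ruler m) (q, replicate k blank_tape) (\<beta> y f))"
    have lk: "length (replicate k blank_tape) = tapes M" by (simp add: k_def)
    have \<beta>_at: "\<beta> y f cl = blank_tape" "\<beta> y f cu = unary_tape mc" "\<beta> y f yt = word_tape y 0"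
      "\<beta> y f yu = unary_tape P" "\<beta> y f fl = mark_tape f" "\<beta> y f X = word_tape x 0" for y f
      by (auto simp: \<beta>_def base_def lay d_def)
    have gt: "2 * tapes M < cl" "2 * tapes M < cu" "2 * tapes M < yt" "2 * tapes M < yu" "2 * tapes M < fl" "2 * tapes M < X"
      by (simp_all add: lay k_def)
    have neq: "fl \<noteq> cl" "yt \<noteq> cl" "yu \<noteq> cl" "cu \<noteq> cl" "fl \<noteq> yt" "cl \<noteq> fl" "cl \<noteq> yt" "yt \<noteq> fl"
      "yt \<noteq> yu" "fl \<noteq> yu" "cl \<noteq> cu"
      by (simp_all add: lay)
    have round: "\<exists>q' y' f'. runs K B body (Z q y 0) (Z q' y' f') \<and>
       (if pair x y \<in> R then f' = 1 else if length (inc y) \<le> P then f' = 0 \<and> y' = inc y else f' = 2)"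
      if y: "length y \<le> P" for q y
    proof -
      let ?w = "pair x y"
      have lw: "length ?w \<le> poly N n" using y by (simp add: length_pair N_def P_def n_def)
      have D1: "poly s (length ?w) \<le> poly D n" "length ?w \<le> poly D n"
        using poly_nat_mono[OF lw, of s] lw by (simp_all add: D_def poly_pcompose)
      have lwB: "length ?w \<le> B" using y B by (simp add: length_pair n_def)
      have init: "init M ?w = (start M, word_tape ?w 0 # replicate (k - 1) blank_tape)"
        by (simp add: init_def k_def input_tape_word)
      have Zat: "Z q y 0 X = word_tape x 0" "Z q y 0 yt = word_tape y 0" "Z q y 0 0 = blank_tape"
        using gt k2 by (auto simp: Z_def \<beta>_at k_def)
      have 1: "runs K B (write_pair X yt 0) (Z q y 0) ((Z q y 0)(0 := word_tape ?w 0))"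
        by (rule runs_write_pair) (use Zat lwB k2 in \<open>auto simp: lay\<close>)
      have in0: "(Z q y 0)(0 := word_tape ?w 0, 2 * k := mark_tape (start M)) = sim_store M (ruler m) (init M ?w) ((\<beta> y 0)(cl := word_tape [] 0))"
      proof -
        have "(\<beta> y 0)(cl := word_tape [] 0) = \<beta> y 0" by (simp add: \<beta>_at word_tape_Nil fun_upd_idem)
        then show ?thesis using k2
          by (auto simp: fun_eq_iff Z_def sim_store_def init k_def[symmetric] nth_Cons' word_tape_def blank_tape_def)
      qed
      have 2: "runs K B (emit (2 * k) (\<lambda>_. start M) 0) ((Z q y 0)(0 := word_tape ?w 0))
          (sim_store M (ruler m) (init M ?w) ((\<beta> y 0)(cl := word_tape [] 0)))"
        by (rule runs_set_mark[where v = q])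
          (use k2 in \<open>auto simp: Z_def in0[symmetric] k_def\<close>)
      have Q: "runs K B Q (sim_store M (ruler m) (q, ts) \<tau>) (sim_store M (ruler m) (step M K (q, ts)) \<tau>)"
        if q: "wf_config M (q, ts)" "\<not> halted M q" "query M q \<noteq> None" for q ts \<tau>
      proof -
        obtain a b' where ab: "query M q = Some (a, b')" using q(3) by auto
        have "sim_store M (ruler m) (q, ts) \<tau> 1 = ts ! 1" using k2 by (simp add: k_def)
        then have an: "answer K (sim_store M (ruler m) (q, ts) \<tau>) \<longleftrightarrow> nat_of_word (query_word (fst (ts ! 1))) \<in> K"
          by (simp add: answer_def)
        have sc: "scan (sim_store M (ruler m) (q, ts) \<tau>) (2 * k) = q" by (simp add: scan_def k_def)
        have st_at: "sim_store M (ruler m) (q, ts) \<tau> (2 * k) = mark_tape q"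
          and st_upd: "(sim_store M (ruler m) (q, ts) \<tau>)(2 * k := mark_tape q') = sim_store M (ruler m) (q', ts) \<tau>" for q'
          by (simp_all add: k_def)
        have qs: "q < states M" using q(1) by (simp add: wf_config_def)
        show ?thesis unfolding Q_def
          by (rule runs_Ask; rule runs_set_mark[where v = q])
            (use qs in \<open>auto simp: an step_query[OF q(2) ab] sc query_target_def ab st_at st_upd\<close>)
      qed
      have pre: "1 \<le> m" "m \<le> B" "mc < B" "length ?w \<le> m"
        using B D1 Dm by (simp_all add: m_def)
      have "\<exists>q' ts' u'. runs K B (sim M cl cu Q) (sim_store M (ruler m) (init M ?w) ((\<beta> y 0)(cl := word_tape [] 0)))
          (sim_store M (ruler m) (q', ts') ((\<beta> y 0)(cl := word_tape u' 0))) \<and>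
        wf_config M (q', ts') \<and> bounded_tapes m ts' \<and> zero_outside m ts' \<and> length u' \<le> mc \<and>
        (q' = accept M \<longleftrightarrow> sim_accepts M K m mc ?w)"
        by (rule runs_sim_input[OF M(1) pre gt(1,2) neq(11) _ Q]) (simp add: \<beta>_at)
      then obtain q' ts' u' where 3: "runs K B (sim M cl cu Q) (sim_store M (ruler m) (init M ?w) ((\<beta> y 0)(cl := word_tape [] 0)))
          (sim_store M (ruler m) (q', ts') ((\<beta> y 0)(cl := word_tape u' 0)))"
        and q': "wf_config M (q', ts')" "bounded_tapes m ts'" "zero_outside m ts'" "length u' \<le> mc"
        and acc: "q' = accept M \<longleftrightarrow> sim_accepts M K m mc ?w" by blast
      note acc
      also have "\<dots> \<longleftrightarrow> ?w \<in> R"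
        by (rule sim_accepts_iff[OF M D1 Dm])
      finally have qR: "q' = accept M \<longleftrightarrow> ?w \<in> R" .
      let ?\<sigma>3 = "sim_store M (ruler m) (q', ts') ((\<beta> y 0)(cl := word_tape u' 0))"
      have \<sigma>3_at: "?\<sigma>3 fl = mark_tape 0" "?\<sigma>3 yt = word_tape y 0" "?\<sigma>3 yu = unary_tape P"
        by (simp_all add: gt neq \<beta>_at)
      have "\<exists>y' f'. runs K B advance
          ?\<sigma>3 (sim_store M (ruler m) (q', ts') ((\<beta> y' f')(cl := word_tape u' 0))) \<and>
         (if ?w \<in> R then f' = 1 else if length (inc y) \<le> P then f' = 0 \<and> y' = inc y else f' = 2)"
      proof (cases "?w \<in> R")
        case True
        have "runs K B (emit fl (\<lambda>_. 1) 0) ?\<sigma>3 (sim_store M (ruler m) (q', ts') ((\<beta> y 1)(cl := word_tape u' 0)))"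
          by (rule runs_set_mark[where v = 0])
            (use \<sigma>3_at gt in \<open>simp_all add: sim_store_upd[symmetric] \<beta>_def fun_upd_twist neq\<close>)
        then have "runs K B advance
          ?\<sigma>3 (sim_store M (ruler m) (q', ts') ((\<beta> y 1)(cl := word_tape u' 0)))"
          unfolding advance_def by (rule runs_CondT) (use True qR in \<open>simp add: scan_def k_def\<close>)
        with True show ?thesis by auto
      next
        case False
        have nacc: "\<not> scan ?\<sigma>3 (2 * k) = accept M" using False qR by (simp add: scan_def k_def)
        show ?thesis
        proof (cases "length (inc y) \<le> P")
          case True
          have "runs K B (inc_word yt yu (emit fl (\<lambda>_. 2) 0)) ?\<sigma>3 (?\<sigma>3(yt := word_tape (inc y) 0))"
            by (rule runs_inc_word(1)[OF \<sigma>3_at(2,3)]) (use y True B in \<open>auto simp: lay\<close>)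
          moreover have "?\<sigma>3(yt := word_tape (inc y) 0) = sim_store M (ruler m) (q', ts') ((\<beta> (inc y) 0)(cl := word_tape u' 0))"
            using gt by (simp add: sim_store_upd[symmetric] \<beta>_def fun_upd_twist neq)
          ultimately have "runs K B advance
            ?\<sigma>3 (sim_store M (ruler m) (q', ts') ((\<beta> (inc y) 0)(cl := word_tape u' 0)))"
            using runs_CondF[where c = "\<lambda>s. s (2 * k) = accept M" and \<sigma> = ?\<sigma>3] nacc by (simp add: advance_def)
          with True False show ?thesis by auto
        next
          case ov: False
          let ?y = "replicate P False"
          have "runs K B (inc_word yt yu (emit fl (\<lambda>_. 2) 0)) ?\<sigma>3 (?\<sigma>3(yt := word_tape ?y 0, fl := mark_tape 2))"
          proof (rule runs_inc_word(2)[OF \<sigma>3_at(2,3)])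
            fix \<tau> :: store assume "\<tau> fl = ?\<sigma>3 fl"
            then show "runs K B (emit fl (\<lambda>_. 2) 0) \<tau> (\<tau>(fl := mark_tape 2))"
              by (intro runs_set_mark[where v = 0]) (simp_all add: \<sigma>3_at)
          qed (use y ov B in \<open>auto simp: lay\<close>)
          moreover have "?\<sigma>3(yt := word_tape ?y 0, fl := mark_tape 2) =
             sim_store M (ruler m) (q', ts') ((\<beta> ?y 2)(cl := word_tape u' 0))"
            using gt by (simp add: sim_store_upd[symmetric] \<beta>_def fun_upd_twist neq)
          ultimately have "runs K B advance
            ?\<sigma>3 (sim_store M (ruler m) (q', ts') ((\<beta> ?y 2)(cl := word_tape u' 0)))"
            using runs_CondF[where c = "\<lambda>s. s (2 * k) = accept M" and \<sigma> = ?\<sigma>3] nacc by (simp add: advance_def)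
          with ov False show ?thesis by auto
        qed
      qed
      then obtain y' f' where 4: "runs K B advance
          ?\<sigma>3 (sim_store M (ruler m) (q', ts') ((\<beta> y' f')(cl := word_tape u' 0)))"
        and f': "if ?w \<in> R then f' = 1 else if length (inc y) \<le> P then f' = 0 \<and> y' = inc y else f' = 2"
        by blast
      have 5: "runs K B (clear cl) (sim_store M (ruler m) (q', ts') ((\<beta> y' f')(cl := word_tape u' 0)))
         (sim_store M (ruler m) (q', ts') (\<beta> y' f'))"
        by (rule runs_clear[where u = u' and n = 0])
          (use gt q'(4) B in \<open>simp_all add: sim_store_upd[symmetric] \<beta>_at fun_upd_idem\<close>)
      have 6: "runs K B (seq_upto (\<lambda>i. clean i (k + i)) k) (sim_store M (ruler m) (q', ts') (\<beta> y' f')) (Z q' y' f')"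
        unfolding Z_def k_def by (rule runs_clean_all[OF q'(1-3)]) (use B in \<open>simp_all add: m_def\<close>)
      have "runs K B body (Z q y 0) (Z q' y' f')"
        unfolding body_def by (rule runs_Seq[OF 1 runs_Seq[OF 2 runs_Seq[OF 3 runs_Seq[OF 4 runs_Seq[OF 5 6]]]]])
      with f' show ?thesis by blast
    qed
    have Zfl: "scan (Z q y f) fl = f" for q y f
      using gt by (simp add: Z_def scan_def \<beta>_at)
    \<comment> \<open>Induction on the number \<open>j\<close> of words still ahead;
      \<open>j = 0\<close> contradicts \<open>length y \<le> P\<close> by
      \<open>length_le_iff\<close>. The assertion concerns the words from \<open>y\<close>
      on.\<close>
    have search: "\<exists>q' y' f'. runs K B (Loop (\<lambda>s. s fl = 0) body) (Z q y 0) (Z q' y' f') \<and>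
      (f' = 1 \<longleftrightarrow> (\<exists>y'. nat_of_word y \<le> nat_of_word y' \<and> length y' \<le> P \<and> pair x y' \<in> R))"
      if "length y \<le> P" "nat_of_word y + j = 2 ^ Suc P" for q y j
      using that
    proof (induction j arbitrary: q y)
      case (0 q y)
      then show ?case unfolding length_le_iff by simp
    next
      case (Suc j q y)
      from round[OF Suc.prems(1), of q] obtain q1 y1 f1 where 1: "runs K B body (Z q y 0) (Z q1 y1 f1)"
        and f1: "if pair x y \<in> R then f1 = 1 else if length (inc y) \<le> P then f1 = 0 \<and> y1 = inc y else f1 = 2"
        by blast
      have le: "nat_of_word y \<le> nat_of_word y' \<longleftrightarrow> y' = y \<or> nat_of_word (inc y) \<le> nat_of_word y'" for y'
        using injD[OF bij_is_inj[OF bij_nat_of_word], of y y'] by (auto simp: nat_of_word_inc)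
      have split: "(\<exists>y'. nat_of_word y \<le> nat_of_word y' \<and> length y' \<le> P \<and> pair x y' \<in> R) \<longleftrightarrow>
         pair x y \<in> R \<or> (\<exists>y'. nat_of_word (inc y) \<le> nat_of_word y' \<and> length y' \<le> P \<and> pair x y' \<in> R)"
        unfolding le using Suc.prems(1) by blast
      show ?case
      proof (cases "f1 = 0")
        case True
        then have f: "pair x y \<notin> R" "length (inc y) \<le> P" "y1 = inc y" using f1 by (auto split: if_splits)
        from Suc.IH[OF f(2), of q1] obtain q' y' f' where 2: "runs K B (Loop (\<lambda>s. s fl = 0) body) (Z q1 (inc y) 0) (Z q' y' f')"
          "f' = 1 \<longleftrightarrow> (\<exists>y'. nat_of_word (inc y) \<le> nat_of_word y' \<and> length y' \<le> P \<and> pair x y' \<in> R)"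
          using Suc.prems(2) by (auto simp: nat_of_word_inc)
        have "runs K B (Loop (\<lambda>s. s fl = 0) body) (Z q y 0) (Z q' y' f')"
          by (rule runs_LoopT[OF 1]) (use 2 True f Zfl in simp_all)
        with 2(2) f(1) split show ?thesis by (intro exI[of _ q'] exI[of _ y'] exI[of _ f']) simp
      next
        case False
        have r: "runs K B (Loop (\<lambda>s. s fl = 0) body) (Z q y 0) (Z q1 y1 f1)"
          by (rule runs_LoopT[OF 1 runs_LoopF]) (use False Zfl in simp_all)
        have "f1 = 1 \<longleftrightarrow> (\<exists>y'. nat_of_word y \<le> nat_of_word y' \<and> length y' \<le> P \<and> pair x y' \<in> R)"
        proof (cases "pair x y \<in> R")
          case True
          then show ?thesis using f1 split by simp
        next
          case nR: False
          then have f: "f1 = 2" "\<not> length (inc y) \<le> P" using f1 False by (auto split: if_splits)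
          \<comment> \<open>Words of length at most \<open>P\<close> form an initial segment, so
            none of them lies beyond an \<open>inc y\<close> that is too long.\<close>
          have "\<not> (nat_of_word (inc y) \<le> nat_of_word y' \<and> length y' \<le> P)" for y'
            using f(2) unfolding length_le_iff by auto
          then show ?thesis using nR f(1) split by auto
        qed
        with r show ?thesis by blast
      qed
    qed
    define \<sigma>1 where "\<sigma>1 = (\<lambda>l. if l = 0 \<or> X \<le> l \<and> l < X + d then word_tape x 0 else blank_tape)"
    define \<sigma>2 where "\<sigma>2 = (\<lambda>l. if X \<le> l \<and> l < X + d then word_tape x 0 else blank_tape)"
    define g where "g = (\<lambda>i l. if k \<le> l \<and> l < k + i then (ruler m, 0) else \<sigma>2 l)"
    have 1: "runs K B (seq_upto (\<lambda>i. Seq (copy 0 (X + i)) (Seq (rewind 0) (rewind (X + i)))) d) (init_store x) \<sigma>1"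
      unfolding \<sigma>1_def by (rule runs_copies) (use B in \<open>auto simp: n_def lay\<close>)
    have 2: "runs K B (clear 0) \<sigma>1 \<sigma>2"
      by (rule runs_clear[where u = x and n = 0]) (use B in \<open>auto simp: \<sigma>1_def \<sigma>2_def n_def lay fun_eq_iff\<close>)
    have 3: "runs K B (seq_upto (\<lambda>i. Seq (new_ruler (k + i)) (for_poly cs X (extend_ruler (k + i)))) k) (g 0) (g k)"
    proof (rule runs_seq_upto)
      fix i assume i: "i < k"
      have a: "runs K B (new_ruler (k + i)) (g i) ((g i)(k + i := (ruler 1, 0)))"
        by (rule runs_new_ruler) (use i B in \<open>auto simp: g_def \<sigma>2_def lay\<close>)
      have c: "runs K B (for_poly cs X (extend_ruler (k + i))) ((g i)(k + i := (ruler 1, 0)))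
          ((g i)(k + i := (ruler 1, 0), k + i := (ruler (Suc (0 + horner cs (length x))), 0)))"
      proof (rule runs_for_poly[where F = "\<lambda>a. (ruler (Suc a), 0)" and M = mc])
        fix a :: nat and \<tau> :: store assume "a < mc" "\<tau> (k + i) = (ruler (Suc a), 0)"
        then show "runs K B (extend_ruler (k + i)) \<tau> (\<tau>(k + i := (ruler (Suc (Suc a)), 0)))"
          by (intro runs_extend_ruler) (use B in \<open>auto simp: m_def\<close>)
      qed (use i B hor in \<open>auto simp: n_def lay g_def \<sigma>2_def d_def\<close>)
      have "(g i)(k + i := (ruler 1, 0), k + i := (ruler (Suc (0 + horner cs (length x))), 0)) = g (Suc i)"
        using hor(1) i by (auto simp: g_def fun_eq_iff m_def n_def)
      with runs_Seq[OF a c] show "runs K B (Seq (new_ruler (k + i)) (for_poly cs X (extend_ruler (k + i)))) (g i) (g (Suc i))"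
        by simp
    qed
    have g0: "g 0 = \<sigma>2" by (auto simp: g_def fun_eq_iff)
    have unary: "runs K B (for_poly c X (append_mark t)) \<tau> (\<tau>(t := unary_tape (horner c n)))"
      if "\<And>i. i < length c \<Longrightarrow> \<tau> (X + i) = word_tape x 0" "\<tau> t = blank_tape" "t < X" "horner c n \<le> mc + P" for \<tau> c t
    proof -
      have "runs K B (for_poly c X (append_mark t)) \<tau> (\<tau>(t := unary_tape (0 + horner c (length x))))"
      proof (rule runs_for_poly[where M = "mc + P"])
        fix a :: nat and \<tau> :: store assume "a < mc + P" "\<tau> t = unary_tape a"
        then show "runs K B (append_mark t) \<tau> (\<tau>(t := unary_tape (Suc a)))"
          by (intro runs_append_mark) (use B in auto)
      qed (use that B in \<open>auto simp: n_def unary_tape_def word_tape_Nil\<close>)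
      then show ?thesis by (simp add: n_def)
    qed
    have 4: "runs K B (for_poly cs X (append_mark cu)) (g k) ((g k)(cu := unary_tape mc))"
      by (rule runs_eq[OF unary]) (use hor in \<open>auto simp: g_def \<sigma>2_def lay d_def\<close>)
    have 5: "runs K B (for_poly ps X (append_mark yu)) ((g k)(cu := unary_tape mc)) ((g k)(cu := unary_tape mc, yu := unary_tape P))"
      by (rule runs_eq[OF unary]) (use hor in \<open>auto simp: g_def \<sigma>2_def lay d_def\<close>)
    have Z0: "(g k)(cu := unary_tape mc, yu := unary_tape P) = Z 0 [] 0"
    proof -
      have "\<beta> [] 0 = base"
        by (auto simp: \<beta>_def word_tape_Nil mark_tape_0 base_def lay fun_eq_iff)
      then show ?thesis
        by (auto simp: Z_def sim_store_def g_def k_def[symmetric] fun_eq_iff \<sigma>2_def base_def lay mark_tape_0 blank_tape_def)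
    qed
    from search[of "[]" "2 ^ Suc P" 0] obtain q' y' f' where
      6: "runs K B (Loop (\<lambda>s. s fl = 0) body) (Z 0 [] 0) (Z q' y' f')"
      and f': "f' = 1 \<longleftrightarrow> (\<exists>y'. length y' \<le> P \<and> pair x y' \<in> R)" by auto
    have "runs K B prog (init_store x) (Z q' y' f')"
      unfolding prog_def
      by (rule runs_Seq[OF 1 runs_Seq[OF 2 runs_Seq[OF 3[unfolded g0] runs_Seq[OF 4 runs_Seq[OF 5[unfolded Z0] 6]]]]])
    moreover have "heads_le B (init_store x)"
      by (auto simp: heads_le_def init_store_def input_tape_def blank_tape_def)
    ultimately obtain t where "exec K B prog (init_store x) t (Z q' y' f')"
      unfolding runs_def runs_in_def by blast
    then show "\<exists>t \<sigma>'. exec K (poly b (length x)) prog (init_store x) t \<sigma>' \<and>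
      (scan \<sigma>' fl = 1 \<longleftrightarrow> x \<in> {x. \<exists>y. length y \<le> poly p (length x) \<and> pair x y \<in> R})"
      using f' Zfl by (intro exI[of _ t] exI[of _ "Z q' y' f'"]) (simp add: B_def n_def P_def)
  qed (use k2 in \<open>auto simp: S_def T_def lay\<close>)
qed

text \<open>A level arises from the previous one by complements and a bounded existential
  quantifier, and \<open>PSPACE_rel K\<close> is closed under both.\<close>

lemma PH_rel_subset_PSPACE_rel: "PH_rel K \<subseteq> PSPACE_rel K"
proof -
  have "Sigma_level (P_rel K) k \<subseteq> PSPACE_rel K" for k
  proof (induction k)
    case 0
    then show ?case using P_rel_subset_PSPACE_rel by simp
  next
    case (Suc k)
    show ?case
    proof
      fix L assume "L \<in> Sigma_level (P_rel K) (Suc k)"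
      then obtain p R where R: "R \<in> Sigma_level (P_rel K) k"
        and L: "\<And>x. x \<in> L \<longleftrightarrow> (\<exists>y. length y \<le> poly p (length x) \<and> pair x y \<in> - R)"
        unfolding Sigma_level.simps by blast
      have "- R \<in> PSPACE_rel K" using R Suc PSPACE_rel_uminus by blast
      moreover have "L = {x. \<exists>y. length y \<le> poly p (length x) \<and> pair x y \<in> - R}" using L by blast
      ultimately show "L \<in> PSPACE_rel K" by (simp only: PSPACE_rel_bounded_ex)
    qed
  qed
  then show ?thesis unfolding PH_rel_def by blast
qed

section \<open>Simulation with a listed oracle\<close>

fun encode_list :: "word list \<Rightarrow> word" where
  "encode_list [] = []"
| "encode_list (z # zs) = pair z (encode_list zs)"

text \<open>Defined by repeated decoding, and not through \<open>encode_list\<close>, because a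
  guessed list is an arbitrary word. Decoding a nonempty word leaves a shorter rest, which gives
  termination.\<close>

function listed :: "word \<Rightarrow> word \<Rightarrow> bool" where
  "listed z l \<longleftrightarrow> (if l = [] then False else fst (unpair l) = z \<or> listed z (snd (unpair l)))"
  by auto
termination
  by (relation "measure (length \<circ> snd)") (auto intro: length_snd_unpair)

declare listed.simps [simp del]

lemma listed_encode_list: "listed z (encode_list zs) \<longleftrightarrow> z \<in> set zs"
proof (induction zs)
  case Nil
  then show ?case by (simp add: listed.simps)
next
  case (Cons y zs)
  have "pair y (encode_list zs) \<noteq> []" by (simp add: pair_def)
  with Cons show ?case by (auto simp: listed.simps[of z "pair y (encode_list zs)"])
qed

definition list_oracle :: "word \<Rightarrow> nat set" where
  "list_oracle l = {nat_of_word z |z. listed z l}"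

lemma mem_list_oracle: "nat_of_word z \<in> list_oracle l \<longleftrightarrow> listed z l"
  using injD[OF bij_is_inj[OF bij_nat_of_word]] by (auto simp: list_oracle_def)

lemma runs_decode_fst:
  assumes "\<sigma> i = word_tape (p @ s) (length p)" "\<sigma> j = blank_tape" "\<sigma> f = blank_tape"
    "i \<noteq> j" "i \<noteq> f" "j \<noteq> f" "length (p @ s) \<le> B"
    "\<sigma>' = \<sigma>(i := word_tape (p @ s) (length (p @ s) - length (snd (unpair s))),
       j := word_tape (fst (unpair s)) (length (fst (unpair s))))"
  shows "runs K B (decode_fst i j f) \<sigma> \<sigma>'"
  unfolding assms(8) using runs_in_decode_fst[of \<sigma> i p s j "[]" f B K] assms
  by (intro runsI) (auto simp: word_tape_Nil)

lemma runs_decode_pair: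
  assumes "\<sigma> i = word_tape w 0" "\<sigma> j = blank_tape" "\<sigma> l = blank_tape" "\<sigma> f = blank_tape"
    "distinct [i, j, l, f]" "length w \<le> B" "1 \<le> B"
    "\<sigma>' = \<sigma>(j := word_tape (fst (unpair w)) 0, l := word_tape (snd (unpair w)) 0)"
  shows "runs K B (decode_pair i j l f) \<sigma> \<sigma>'"
  unfolding assms(8) by (rule runsI[OF runs_in_decode_pair]) (use assms in auto)

text \<open>The loop stops at the first difference or at the end of \<open>u\<close>. Equal symbols
  under the heads can then only be two blanks, so one comparison of symbols decides equality of the
  words.\<close>

lemma runs_compare:
  assumes "\<sigma> i = word_tape (p @ u) (length p)" "\<sigma> j = word_tape (p @ z) (length p)" "i \<noteq> j"
    "length (p @ u) \<le> B" "length (p @ z) \<le> B"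
  shows "\<exists>n. runs K B (Loop (\<lambda>s. s i \<noteq> 0 \<and> s i = s j) (move {i, j} 1)) \<sigma>
      (\<sigma>(i := word_tape (p @ u) n, j := word_tape (p @ z) n)) \<and>
    n \<le> length (p @ u) \<and> n \<le> length (p @ z) \<and> (cells (p @ u) (int n) = cells (p @ z) (int n) \<longleftrightarrow> u = z)"
  using assms
proof (induction u arbitrary: p z \<sigma>)
  case Nil
  have e: "cells p (int (length p)) = 0" "cells (p @ z) (int (length p)) = 0 \<longleftrightarrow> z = []"
    by (auto simp: cells_nth)
  have 1: "runs K B (Loop (\<lambda>s. s i \<noteq> 0 \<and> s i = s j) (move {i, j} 1)) \<sigma>
      (\<sigma>(i := word_tape (p @ []) (length p), j := word_tape (p @ z) (length p)))"
    by (rule runs_eq[OF runs_LoopF]) (use Nil in \<open>auto simp: scan_def fun_eq_iff\<close>)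
  show ?case
    by (rule exI[of _ "length p"], rule conjI, rule runs_eq[OF 1]) (use e in \<open>auto simp: fun_eq_iff\<close>)
next
  case (Cons b u)
  show ?case
  proof (cases "\<exists>z'. z = b # z'")
    case False
    have ne: "cells (p @ b # u) (int (length p)) \<noteq> cells (p @ z) (int (length p))"
      using False by (cases z) (auto simp: cells_nth)
    have 1: "runs K B (Loop (\<lambda>s. s i \<noteq> 0 \<and> s i = s j) (move {i, j} 1)) \<sigma>
      (\<sigma>(i := word_tape (p @ b # u) (length p), j := word_tape (p @ z) (length p)))"
      by (rule runs_eq[OF runs_LoopF]) (use Cons.prems ne in \<open>auto simp: scan_def fun_eq_iff\<close>)
    show ?thesis
      by (rule exI[of _ "length p"], rule conjI, rule runs_eq[OF 1]) (use ne False in \<open>auto simp: fun_eq_iff\<close>)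
  next
    case True
    then obtain z' where z: "z = b # z'" by blast
    let ?\<sigma> = "\<sigma>(i := word_tape ((p @ [b]) @ u) (length (p @ [b])), j := word_tape ((p @ [b]) @ z') (length (p @ [b])))"
    have 1: "runs K B (move {i, j} 1) \<sigma> ?\<sigma>"
      by (rule runs_eq[OF runsI[OF runs_in_move]]) (use Cons.prems z in \<open>auto simp: word_tape_def\<close>)
    have "\<exists>n. runs K B (Loop (\<lambda>s. s i \<noteq> 0 \<and> s i = s j) (move {i, j} 1)) ?\<sigma>
      (?\<sigma>(i := word_tape ((p @ [b]) @ u) n, j := word_tape ((p @ [b]) @ z') n)) \<and>
      n \<le> length ((p @ [b]) @ u) \<and> n \<le> length ((p @ [b]) @ z') \<and>
      (cells ((p @ [b]) @ u) (int n) = cells ((p @ [b]) @ z') (int n) \<longleftrightarrow> u = z')"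
      by (rule Cons.IH) (use Cons.prems z in auto)
    then obtain n where n: "runs K B (Loop (\<lambda>s. s i \<noteq> 0 \<and> s i = s j) (move {i, j} 1)) ?\<sigma>
      (?\<sigma>(i := word_tape ((p @ [b]) @ u) n, j := word_tape ((p @ [b]) @ z') n))"
      "n \<le> length ((p @ [b]) @ u)" "n \<le> length ((p @ [b]) @ z')"
      "cells ((p @ [b]) @ u) (int n) = cells ((p @ [b]) @ z') (int n) \<longleftrightarrow> u = z'" by blast
    have 2: "runs K B (Loop (\<lambda>s. s i \<noteq> 0 \<and> s i = s j) (move {i, j} 1)) \<sigma>
      (\<sigma>(i := word_tape (p @ b # u) n, j := word_tape (p @ z) n))"
      by (rule runs_LoopT[OF 1 runs_eq[OF n(1)]]) (use Cons.prems z in \<open>auto simp: scan_def fun_eq_iff\<close>)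
    show ?thesis
      by (rule exI[of _ n], rule conjI, rule runs_eq[OF 2]) (use n z in \<open>auto simp: fun_eq_iff\<close>)
  qed
qed

definition flag :: "bool \<Rightarrow> nat" where
  "flag b = (if b then 1 else 0)"

text \<open>Looks up the word on tape \<open>i\<close> in the list on tape \<open>l\<close>; \<open>e\<close> receives the entries, \<open>a\<close> the answer.\<close>

definition lookup :: "nat \<Rightarrow> nat \<Rightarrow> nat \<Rightarrow> nat \<Rightarrow> nat \<Rightarrow> prog" where
  "lookup i l e a f = Seq (Loop (\<lambda>s. s l \<noteq> 0)
     (Seq (decode_fst l e f) (Seq (rewind e) (Seq (Loop (\<lambda>s. s e \<noteq> 0 \<and> s e = s i) (move {e, i} 1))
       (Seq (Cond (\<lambda>s. s e = s i) (emit a (\<lambda>_. 1) 0) skip) (Seq (rewind i) (clear e)))))))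
     (rewind l)"

lemma wf_lookup [simp]:
  "i < T \<Longrightarrow> l < T \<Longrightarrow> e < T \<Longrightarrow> a < T \<Longrightarrow> f < T \<Longrightarrow> 2 < S \<Longrightarrow> wf_prog S T (lookup i l e a f)"
  and ask_free_lookup [simp]: "ask_free (lookup i l e a f)"
  by (simp_all add: lookup_def)

lemma runs_lookup:
  assumes "\<sigma> i = word_tape z 0" "\<sigma> l = word_tape w 0" "\<sigma> e = blank_tape" "\<sigma> a = blank_tape" "\<sigma> f = blank_tape"
    "distinct [i, l, e, a, f]" "length z \<le> B" "length w \<le> B" "1 \<le> B"
  shows "runs K B (lookup i l e a f) \<sigma> (\<sigma>(a := mark_tape (flag (listed z w))))"
proof -
  define body where "body = Seq (decode_fst l e f) (Seq (rewind e) (Seq (Loop (\<lambda>s. s e \<noteq> 0 \<and> s e = s i) (move {e, i} 1))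
       (Seq (Cond (\<lambda>s. s e = s i) (emit a (\<lambda>_. 1) 0) skip) (Seq (rewind i) (clear e)))))"
  \<comment> \<open>\<open>b\<close> says whether one of the entries in the part \<open>p\<close>
    already read has matched.\<close>
  have loop: "runs K B (Loop (\<lambda>s. s l \<noteq> 0) body) (\<sigma>(l := word_tape w (length p), a := mark_tape (flag b)))
     (\<sigma>(l := word_tape w (length w), a := mark_tape (flag (b \<or> listed z s))))" if "w = p @ s" for p s b
    using that
  proof (induction "length s" arbitrary: p s b rule: less_induct)
    case less
    show ?case
    proof (cases "s = []")
      case True
      then show ?thesis
        by (intro runs_eq[OF runs_LoopF]) (use less.prems assms in \<open>auto simp: scan_def listed.simps\<close>)
    next
      case False
      let ?u = "fst (unpair s)" and ?s = "snd (unpair s)"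
      obtain q where q: "s = q @ ?s" using unpair_suffix by blast
      have w: "w = (p @ q) @ ?s" using less.prems q by simp
      have lq: "length (p @ s) - length ?s = length (p @ q)"
        using arg_cong[OF w, of length] less.prems by simp
      have lu: "length ?u \<le> length w" using length_unpair[of s] less.prems by simp
      let ?b = "b \<or> ?u = z"
      define \<sigma>0 where "\<sigma>0 = \<sigma>(l := word_tape w (length p), a := mark_tape (flag b))"
      define \<sigma>1 where "\<sigma>1 = \<sigma>(l := word_tape w (length (p @ q)), a := mark_tape (flag b), e := word_tape ?u (length ?u))"
      define \<sigma>2 where "\<sigma>2 = \<sigma>(l := word_tape w (length (p @ q)), a := mark_tape (flag b), e := word_tape ?u 0)"
      have 1: "runs K B (decode_fst l e f) \<sigma>0 \<sigma>1"
        by (rule runs_decode_fst[where p = p and s = s])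
          (use assms less.prems lq in \<open>auto simp: \<sigma>0_def \<sigma>1_def fun_eq_iff\<close>)
      have 2: "runs K B (rewind e) \<sigma>1 \<sigma>2"
        by (rule runs_rewind[where u = ?u and n = "length ?u"])
          (use assms in \<open>auto simp: \<sigma>1_def \<sigma>2_def fun_eq_iff\<close>)
      have "\<exists>n. runs K B (Loop (\<lambda>s. s e \<noteq> 0 \<and> s e = s i) (move {e, i} 1)) \<sigma>2
        (\<sigma>2(e := word_tape ([] @ ?u) n, i := word_tape ([] @ z) n)) \<and>
         n \<le> length ([] @ ?u) \<and> n \<le> length ([] @ z) \<and> (cells ([] @ ?u) (int n) = cells ([] @ z) (int n) \<longleftrightarrow> ?u = z)"
        by (rule runs_compare) (use assms lu in \<open>auto simp: \<sigma>2_def\<close>)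
      then obtain n where 3: "runs K B (Loop (\<lambda>s. s e \<noteq> 0 \<and> s e = s i) (move {e, i} 1)) \<sigma>2
        (\<sigma>2(e := word_tape ?u n, i := word_tape z n))"
        and n: "n \<le> length ?u" "n \<le> length z" "cells ?u (int n) = cells z (int n) \<longleftrightarrow> ?u = z" by auto
      let ?\<sigma>3 = "\<sigma>2(e := word_tape ?u n, i := word_tape z n)"
      let ?\<sigma>4 = "?\<sigma>3(a := mark_tape (flag ?b))"
      have sc: "scan ?\<sigma>3 e = scan ?\<sigma>3 i \<longleftrightarrow> ?u = z" using n(3) assms by (auto simp: scan_def)
      have 4: "runs K B (Cond (\<lambda>s. s e = s i) (emit a (\<lambda>_. 1) 0) skip) ?\<sigma>3 ?\<sigma>4"
      proof (cases "?u = z")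
        case True
        have "runs K B (emit a (\<lambda>_. 1) 0) ?\<sigma>3 ?\<sigma>4"
          by (rule runs_set_mark[where v = "flag b"]) (use assms True in \<open>auto simp: \<sigma>2_def flag_def\<close>)
        then show ?thesis by (rule runs_CondT) (use sc True in blast)
      next
        case False
        have "?\<sigma>4 = ?\<sigma>3" using False assms by (auto simp: \<sigma>2_def fun_eq_iff)
        then have "runs K B skip ?\<sigma>3 ?\<sigma>4" using runs_skip[of K B ?\<sigma>3] by simp
        then show ?thesis by (rule runs_CondF) (use sc False in blast)
      qed
      let ?\<sigma>5 = "?\<sigma>4(i := word_tape z 0)"
      have 5: "runs K B (rewind i) ?\<sigma>4 ?\<sigma>5"
        by (rule runs_rewind[where u = z and n = n]) (use assms n in auto)
      have 6: "runs K B (clear e) ?\<sigma>5 (\<sigma>(l := word_tape w (length (p @ q)), a := mark_tape (flag ?b)))"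
        by (rule runs_clear[where u = ?u and n = n])
          (use assms n lu in \<open>auto simp: \<sigma>2_def fun_eq_iff\<close>)
      have 7: "runs K B body \<sigma>0 (\<sigma>(l := word_tape w (length (p @ q)), a := mark_tape (flag ?b)))"
        unfolding body_def
        by (rule runs_Seq[OF 1 runs_Seq[OF 2 runs_Seq[OF 3 runs_Seq[OF 4 runs_Seq[OF 5 6]]]]])
      have 8: "runs K B (Loop (\<lambda>s. s l \<noteq> 0) body) (\<sigma>(l := word_tape w (length (p @ q)), a := mark_tape (flag ?b)))
         (\<sigma>(l := word_tape w (length w), a := mark_tape (flag (?b \<or> listed z ?s))))"
        by (rule less.hyps[OF length_snd_unpair[OF False] w])
      have li: "b \<or> listed z s \<longleftrightarrow> ?b \<or> listed z ?s"
        using False listed.simps[of z s] by auto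
      have "scan \<sigma>0 l \<noteq> 0"
        using False less.prems assms by (auto simp: \<sigma>0_def scan_def cells_nth)
      then show ?thesis unfolding li \<sigma>0_def[symmetric] by (intro runs_LoopT[OF 7 8])
    qed
  qed
  have 1: "runs K B (Loop (\<lambda>s. s l \<noteq> 0) body) \<sigma> (\<sigma>(l := word_tape w (length w), a := mark_tape (flag (listed z w))))"
    using loop[of "[]" w False] assms by (simp add: flag_def mark_tape_0 fun_upd_idem)
  have 2: "runs K B (rewind l) (\<sigma>(l := word_tape w (length w), a := mark_tape (flag (listed z w)))) (\<sigma>(a := mark_tape (flag (listed z w))))"
    by (rule runs_rewind[where u = w and n = "length w"]) (use assms in \<open>auto simp: fun_eq_iff\<close>)
  show ?thesis unfolding lookup_def body_def[symmetric] by (rule runs_Seq[OF 1 2])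
qed

section \<open>Reading the query word of a simulated machine\<close>

lemma query_word_nth:
  assumes "i < length (query_word c)"
  shows "c (int i) = bit_sym (query_word c ! i)"
proof -
  have "i < (LEAST n. c (int n) \<notin> {1, 2})" using assms by (simp add: query_word_def)
  then have "c (int i) \<in> {1, 2}" using not_less_Least by blast
  moreover have "query_word c ! i = (c (int i) = 2)" using assms by (simp add: query_word_def)
  ultimately show ?thesis by (auto simp: bit_sym_def)
qed

lemma query_word_end:
  assumes "\<And>i. int m < i \<Longrightarrow> c i = 0"
  shows "c (int (length (query_word c))) \<notin> {1, 2}"
proof -
  have "c (int (Suc m)) \<notin> {1, 2}" using assms[of "int (Suc m)"] by simp
  from LeastI[where P = "\<lambda>n. c (int n) \<notin> {1, 2}", OF this] show ?thesis
    by (simp add: query_word_def)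
qed

text \<open>
  Copies the query word to tape \<open>z\<close>.  Tape \<open>g\<close> bears a single mark; its head moves along with the
  head of the query tape, so that the latter can be brought back to where it was.
\<close>

definition fetch_query :: "nat \<Rightarrow> nat \<Rightarrow> nat \<Rightarrow> prog" where
  "fetch_query r g z = Seq (Loop (\<lambda>s. s r \<noteq> 3) (move {1, r, g} (-1)))
     (Seq (Loop (\<lambda>s. s r \<noteq> 2) (move {1, r, g} 1))
     (Seq (Loop (\<lambda>s. s 1 \<in> {1, 2}) (copy_cell {1, r, g} 1 z))
     (Seq (Loop (\<lambda>s. s r \<noteq> 3) (move {1, r, g} (-1)))
     (Seq (Loop (\<lambda>s. s g \<noteq> 1) (move {1, r, g} 1)) (rewind z)))))"

lemma runs_fetch_query:
  assumes "\<sigma> 1 = (c, h)" "\<sigma> r = (ruler m, h)" "\<sigma> g = mark_tape 1" "\<sigma> z = blank_tape" "distinct [1, r, g, z]"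
    "\<bar>h\<bar> \<le> int m" "1 \<le> m" "2 * m + 1 \<le> B" "\<And>i. int m < \<bar>i\<bar> \<Longrightarrow> c i = 0"
  shows "runs K B (fetch_query r g z) \<sigma> (\<sigma>(z := word_tape (query_word c) 0))"
proof -
  let ?w = "query_word c"
  define G where "G = fst (mark_tape 1)"
  \<comment> \<open>\<open>e\<close> is the current position on the query tape and \<open>u\<close>
    the part copied so far. The head of \<open>g\<close> is offset by \<open>h\<close>, so its mark
    in cell \<open>0\<close> is under the head exactly when the query head is back at
    \<open>h\<close>.\<close>
  define \<tau> where "\<tau> = (\<lambda>e u. \<sigma>(1 := (c, e), r := (ruler m, e), g := (G, e - h), z := word_tape u (length u)))"
  have lw: "length ?w \<le> Suc m" by (rule length_query_word) (use assms(9) in auto)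
  have mv: "(\<lambda>l. if l \<in> {1, r, g} then (fst (\<tau> e u l), snd (\<tau> e u l) + d) else \<tau> e u l) = \<tau> (e + d) u" for e d u
    using assms(5) by (auto simp: \<tau>_def fun_eq_iff)
  have \<tau>0: "\<sigma> = \<tau> h []"
    using assms by (auto simp: \<tau>_def G_def mark_tape_def word_tape_Nil fun_eq_iff)
  \<comment> \<open>A query word may fill the cells \<open>0\<close> to \<open>m\<close>, so copying
    may end at \<open>m + 1\<close>, just beyond the ruler. With the offset \<open>h\<close> the
    head of \<open>g\<close> can then be at distance \<open>2 * m + 1\<close>, whence the bound on
    \<open>B\<close>.\<close>
  have bd: "\<bar>snd (\<tau> e u l)\<bar> \<le> int B" if "l \<in> {1, r, g}" "- int m \<le> e" "e \<le> int m + 1" for e u l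
    using that assms by (auto simp: \<tau>_def)
  have seek: "runs K B (Loop (\<lambda>s. s i \<noteq> v) (move {1, r, g} d)) (\<tau> e u) (\<tau> e' u)"
    if "i \<in> {1, r, g}" "e' = e + d * int n" "\<And>j. j < n \<Longrightarrow> fst (\<tau> e u i) (snd (\<tau> e u i) + d * int j) \<noteq> v"
      "fst (\<tau> e u i) (snd (\<tau> e u i) + d * int n) = v" "\<And>j. j \<le> n \<Longrightarrow> - int m \<le> e + d * int j \<and> e + d * int j \<le> int m + 1"
    for i v d e e' u n
  proof (rule runs_seek[OF that(1), where n = n and P = "\<lambda>a. a \<noteq> v"])
    fix l j assume lj: "l \<in> {1, r, g}" "j \<le> n"
    have "snd (\<tau> e u l) + d * int j = snd (\<tau> (e + d * int j) u l)"
      using fun_cong[OF mv[of e u "d * int j"], of l] lj by (metis snd_conv)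
    with bd[OF lj(1), of "e + d * int j" u] that(5)[OF lj(2)] show "\<bar>snd (\<tau> e u l) + d * int j\<bar> \<le> int B" by simp
  next
    show "\<tau> e' u = (\<lambda>l. if l \<in> {1, r, g} then (fst (\<tau> e u l), snd (\<tau> e u l) + d * int n) else \<tau> e u l)"
      unfolding mv that(2) ..
  qed (use that in auto)
  have \<tau>r: "\<tau> e u r = (ruler m, e)" "\<tau> e u g = (G, e - h)" "\<tau> e u 1 = (c, e)" for e u
    using assms(5) by (auto simp: \<tau>_def)
  have 1: "runs K B (Loop (\<lambda>s. s r \<noteq> 3) (move {1, r, g} (-1))) (\<tau> h []) (\<tau> (- int m) [])"
    by (rule seek[where n = "nat (h + int m)"]) (use assms in \<open>auto simp: \<tau>r ruler_def\<close>)
  have 2: "runs K B (Loop (\<lambda>s. s r \<noteq> 2) (move {1, r, g} 1)) (\<tau> (- int m) []) (\<tau> 0 [])"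
    by (rule seek[where n = m]) (use assms in \<open>auto simp: \<tau>r ruler_def\<close>)
  have cp: "runs K B (Loop (\<lambda>s. s 1 \<in> {1, 2}) (copy_cell {1, r, g} 1 z)) (\<tau> (int (length ?w - j)) (take (length ?w - j) ?w))
      (\<tau> (int (length ?w)) ?w)" if "j \<le> length ?w" for j
    using that
  proof (induction j)
    case 0
    have "c (int (length ?w)) \<notin> {1, 2}" by (rule query_word_end[of m]) (use assms(9) in auto)
    then have "\<not> scan (\<tau> (int (length ?w)) ?w) 1 \<in> {1, 2}" by (simp only: scan_def \<tau>r fst_conv snd_conv not_False_eq_True)
    then show ?case by (simp add: runs_LoopF)
  next
    case (Suc j)
    define n where "n = length ?w - Suc j"
    have n: "n < length ?w" "length ?w - j = Suc n" using Suc.prems by (auto simp: n_def)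
    have cn: "c (int n) = bit_sym (?w ! n)" by (rule query_word_nth[OF n(1)])
    have tk: "take (Suc n) ?w = take n ?w @ [?w ! n]" by (rule take_Suc_conv_app_nth[OF n(1)])
    have ltk: "length (take n ?w) = n" using n by simp
    have sc: "scan (\<tau> (int n) (take n ?w)) 1 = bit_sym (?w ! n)" by (simp only: scan_def \<tau>r cn fst_conv snd_conv)
    have "runs K B (copy_cell {1, r, g} 1 z) (\<tau> (int n) (take n ?w)) (\<tau> (int (Suc n)) (take (Suc n) ?w))"
    proof (rule runs_eq[OF runsI[OF runs_in_copy_cell]])
      fix l assume l: "l \<in> {1, r, g}"
      have "snd (\<tau> (int n) (take n ?w) l) + 1 = snd (\<tau> (int n + 1) (take n ?w) l)"
        using fun_cong[OF mv[of "int n" "take n ?w" 1], of l] l by (metis snd_conv)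
      with bd[OF l, of "int n + 1" "take n ?w"] n lw show "\<bar>snd (\<tau> (int n) (take n ?w) l) + 1\<bar> \<le> int B" by simp
    next
      show "\<bar>snd (\<tau> (int n) (take n ?w) z) + 1\<bar> \<le> int B"
        using n lw assms by (simp add: \<tau>_def)
      show "(\<lambda>l. if l = z then ((fst (\<tau> (int n) (take n ?w) z))(snd (\<tau> (int n) (take n ?w) z) := scan (\<tau> (int n) (take n ?w)) 1),
                snd (\<tau> (int n) (take n ?w) z) + 1)
           else if l \<in> {1, r, g} then (fst (\<tau> (int n) (take n ?w) l), snd (\<tau> (int n) (take n ?w) l) + 1)
                else \<tau> (int n) (take n ?w) l) = \<tau> (int (Suc n)) (take (Suc n) ?w)"
      proof
        fix l
        have \<tau>z: "\<tau> e u z = (cells u, int (length u))" for e u by (simp add: \<tau>_def word_tape_def)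
        have up: "(cells (take n ?w))(int n := bit_sym (?w ! n)) = cells (take (Suc n) ?w)"
          using cells_snoc[of "take n ?w" "?w ! n"] by (simp only: ltk tk)
        have l2: "int (length (take (Suc n) ?w)) = int n + 1" using n by simp
        show "(if l = z then ((fst (\<tau> (int n) (take n ?w) z))(snd (\<tau> (int n) (take n ?w) z) := scan (\<tau> (int n) (take n ?w)) 1),
                snd (\<tau> (int n) (take n ?w) z) + 1)
           else if l \<in> {1, r, g} then (fst (\<tau> (int n) (take n ?w) l), snd (\<tau> (int n) (take n ?w) l) + 1)
                else \<tau> (int n) (take n ?w) l) = \<tau> (int (Suc n)) (take (Suc n) ?w) l"
        proof (cases "l = z")
          case True
          then show ?thesis unfolding sc by (simp only: \<tau>z fst_conv snd_conv ltk up l2 if_True refl)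
        next
          case False
          have "\<tau> (int n + 1) (take n ?w) l = \<tau> (int (Suc n)) (take (Suc n) ?w) l"
            using False by (simp add: \<tau>_def add.commute)
          moreover have "(if l \<in> {1, r, g} then (fst (\<tau> (int n) (take n ?w) l), snd (\<tau> (int n) (take n ?w) l) + 1)
                else \<tau> (int n) (take n ?w) l) = \<tau> (int n + 1) (take n ?w) l"
            using fun_cong[OF mv[of "int n" "take n ?w" 1], of l] .
          ultimately show ?thesis using False by (simp only: if_False refl)
        qed
      qed
    qed
    note * = runs_LoopT[where c = "\<lambda>s. s 1 \<in> {1, 2}", OF this]
    have "runs K B (Loop (\<lambda>s. s 1 \<in> {1, 2}) (copy_cell {1, r, g} 1 z)) (\<tau> (int (Suc n)) (take (Suc n) ?w)) (\<tau> (int (length ?w)) ?w)"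
      using Suc n(2) by simp
    from *[OF this] sc show ?case by (simp add: n_def[symmetric] bit_sym_def)
  qed
  have 3: "runs K B (Loop (\<lambda>s. s 1 \<in> {1, 2}) (copy_cell {1, r, g} 1 z)) (\<tau> 0 []) (\<tau> (int (length ?w)) ?w)"
    using cp[of "length ?w"] by simp
  have 4: "runs K B (Loop (\<lambda>s. s r \<noteq> 3) (move {1, r, g} (-1))) (\<tau> (int (length ?w)) ?w) (\<tau> (- int m) ?w)"
    by (rule seek[where n = "length ?w + m"]) (use assms lw in \<open>auto simp: \<tau>r ruler_def\<close>)
  have 5: "runs K B (Loop (\<lambda>s. s g \<noteq> 1) (move {1, r, g} 1)) (\<tau> (- int m) ?w) (\<tau> h ?w)"
    by (rule seek[where n = "nat (h + int m)"]) (use assms in \<open>auto simp: \<tau>r G_def mark_tape_def\<close>)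
  have 6: "runs K B (rewind z) (\<tau> h ?w) (\<sigma>(z := word_tape ?w 0))"
    by (rule runs_rewind[where u = ?w and n = "length ?w"])
      (use assms in \<open>auto simp: \<tau>_def G_def mark_tape_def fun_eq_iff\<close>)
  show ?thesis
    unfolding fetch_query_def by (subst \<tau>0) (rule runs_Seq[OF 1 runs_Seq[OF 2 runs_Seq[OF 3 runs_Seq[OF 4 runs_Seq[OF 5 6]]]]])
qed

lemma wf_fetch_query [simp]: "1 < T \<Longrightarrow> r < T \<Longrightarrow> g < T \<Longrightarrow> z < T \<Longrightarrow> wf_prog S T (fetch_query r g z)"
  and ask_free_fetch_query [simp]: "ask_free (fetch_query r g z)"
  by (simp_all add: fetch_query_def)

text \<open>A comparison of two lengths: whichever tape still shows a symbol at the end holds the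
  longer word.\<close>

lemma runs_race:
  assumes "\<sigma> i = word_tape (p @ u) (length p)" "\<sigma> j = word_tape (q @ v) (length p)" "i \<noteq> j"
    "length p = length q" "length (p @ u) \<le> B" "length (q @ v) \<le> B"
    "\<sigma>' = \<sigma>(i := word_tape (p @ u) (min (length (p @ u)) (length (q @ v))),
      j := word_tape (q @ v) (min (length (p @ u)) (length (q @ v))))"
  shows "runs K B (Loop (\<lambda>s. s i \<noteq> 0 \<and> s j \<noteq> 0) (move {i, j} 1)) \<sigma> \<sigma>'"
  using assms
proof (induction u arbitrary: p q v \<sigma>)
  case Nil
  have "scan \<sigma> i = 0" using Nil.prems(1) by (simp add: scan_def)
  with Nil show ?case by (intro runs_eq[OF runs_LoopF]) (auto simp: fun_eq_iff)
next
  case (Cons b u)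
  show ?case
  proof (cases v)
    case Nil
    have "cells (q @ v) (int (length p)) = 0" using Nil Cons.prems(4) by simp
    then show ?thesis
      by (intro runs_eq[OF runs_LoopF]) (use Cons.prems Nil in \<open>auto simp: scan_def fun_eq_iff\<close>)
  next
    case v: (Cons c v')
    let ?\<sigma> = "\<sigma>(i := word_tape ((p @ [b]) @ u) (length (p @ [b])), j := word_tape ((q @ [c]) @ v') (length (p @ [b])))"
    have 1: "runs K B (move {i, j} 1) \<sigma> ?\<sigma>"
      by (rule runs_eq[OF runsI[OF runs_in_move]]) (use Cons.prems v in \<open>auto simp: word_tape_def\<close>)
    have 2: "runs K B (Loop (\<lambda>s. s i \<noteq> 0 \<and> s j \<noteq> 0) (move {i, j} 1)) ?\<sigma> \<sigma>'"
      by (rule Cons.IH[where p = "p @ [b]" and q = "q @ [c]" and v = v'])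
        (use Cons.prems v in \<open>auto simp: fun_eq_iff\<close>)
    have c: "cells (q @ v) (int (length p)) = bit_sym c" using v Cons.prems(4) by simp
    have "scan \<sigma> i = bit_sym b" "scan \<sigma> j = bit_sym c"
      using Cons.prems(1,2) c by (simp_all add: scan_def)
    then show ?thesis by (intro runs_LoopT[OF 1 2]) simp
  qed
qed

text \<open>
  Inputs have the form \<open>((x, (pad, l)), v)\<close>.  The machine is run on \<open>x\<close> with the words listed in \<open>l\<close>
  as oracle, with resources bounded in terms of the padding; \<open>v\<close> is a claim about one word, checked
  against \<open>l\<close> unless it is too long to matter.
\<close>

definition list_sim :: "machine \<Rightarrow> lang" where
  "list_sim M = {w. let v = snd (unpair w); x = fst (unpair (fst (unpair w))); a = snd (unpair (fst (unpair w)));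
      pad = fst (unpair a); l = snd (unpair a); n = length pad + length x in
     sim_accepts M (list_oracle l) (n + 1) (n + 4) x \<and>
     (n + 4 < length v \<or> (v \<noteq> [] \<and> (hd v \<longleftrightarrow> listed (tl v) l)))}"

text \<open>The resources are linear in the padding and the input, so rulers and clock limit are
  produced by walking along two words, and a linear space bound suffices. No query is asked: the
  answers for \<open>M\<close> come from \<open>lookup\<close>.\<close>

lemma list_sim_PSPACE:
  assumes M: "oracle_tm M"
  shows "list_sim M \<in> PSPACE"
proof -
  define k where "k = tapes M"
  note orM = oracle_tmD[OF M]
  have k2: "2 \<le> k" unfolding k_def by (rule orM(2))
  define cl cu xa vt aa pd ls g z en an fl lg cb where
    lay: "cl = 2 * k + 1" "cu = 2 * k + 2" "xa = 2 * k + 3" "vt = 2 * k + 4" "aa = 2 * k + 5" "pd = 2 * k + 6"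
      "ls = 2 * k + 7" "g = 2 * k + 8" "z = 2 * k + 9" "en = 2 * k + 10" "an = 2 * k + 11" "fl = 2 * k + 12"
      "lg = 2 * k + 13" "cb = 2 * k + 14"
  define T where "T = 2 * k + 15"
  define S where "S = states M + symbols M + 5"
  \<comment> \<open>After the change of state, the answer and the fetched word are removed, because
    the next query needs these tapes blank.\<close>
  define Q where "Q = Seq (fetch_query (k + 1) g z) (Seq (lookup z ls en an fl)
    (Seq (emit (2 * k) (\<lambda>s. query_target M (s an = 1) (s (2 * k))) 0) (Seq (emit an (\<lambda>_. 0) 0) (clear z))))"
  \<comment> \<open>Tape \<open>0\<close> is cleared and reused for \<open>x\<close>, where
    \<open>M\<close> expects its input. The rulers start with radius \<open>1\<close> and the limit
    with \<open>4\<close>, and both grow by one for each symbol of the padding and of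
    \<open>x\<close>; this gives \<open>n + 1\<close> and \<open>n + 4\<close>. The limit on
    \<open>cu\<close> serves the clock and later the test of the length of \<open>v\<close>.\<close>
  define prep where "prep = Seq (decode_pair 0 xa vt fl) (Seq (clear 0) (Seq (decode_pair xa 0 aa fl)
    (Seq (decode_pair aa pd ls fl) (Seq (emit g (\<lambda>_. 1) 0)
    (Seq (seq_upto (\<lambda>i. Seq (new_ruler (k + i)) (Seq (for_each pd (extend_ruler (k + i))) (for_each 0 (extend_ruler (k + i))))) k)
    (Seq (repeat 4 (append_mark cu)) (Seq (for_each pd (append_mark cu)) (for_each 0 (append_mark cu)))))))))"
  define claimed where "claimed = Cond (\<lambda>s. s vt = 0) skip (Seq (move {vt} 1) (Seq (copy vt z) (Seq (rewind z) (lookup z ls en an fl))))"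
  define check where "check = Seq (Loop (\<lambda>s. s vt \<noteq> 0 \<and> s cu \<noteq> 0) (move {vt, cu} 1))
    (Seq (emit lg (\<lambda>s. if s vt \<noteq> 0 then 1 else 0) 0) (Seq (rewind vt) (Seq (emit cb (\<lambda>s. s vt) 0)
      claimed)))"
  define prog where "prog = Seq prep (Seq (emit (2 * k) (\<lambda>_. start M) 0) (Seq (sim M cl cu Q) check))"
  \<comment> \<open>\<open>lg\<close> reports that \<open>v\<close> is too long, and
    \<open>cb\<close> is the first symbol of \<open>v\<close>: \<open>2\<close> or \<open>1\<close>
    for a claimed yes or no. For empty \<open>v\<close> it is blank and neither alternative
    applies.\<close>
  define fin where "fin = (\<lambda>s :: nat \<Rightarrow> nat. s (2 * k) = accept M \<and>
    (s lg = 1 \<or> (s cb = 2 \<and> s an = 1) \<or> (s cb = 1 \<and> s an \<noteq> 1)))"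
  have lt: "start M < S" "query_target M b q < S" for b q
    using orM(3) query_target_lt[OF M, of b q] by (auto simp: S_def)
  have wf: "wf_prog S T prog"
    unfolding prog_def prep_def check_def claimed_def Q_def using k2 M lt
    by (simp add: S_def lay T_def k_def[symmetric])
  have af: "ask_free prog"
    unfolding prog_def prep_def check_def claimed_def Q_def by simp
  show ?thesis
  proof (rule PSPACEI[OF wf _ _ af, where r = "[:10, 4:]" and c = fin])
    fix w :: word
    define xw where "xw = fst (unpair w)"
    define v where "v = snd (unpair w)"
    define x where "x = fst (unpair xw)"
    define a where "a = snd (unpair xw)"
    define pad where "pad = fst (unpair a)"
    define l where "l = snd (unpair a)"
    define n where "n = length pad + length x"
    define m where "m = n + 1"
    define mc where "mc = n + 4"
    define B where "B = poly [:10, 4:] (length w)"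
    define orac where "orac = list_oracle l"
    have len: "length xw + length v \<le> length w" "length x + length a \<le> length xw" "length pad + length l \<le> length a"
      using length_unpair by (auto simp: xw_def v_def x_def a_def pad_def l_def)
    have Bw: "B = 4 * length w + 10" by (simp add: B_def)
    have B: "m \<le> B" "mc < B" "2 * m + 2 \<le> B" "length w \<le> B" "length xw \<le> B" "length v \<le> B" "length x \<le> B"
      "length a \<le> B" "length pad \<le> B" "length l \<le> B" "1 \<le> B"
      using len by (auto simp: Bw m_def mc_def n_def)
    define e :: store where "e = (\<lambda>_. blank_tape)"
    define \<sigma>1 where "\<sigma>1 = e(0 := word_tape w 0, xa := word_tape xw 0, vt := word_tape v 0)"
    define \<sigma>2 where "\<sigma>2 = e(xa := word_tape xw 0, vt := word_tape v 0)"
    define \<sigma>3 where "\<sigma>3 = e(xa := word_tape xw 0, vt := word_tape v 0, 0 := word_tape x 0, aa := word_tape a 0)"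
    define \<sigma>4 where "\<sigma>4 = e(xa := word_tape xw 0, vt := word_tape v 0, 0 := word_tape x 0, aa := word_tape a 0,
      pd := word_tape pad 0, ls := word_tape l 0)"
    define \<sigma>5 where "\<sigma>5 = e(xa := word_tape xw 0, vt := word_tape v 0, 0 := word_tape x 0, aa := word_tape a 0,
      pd := word_tape pad 0, ls := word_tape l 0, g := mark_tape 1)"
    have p1: "runs K B (decode_pair 0 xa vt fl) (init_store w) \<sigma>1" for K
      by (rule runs_decode_pair[where w = w])
        (use B in \<open>auto simp: init_store_def \<sigma>1_def e_def input_tape_word xw_def v_def lay fun_eq_iff\<close>)
    have p2: "runs K B (clear 0) \<sigma>1 \<sigma>2" for K
      by (rule runs_clear[where u = w and n = 0]) (use B in \<open>auto simp: \<sigma>1_def \<sigma>2_def e_def lay fun_eq_iff\<close>)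
    have p3: "runs K B (decode_pair xa 0 aa fl) \<sigma>2 \<sigma>3" for K
      by (rule runs_decode_pair[where w = xw])
        (use B in \<open>auto simp: \<sigma>2_def \<sigma>3_def e_def x_def a_def lay\<close>)
    have p4: "runs K B (decode_pair aa pd ls fl) \<sigma>3 \<sigma>4" for K
      by (rule runs_decode_pair[where w = a])
        (use B in \<open>auto simp: \<sigma>3_def \<sigma>4_def e_def pad_def l_def lay\<close>)
    have p5: "runs K B (emit g (\<lambda>_. 1) 0) \<sigma>4 \<sigma>5" for K
      by (rule runs_set_mark[where v = 0]) (auto simp: \<sigma>4_def \<sigma>5_def e_def mark_tape_0 lay)
    define G where "G = (\<lambda>i t. if k \<le> t \<and> t < k + i then (ruler m, 0) else \<sigma>5 t)"
    have G_at: "G i 0 = word_tape x 0" "G i pd = word_tape pad 0" if "i \<le> k" for i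
      using k2 that by (auto simp: G_def \<sigma>5_def lay)
    have p6: "runs K B (seq_upto (\<lambda>i. Seq (new_ruler (k + i)) (Seq (for_each pd (extend_ruler (k + i))) (for_each 0 (extend_ruler (k + i))))) k) (G 0) (G k)" for K
    proof (rule runs_seq_upto)
      fix i assume i: "i < k"
      let ?F = "\<lambda>b. (ruler (Suc b), 0 :: int)"
      have ex: "runs K B (extend_ruler (k + i)) (\<tau>(c := w', k + i := ?F b)) (\<tau>(c := w', k + i := ?F (b + 1)))"
        if "b + 1 \<le> n" for \<tau> c w' b
        by (rule runs_eq[OF runs_extend_ruler]) (use that B in \<open>auto simp: m_def\<close>)
      have a1: "runs K B (new_ruler (k + i)) (G i) ((G i)(k + i := ?F 0))"
        by (rule runs_eq[OF runs_new_ruler]) (use i B in \<open>auto simp: G_def \<sigma>5_def e_def lay\<close>)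
      let ?\<tau> = "(G i)(k + i := ?F 0)"
      have a2: "runs K B (for_each pd (extend_ruler (k + i))) ?\<tau> (?\<tau>(k + i := ?F (0 + length pad * 1)))"
        by (rule runs_for_each[where M = n and F = ?F, OF _ _ ex])
          (use G_at i B in \<open>auto simp: n_def lay\<close>)
      let ?\<tau>' = "?\<tau>(k + i := ?F (0 + length pad * 1))"
      have a3: "runs K B (for_each 0 (extend_ruler (k + i))) ?\<tau>' (?\<tau>'(k + i := ?F (length pad + length x * 1)))"
        by (rule runs_for_each[where M = n and F = ?F, OF _ _ ex])
          (use G_at i B k2 in \<open>auto simp: n_def\<close>)
      have "?\<tau>'(k + i := ?F (length pad + length x * 1)) = G (Suc i)"
        using i by (auto simp: G_def m_def n_def fun_eq_iff)
      with runs_Seq[OF a1 runs_Seq[OF a2 a3]]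
      show "runs K B (Seq (new_ruler (k + i)) (Seq (for_each pd (extend_ruler (k + i))) (for_each 0 (extend_ruler (k + i))))) (G i) (G (Suc i))"
        by simp
    qed
    have G0: "G 0 = \<sigma>5" by (auto simp: G_def fun_eq_iff)
    have ap: "runs K B (append_mark cu) (\<tau>(c := w', cu := unary_tape b)) (\<tau>(c := w', cu := unary_tape (b + 1)))"
      if "b + 1 \<le> mc" for \<tau> c w' b K
      by (rule runs_eq[OF runs_append_mark]) (use that B in auto)
    have p7: "runs K B (repeat 4 (append_mark cu)) (G k) ((G k)(cu := unary_tape (0 + 4)))" for K
    proof (rule runs_repeat[where M = mc])
      fix b :: nat and \<tau> :: store assume "b < mc" "\<tau> cu = unary_tape b"
      then show "runs K B (append_mark cu) \<tau> (\<tau>(cu := unary_tape (Suc b)))"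
        using B by (intro runs_append_mark) auto
    qed (auto simp: G_def \<sigma>5_def e_def lay mc_def unary_tape_def word_tape_Nil)
    have p8: "runs K B (for_each pd (append_mark cu)) ((G k)(cu := unary_tape (0 + 4)))
       ((G k)(cu := unary_tape (0 + 4), cu := unary_tape (4 + length pad * 1)))" for K
      by (rule runs_for_each[where M = mc and F = unary_tape, OF _ _ ap])
        (use G_at B in \<open>auto simp: n_def mc_def lay\<close>)
    have p9: "runs K B (for_each 0 (append_mark cu)) ((G k)(cu := unary_tape (0 + 4), cu := unary_tape (4 + length pad * 1)))
       ((G k)(cu := unary_tape (0 + 4), cu := unary_tape (4 + length pad * 1), cu := unary_tape (4 + length pad + length x * 1)))" for K
      by (rule runs_for_each[where M = mc and F = unary_tape, OF _ _ ap])
        (use G_at B in \<open>auto simp: n_def mc_def lay\<close>)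
    have prep: "runs K B prep (init_store w) ((G k)(cu := unary_tape mc))" for K
      unfolding prep_def
      by (rule runs_eq[OF runs_Seq[OF p1 runs_Seq[OF p2 runs_Seq[OF p3 runs_Seq[OF p4 runs_Seq[OF p5
            runs_Seq[OF p6[unfolded G0] runs_Seq[OF p7 runs_Seq[OF p8 p9]]]]]]]]])
        (auto simp: mc_def n_def add.commute add.left_commute)
    define \<beta> where "\<beta> = e(xa := word_tape xw 0, vt := word_tape v 0, aa := word_tape a 0,
      pd := word_tape pad 0, ls := word_tape l 0, g := mark_tape 1, cu := unary_tape mc)"
    have gt: "2 * tapes M < i" if "2 * k < i" for i using that by (simp add: k_def)
    have \<beta>_at: "\<beta> cl = blank_tape" "\<beta> cu = unary_tape mc" "\<beta> ls = word_tape l 0" "\<beta> g = mark_tape 1"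
      "\<beta> z = blank_tape" "\<beta> en = blank_tape" "\<beta> an = blank_tape" "\<beta> fl = blank_tape" "\<beta> vt = word_tape v 0"
      "\<beta> lg = blank_tape" "\<beta> cb = blank_tape"
      by (auto simp: \<beta>_def e_def lay)
    have init: "init M x = (start M, word_tape x 0 # replicate (k - 1) blank_tape)"
      by (simp add: init_def k_def input_tape_word)
    have st0: "((G k)(cu := unary_tape mc))(2 * k := mark_tape (start M)) = sim_store M (ruler m) (init M x) (\<beta>(cl := word_tape [] 0))"
    proof -
      have "\<beta>(cl := word_tape [] 0) = \<beta>" by (simp add: \<beta>_at word_tape_Nil fun_upd_idem)
      then show ?thesis using k2
        by (auto simp: fun_eq_iff sim_store_def init k_def[symmetric] nth_Cons' word_tape_def blank_tape_def
            G_def \<sigma>5_def \<beta>_def e_def lay)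
    qed
    have s1: "runs K B (emit (2 * k) (\<lambda>_. start M) 0) ((G k)(cu := unary_tape mc)) (sim_store M (ruler m) (init M x) (\<beta>(cl := word_tape [] 0)))" for K
    proof (rule runs_set_mark[where v = 0])
      show "((G k)(cu := unary_tape mc)) (2 * k) = mark_tape 0"
        using k2 by (auto simp: G_def \<sigma>5_def e_def lay mark_tape_0)
    qed (rule st0[symmetric])
    \<comment> \<open>The oracle \<open>K\<close> of the host is arbitrary: the step is that of
      \<open>M\<close> with oracle \<open>list_oracle l\<close>, obtained by searching the
      list.\<close>
    have Qspec: "runs K B Q (sim_store M (ruler m) (q, ts) (\<beta>(cl := word_tape u 0)))
        (sim_store M (ruler m) (step M orac (q, ts)) (\<beta>(cl := word_tape u 0)))"
      if q: "wf_config M (q, ts)" "\<not> halted M q" "query M q \<noteq> None" "heads_within m ts" "zero_outside m ts" for q ts u K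
    proof -
      define \<Sigma> where "\<Sigma> = sim_store M (ruler m) (q, ts) (\<beta>(cl := word_tape u 0))"
      obtain b1 b2 where ab: "query M q = Some (b1, b2)" using q(3) by auto
      have qs: "q < states M" and lts: "length ts = k" using q(1) by (simp_all add: wf_config_def k_def)
      obtain c h where ch: "ts ! 1 = (c, h)" by force
      have h: "\<bar>h\<bar> \<le> int m" using q(4) ch k2 lts by (auto simp: heads_within_nth dest!: spec[of _ 1])
      have zc: "c i = 0" if "int m < \<bar>i\<bar>" for i
        using q(5)[unfolded zero_outside_nth, rule_format, of 1 i] ch k2 lts that by simp
      let ?w = "query_word c"
      have lq: "length ?w \<le> Suc m" by (rule length_query_word) (use zc in auto)
      have \<Sigma>_at: "\<Sigma> 1 = (c, h)" "\<Sigma> (k + 1) = (ruler m, h)" "\<Sigma> (2 * k) = mark_tape q"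
        using k2 ch by (auto simp: \<Sigma>_def sim_store_def k_def)
      have \<Sigma>_other: "\<Sigma> i = \<beta> i" if "2 * k < i" "i \<noteq> cl" for i
        using that gt by (simp add: \<Sigma>_def)
      have "\<Sigma> g = \<beta> g" "\<Sigma> z = \<beta> z" "\<Sigma> ls = \<beta> ls" "\<Sigma> en = \<beta> en" "\<Sigma> an = \<beta> an" "\<Sigma> fl = \<beta> fl"
        by (simp_all add: \<Sigma>_other lay)
      then have \<Sigma>_at2: "\<Sigma> g = mark_tape 1" "\<Sigma> z = blank_tape" "\<Sigma> ls = word_tape l 0" "\<Sigma> en = blank_tape"
        "\<Sigma> an = blank_tape" "\<Sigma> fl = blank_tape"
        by (simp_all add: \<beta>_at)
      have 1: "runs K B (fetch_query (k + 1) g z) \<Sigma> (\<Sigma>(z := word_tape ?w 0))"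
        by (rule runs_fetch_query[OF \<Sigma>_at(1,2) \<Sigma>_at2(1,2)])
          (use h zc B k2 in \<open>auto simp: lay m_def\<close>)
      define ans where "ans = listed ?w l"
      have 2: "runs K B (lookup z ls en an fl) (\<Sigma>(z := word_tape ?w 0)) (\<Sigma>(z := word_tape ?w 0, an := mark_tape (flag ans)))"
        unfolding ans_def
        by (rule runs_lookup) (use \<Sigma>_at2 lq B in \<open>auto simp: lay\<close>)
      let ?\<Sigma>2 = "\<Sigma>(z := word_tape ?w 0, an := mark_tape (flag ans))"
      let ?q = "query_target M ans q"
      have sc: "scan ?\<Sigma>2 an = 1 \<longleftrightarrow> ans" "scan ?\<Sigma>2 (2 * k) = q"
        using \<Sigma>_at(3) by (auto simp: scan_def flag_def lay)
      have 3: "runs K B (emit (2 * k) (\<lambda>s. query_target M (s an = 1) (s (2 * k))) 0) ?\<Sigma>2 (?\<Sigma>2(2 * k := mark_tape ?q))"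
        by (rule runs_set_mark[where v = q]) (use \<Sigma>_at(3) sc in \<open>auto simp: lay\<close>)
      have 4: "runs K B (emit an (\<lambda>_. 0) 0) (?\<Sigma>2(2 * k := mark_tape ?q)) (\<Sigma>(z := word_tape ?w 0, 2 * k := mark_tape ?q))"
        by (rule runs_set_mark[where v = "flag ans"])
          (use \<Sigma>_at2 in \<open>auto simp: lay mark_tape_0 fun_eq_iff\<close>)
      have 5: "runs K B (clear z) (\<Sigma>(z := word_tape ?w 0, 2 * k := mark_tape ?q)) (\<Sigma>(2 * k := mark_tape ?q))"
        by (rule runs_clear[where u = ?w and n = 0])
          (use \<Sigma>_at2 lq B in \<open>auto simp: lay fun_eq_iff\<close>)
      have "\<Sigma>(2 * k := mark_tape ?q) = sim_store M (ruler m) (?q, ts) (\<beta>(cl := word_tape u 0))"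
        by (simp add: \<Sigma>_def k_def)
      moreover have "step M orac (q, ts) = (?q, ts)"
        using qs by (simp add: step_query[OF q(2) ab] ch[simplified] orac_def mem_list_oracle ans_def query_target_def ab)
      ultimately show ?thesis
        using runs_Seq[OF 1 runs_Seq[OF 2 runs_Seq[OF 3 runs_Seq[OF 4 5]]]] by (simp add: Q_def \<Sigma>_def)
    qed
    have pre: "1 \<le> m" "m \<le> B" "mc < B" "length x \<le> m" "2 * tapes M < cl" "2 * tapes M < cu" "cl \<noteq> cu"
      using B gt by (simp_all add: m_def n_def lay)
    have "\<exists>q' ts' u'. runs {} B (sim M cl cu Q) (sim_store M (ruler m) (init M x) (\<beta>(cl := word_tape [] 0)))
        (sim_store M (ruler m) (q', ts') (\<beta>(cl := word_tape u' 0))) \<and>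
      wf_config M (q', ts') \<and> bounded_tapes m ts' \<and> zero_outside m ts' \<and> length u' \<le> mc \<and>
      (q' = accept M \<longleftrightarrow> sim_accepts M orac m mc x)"
      by (rule runs_sim_input[OF M pre _ Qspec]) (rule \<beta>_at(2))
    then obtain q' ts' u' where s2: "runs {} B (sim M cl cu Q) (sim_store M (ruler m) (init M x) (\<beta>(cl := word_tape [] 0)))
        (sim_store M (ruler m) (q', ts') (\<beta>(cl := word_tape u' 0)))"
      and acc: "q' = accept M \<longleftrightarrow> sim_accepts M orac m mc x" by blast
    define \<Sigma> where "\<Sigma> = sim_store M (ruler m) (q', ts') (\<beta>(cl := word_tape u' 0))"
    have \<Sigma>_other: "\<Sigma> i = \<beta> i" if "2 * k < i" "i \<noteq> cl" for i
      using that gt by (simp add: \<Sigma>_def)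
    have "\<Sigma> cu = \<beta> cu" "\<Sigma> vt = \<beta> vt" "\<Sigma> lg = \<beta> lg" "\<Sigma> cb = \<beta> cb"
      "\<Sigma> z = \<beta> z" "\<Sigma> ls = \<beta> ls" "\<Sigma> en = \<beta> en" "\<Sigma> an = \<beta> an" "\<Sigma> fl = \<beta> fl"
      by (simp_all add: \<Sigma>_other lay)
    then have \<Sigma>_at: "\<Sigma> cu = word_tape (replicate mc False) 0" "\<Sigma> vt = word_tape v 0" "\<Sigma> lg = blank_tape" "\<Sigma> cb = blank_tape"
      "\<Sigma> z = blank_tape" "\<Sigma> ls = word_tape l 0" "\<Sigma> en = blank_tape" "\<Sigma> an = blank_tape" "\<Sigma> fl = blank_tape"
      by (simp_all add: \<beta>_at unary_tape_def)
    have \<Sigma>_st: "\<Sigma> (2 * k) = mark_tape q'" by (simp add: \<Sigma>_def k_def)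
    let ?c = "replicate mc False" and ?n = "min (length v) mc"
    let ?long = "flag (mc < length v)"
    define \<tau>1 where "\<tau>1 = \<Sigma>(vt := word_tape v ?n, cu := word_tape ?c ?n)"
    define \<tau>2 where "\<tau>2 = \<Sigma>(vt := word_tape v ?n, cu := word_tape ?c ?n, lg := mark_tape ?long)"
    define \<tau>3 where "\<tau>3 = \<Sigma>(cu := word_tape ?c ?n, lg := mark_tape ?long)"
    define \<tau>4 where "\<tau>4 = \<Sigma>(cu := word_tape ?c ?n, lg := mark_tape ?long, cb := mark_tape (cells v 0))"
    have c1: "runs {} B (Loop (\<lambda>s. s vt \<noteq> 0 \<and> s cu \<noteq> 0) (move {vt, cu} 1)) \<Sigma> \<tau>1"
      by (rule runs_race[where p = "[]" and q = "[]" and u = v and v = ?c])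
        (use \<Sigma>_at B in \<open>auto simp: \<tau>1_def lay\<close>)
    have c2: "runs {} B (emit lg (\<lambda>s. if s vt \<noteq> 0 then 1 else 0) 0) \<tau>1 \<tau>2"
      by (rule runs_set_mark[where v = 0])
        (use \<Sigma>_at in \<open>auto simp: \<tau>1_def \<tau>2_def lay mark_tape_0 scan_def flag_def cells_nth\<close>)
    have c3: "runs {} B (rewind vt) \<tau>2 \<tau>3"
      by (rule runs_rewind[where u = v and n = ?n])
        (use \<Sigma>_at B in \<open>auto simp: \<tau>2_def \<tau>3_def lay fun_eq_iff\<close>)
    have c4: "runs {} B (emit cb (\<lambda>s. s vt) 0) \<tau>3 \<tau>4"
      by (rule runs_set_mark[where v = 0])
        (use \<Sigma>_at in \<open>auto simp: \<tau>3_def \<tau>4_def lay mark_tape_0 scan_def\<close>)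
    have "\<exists>\<tau>5. runs {} B claimed \<tau>4 \<tau>5 \<and>
       \<tau>5 (2 * k) = mark_tape q' \<and> \<tau>5 lg = mark_tape ?long \<and> \<tau>5 cb = mark_tape (cells v 0) \<and>
       (v \<noteq> [] \<longrightarrow> \<tau>5 an = mark_tape (flag (listed (tl v) l)))"
    proof (cases v)
      case Nil
      have "runs {} B claimed \<tau>4 \<tau>4"
        unfolding claimed_def by (rule runs_CondT[OF runs_skip]) (use \<Sigma>_at Nil in \<open>auto simp: \<tau>4_def lay scan_def cells_nth\<close>)
      then show ?thesis using Nil \<Sigma>_st by (intro exI[of _ \<tau>4]) (auto simp: \<tau>4_def lay)
    next
      case (Cons c y)
      have \<tau>4_at: "\<tau>4 vt = word_tape (c # y) 0" "\<tau>4 z = blank_tape" "\<tau>4 ls = word_tape l 0" "\<tau>4 en = blank_tape"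
        "\<tau>4 an = blank_tape" "\<tau>4 fl = blank_tape" "\<tau>4 (2 * k) = mark_tape q'" "\<tau>4 lg = mark_tape ?long" "\<tau>4 cb = mark_tape (cells v 0)"
        using \<Sigma>_at \<Sigma>_st Cons by (auto simp: \<tau>4_def lay)
      let ?\<rho>1 = "\<tau>4(vt := word_tape (c # y) 1)"
      let ?\<rho>2 = "\<tau>4(vt := word_tape (c # y) (length (c # y)), z := word_tape y (length y))"
      let ?\<rho>3 = "\<tau>4(vt := word_tape (c # y) (length (c # y)), z := word_tape y 0)"
      have ly: "Suc (length y) \<le> B" using B(6) Cons by simp
      have d1: "runs {} B (move {vt} 1) \<tau>4 ?\<rho>1"
        by (rule runs_move1[where c = "cells (c # y)" and h = 0]) (use \<tau>4_at B in \<open>auto simp: word_tape_def\<close>)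
      have d2: "runs {} B (copy vt z) ?\<rho>1 ?\<rho>2"
        by (rule runs_copy[where p = "[c]" and s = y and v = "[]"])
          (use \<tau>4_at ly in \<open>auto simp: lay word_tape_Nil\<close>)
      have d3: "runs {} B (rewind z) ?\<rho>2 ?\<rho>3"
        by (rule runs_rewind[where u = y and n = "length y"]) (use B in auto)
      have d4: "runs {} B (lookup z ls en an fl) ?\<rho>3 (?\<rho>3(an := mark_tape (flag (listed y l))))"
        by (rule runs_lookup) (use \<tau>4_at ly B in \<open>auto simp: lay\<close>)
      have "runs {} B claimed \<tau>4
         (?\<rho>3(an := mark_tape (flag (listed y l))))"
        unfolding claimed_def by (rule runs_CondF[OF runs_Seq[OF d1 runs_Seq[OF d2 runs_Seq[OF d3 d4]]]])
          (use \<tau>4_at in \<open>auto simp: scan_def cells_nth\<close>)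
      then show ?thesis using Cons \<tau>4_at
        by (intro exI[of _ "?\<rho>3(an := mark_tape (flag (listed y l)))"]) (auto simp: lay)
    qed
    then obtain \<tau>5 where c5: "runs {} B claimed \<tau>4 \<tau>5"
      and \<tau>5: "\<tau>5 (2 * k) = mark_tape q'" "\<tau>5 lg = mark_tape ?long" "\<tau>5 cb = mark_tape (cells v 0)"
       "v \<noteq> [] \<Longrightarrow> \<tau>5 an = mark_tape (flag (listed (tl v) l))" by blast
    have "runs {} B check \<Sigma> \<tau>5"
      unfolding check_def by (rule runs_Seq[OF c1 runs_Seq[OF c2 runs_Seq[OF c3 runs_Seq[OF c4 c5]]]])
    then have "runs {} B prog (init_store w) \<tau>5"
      unfolding prog_def \<Sigma>_def by (intro runs_Seq[OF prep] runs_Seq[OF s1] runs_Seq[OF s2])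
    moreover have "heads_le B (init_store w)"
      by (auto simp: heads_le_def init_store_def input_tape_def blank_tape_def)
    ultimately obtain t where t: "exec {} B prog (init_store w) t \<tau>5"
      unfolding runs_def runs_in_def by blast
    have "fin (scan \<tau>5) \<longleftrightarrow> w \<in> list_sim M"
    proof -
      have "fin (scan \<tau>5) \<longleftrightarrow> q' = accept M \<and> (mc < length v \<or> (v \<noteq> [] \<and> (hd v \<longleftrightarrow> listed (tl v) l)))"
        using \<tau>5 by (cases v) (auto simp: fin_def scan_def flag_def bit_sym_def cells_nth)
      then show ?thesis unfolding acc list_sim_def mem_Collect_eq Let_def
        by (simp only: xw_def[symmetric] v_def[symmetric] x_def[symmetric] a_def[symmetric] pad_def[symmetric]
            l_def[symmetric] n_def[symmetric] m_def[symmetric] mc_def[symmetric] orac_def[symmetric])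
    qed
    with t show "\<exists>t \<sigma>'. exec {} (poly [:10, 4:] (length w)) prog (init_store w) t \<sigma>' \<and> (fin (scan \<sigma>') \<longleftrightarrow> w \<in> list_sim M)"
      unfolding B_def by blast
  qed (use k2 in \<open>auto simp: S_def T_def\<close>)
qed

section \<open>Sparse oracles\<close>

definition sparse :: "nat set \<Rightarrow> bool" where
  "sparse K \<longleftrightarrow> (\<exists>c. \<forall>N. card (K \<inter> {..<2 ^ N}) \<le> N + c)"

text \<open>The elements of \<open>A\<close> with index \<open>2 ^ i\<close> are taken. The element
  with index \<open>j\<close> is at least \<open>j\<close>, so only those with \<open>i < N\<close>
  can lie below \<open>2 ^ N\<close>.\<close>

lemma infinite_sparse_subset:
  assumes "infinite (A :: nat set)"
  obtains B where "B \<subseteq> A" "infinite B" "\<And>N. card (B \<inter> {..<2 ^ N}) \<le> N"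
proof
  define f where "f = (\<lambda>i. enumerate A (2 ^ i))"
  have "inj f"
    unfolding f_def
    by (rule injI) (use strict_mono_enumerate[OF assms] in \<open>auto simp: strict_mono_eq\<close>)
  then show "infinite (range f)" by (simp add: finite_image_iff)
  show "range f \<subseteq> A" using enumerate_in_set[OF assms] by (auto simp: f_def)
  fix N
  have "range f \<inter> {..<2 ^ N} \<subseteq> f ` {..<N}"
  proof
    fix y assume "y \<in> range f \<inter> {..<2 ^ N}"
    then obtain i where i: "y = f i" "f i < 2 ^ N" by auto
    have "2 ^ i \<le> f i" unfolding f_def by (rule le_enumerate[OF assms])
    with i(2) have "(2::nat) ^ i < 2 ^ N" by linarith
    then show "y \<in> f ` {..<N}" using i by simp
  qed
  then have "card (range f \<inter> {..<2 ^ N}) \<le> card (f ` {..<N})" by (intro card_mono) auto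
  also have "\<dots> \<le> N" using card_image_le[of "{..<N}" f] by simp
  finally show "card (range f \<inter> {..<2 ^ N}) \<le> N" .
qed

lemma length_encode_list:
  assumes "\<And>z. z \<in> set zs \<Longrightarrow> length z \<le> b"
  shows "length (encode_list zs) \<le> length zs * (2 * b + 2)"
  using assms
proof (induction zs)
  case (Cons z zs)
  then have "length (encode_list zs) \<le> length zs * (2 * b + 2)" "length z \<le> b" by auto
  then show ?case by (simp add: length_pair)
qed simp

text \<open>Words of length at most \<open>b\<close> have numbers below \<open>2 ^ (b + 1)\<close>,
  and sparseness is applied with \<open>N = b + 1\<close>.\<close>

lemma sparse_word_list:
  assumes "\<forall>N. card (K \<inter> {..<2 ^ N}) \<le> N + c"
  obtains zs where "set zs = {z. length z \<le> b \<and> nat_of_word z \<in> K}" "length zs \<le> b + 1 + c"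
proof -
  let ?Z = "{z. length z \<le> b \<and> nat_of_word z \<in> K}"
  have inj: "inj_on nat_of_word ?Z"
    using bij_is_inj[OF bij_nat_of_word] by (rule inj_on_subset) simp
  have sub: "nat_of_word ` ?Z \<subseteq> K \<inter> {..<2 ^ (b + 1)}"
    by (auto simp: length_le_iff)
  then have fin: "finite ?Z" using finite_imageD[OF finite_subset[OF sub] inj] by simp
  have "card ?Z = card (nat_of_word ` ?Z)" by (rule card_image[OF inj, symmetric])
  also have "\<dots> \<le> card (K \<inter> {..<2 ^ (b + 1)})" by (rule card_mono[OF _ sub]) simp
  also have "\<dots> \<le> b + 1 + c" using assms by blast
  finally have card: "card ?Z \<le> b + 1 + c" .
  obtain zs where "set zs = ?Z" "distinct zs" using finite_distinct_list[OF fin] by blast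
  with card that show ?thesis by (metis distinct_card)
qed

lemma Sigma_level_SucI:
  "R \<in> Sigma_level C k \<Longrightarrow> {x. \<exists>y. length y \<le> poly p (length x) \<and> pair x y \<in> - R} \<in> Sigma_level C (Suc k)"
  unfolding Sigma_level.simps by blast

text \<open>\<open>x \<in> L\<close> is expressed as: there is \<open>a\<close>, consisting of
  padding and list, such that for all \<open>v\<close> of bounded length, if \<open>v\<close> is a
  correct claim about \<open>K\<close> then \<open>((x, a), v)\<close> is in
  \<open>list_sim M\<close>. The two quantifiers come on top of the level \<open>k\<close> at which
  \<open>PH\<close> contains \<open>list_sim M\<close>.\<close>

lemma PSPACE_rel_subset_PH_rel:
  assumes PH: "PSPACE \<subseteq> PH" and K: "sparse K"
  shows "PSPACE_rel K \<subseteq> PH_rel K"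
proof
  fix L assume "L \<in> PSPACE_rel K"
  then obtain M s where M: "oracle_tm M" "decides_in_space M K L (poly s)"
    unfolding PSPACE_rel_def by blast
  obtain c where c: "\<forall>N. card (K \<inter> {..<2 ^ N}) \<le> N + c" using K unfolding sparse_def by blast
  obtain k where k: "list_sim M \<in> Sigma_level PTIME k"
    using list_sim_PSPACE[OF M(1)] PH unfolding PH_def by blast
  define E where "E = {w. claim K (snd (unpair w)) \<longrightarrow> w \<in> list_sim M}"
  have E: "E \<in> Sigma_level (P_rel K) k"
    using level_with_claim[OF k, of K 0] by (simp add: E_def nested_claim_def)
  \<comment> \<open>\<open>R\<close> says that \<open>u\<close> is refuted by a correct claim. The
    bound on \<open>v\<close> leaves ample room for claims of length \<open>n + 3\<close>.\<close>
  define R where "R = {u. \<exists>v. length v \<le> poly [:10, 2:] (length u) \<and> pair u v \<in> - E}"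
  define D where "D = s + [:0, 1:]"
  \<comment> \<open>The padding is to have length \<open>D + log_configs M D\<close>; with
    \<open>n\<close> at least this, \<open>n + 1\<close> and \<open>n + 4\<close> are sufficient
    resources.\<close>
  define r where "r = D + [:states M:] + [:tapes M:] * ([:symbols M:] * ([:2:] * D + 1) + ([:2:] * D + 1))"
  define N where "N = r + [:0, 1:]"
  \<comment> \<open>The doubled padding and its separator, then at most \<open>n + 4 + c\<close>
    entries, each a word of length at most \<open>n + 3\<close> costing
    \<open>2 * (n + 3) + 2\<close> symbols.\<close>
  define q where "q = 2 * r + 2 + (N + [:4 + c:]) * (2 * N + 8)"
  have "{x. \<exists>a. length a \<le> poly q (length x) \<and> pair x a \<in> - R} \<in> Sigma_level (P_rel K) (Suc (Suc k))"
    unfolding R_def by (intro Sigma_level_SucI E)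
  moreover have "{x. \<exists>a. length a \<le> poly q (length x) \<and> pair x a \<in> - R} = L"
  proof (intro set_eqI iffI)
    fix x assume "x \<in> {x. \<exists>a. length a \<le> poly q (length x) \<and> pair x a \<in> - R}"
    then obtain a where a: "pair x a \<notin> R" by auto
    define pad where "pad = fst (unpair a)"
    define l where "l = snd (unpair a)"
    define n where "n = length pad + length x"
    have n: "n \<le> length (pair x a)"
      using length_unpair[of a] by (simp add: n_def pad_def length_pair)
    have ls: "sim_accepts M (list_oracle l) (n + 1) (n + 4) x" "nat_of_word z \<in> list_oracle l \<longleftrightarrow> nat_of_word z \<in> K"
      if z: "length z \<le> n + 2" for z
    proof -
      \<comment> \<open>The correct claim about \<open>z\<close>. Its length is at most
        \<open>n + 3\<close>, so \<open>list_sim\<close> does not excuse it as too long and has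
        checked it against the list.\<close>
      define v where "v = (nat_of_word z \<in> K) # z"
      have "length v \<le> poly [:10, 2:] (length (pair x a))" using z n by (simp add: v_def)
      then have "pair (pair x a) v \<in> E" using a by (auto simp: R_def)
      moreover have "claim K v" by (simp add: claim_def v_def)
      ultimately have "pair (pair x a) v \<in> list_sim M" by (simp add: E_def)
      then have *: "sim_accepts M (list_oracle l) (n + 1) (n + 4) x \<and>
          (n + 4 < length v \<or> (v \<noteq> [] \<and> (hd v \<longleftrightarrow> listed (tl v) l)))"
        by (simp add: list_sim_def Let_def pad_def[symmetric] l_def[symmetric] n_def[symmetric])
      then show "sim_accepts M (list_oracle l) (n + 1) (n + 4) x" by blast
      from * z show "nat_of_word z \<in> list_oracle l \<longleftrightarrow> nat_of_word z \<in> K"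
        by (simp add: v_def mem_list_oracle)
    qed
    \<comment> \<open>The list agrees with \<open>K\<close> on words of length up to
      \<open>n + 2\<close>, the longest that can be queried with rulers of size
      \<open>n + 1\<close>. That \<open>M\<close> accepts under the list is part of every instance,
      so the claim about the empty word yields it.\<close>
    have "sim_accepts M K (n + 1) (n + 4) x"
      using ls(1)[of "[]"] sim_accepts_agree[OF M(1), of x "n + 1" "list_oracle l" K] ls(2)
      by (simp add: n_def)
    then show "x \<in> L" using accept_iff[OF M] unfolding sim_accepts_def by blast
  next
    fix x assume x: "x \<in> L"
    define pad where "pad = replicate (poly r (length x)) False"
    define n where "n = length pad + length x"
    \<comment> \<open>Claims of length up to \<open>n + 4\<close> are checked, and one symbol of
      them is the claimed bit; so the list has to be right up to length
      \<open>n + 3\<close>.\<close>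
    obtain zs where zs: "set zs = {z. length z \<le> n + 3 \<and> nat_of_word z \<in> K}" "length zs \<le> n + 3 + 1 + c"
      by (rule sparse_word_list[OF c])
    define a where "a = pair pad (encode_list zs)"
    have ls: "listed z (encode_list zs) \<longleftrightarrow> nat_of_word z \<in> K" if "length z \<le> n + 3" for z
      using that by (simp add: listed_encode_list zs(1))
    have nN: "n = poly N (length x)" by (simp add: n_def pad_def N_def)
    have "length (encode_list zs) \<le> length zs * (2 * (n + 3) + 2)"
      by (rule length_encode_list) (use zs in auto)
    also have "\<dots> \<le> (n + 4 + c) * (2 * n + 8)"
      by (rule mult_mono) (use zs in auto)
    finally have "length a \<le> poly q (length x)"
      by (simp add: a_def length_pair q_def pad_def nN numeral_poly add.assoc)
    moreover have "pair x a \<notin> R"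
    proof -
      have "pair (pair x a) v \<in> E" for v
      proof -
        have "sim_accepts M (list_oracle (encode_list zs)) (n + 1) (n + 4) x"
        proof -
          have "sim_accepts M K (n + 1) (n + 4) x \<longleftrightarrow> x \<in> L"
            by (rule sim_accepts_iff[OF M, where D = "poly D (length x)"])
              (simp_all add: D_def n_def pad_def r_def log_configs_def)
          moreover have "sim_accepts M K (n + 1) (n + 4) x \<longleftrightarrow> sim_accepts M (list_oracle (encode_list zs)) (n + 1) (n + 4) x"
          proof (rule sim_accepts_agree[OF M(1)])
            show "length x \<le> n + 1" by (simp add: n_def)
          qed (simp add: mem_list_oracle ls)
          ultimately show ?thesis using x by simp
        qed
        moreover have "n + 4 < length v \<or> (v \<noteq> [] \<and> (hd v \<longleftrightarrow> listed (tl v) (encode_list zs)))" if "claim K v"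
          using that ls[of "tl v"] by (cases v) (auto simp: claim_def)
        ultimately show ?thesis
          by (simp add: E_def list_sim_def Let_def a_def n_def[symmetric])
      qed
      then show ?thesis by (auto simp: R_def)
    qed
    ultimately show "x \<in> {x. \<exists>a. length a \<le> poly q (length x) \<and> pair x a \<in> - R}" by auto
  qed
  ultimately show "L \<in> PH_rel K" unfolding PH_rel_def by blast
qed

section \<open>Sparse sets in the Ellentuck topology\<close>

text \<open>For a basic set the end of its stem is a suitable \<open>n\<close>, because shrinking
  \<open>K\<close> above the stem keeps it in the set. The property passes to intersections by
  taking the larger \<open>n\<close>, and to unions, hence to all open sets.\<close>

lemma openin_ellentuck_local:
  assumes "openin ellentuck U" "K \<in> U"
  shows "\<exists>n. \<forall>S. infinite S \<longrightarrow> S \<inter> {..<n} = K \<inter> {..<n} \<longrightarrow> S \<subseteq> K \<longrightarrow> S \<in> U"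
proof -
  have "generate_topology_on {ellentuck_basic a A |a A. finite a \<and> infinite A \<and> (\<forall>i \<in> A. stem_end a \<le> i)} U"
    using assms(1) unfolding ellentuck_def openin_topology_generated_by_iff .
  then show ?thesis using assms(2)
  proof (induction arbitrary: K rule: generate_topology_on.induct)
    case (Int a b)
    then have K: "K \<in> a" "K \<in> b" by auto
    obtain n where n: "\<And>S. infinite S \<Longrightarrow> S \<inter> {..<n} = K \<inter> {..<n} \<Longrightarrow> S \<subseteq> K \<Longrightarrow> S \<in> a"
      using Int.IH(1)[OF K(1)] by blast
    obtain m where m: "\<And>S. infinite S \<Longrightarrow> S \<inter> {..<m} = K \<inter> {..<m} \<Longrightarrow> S \<subseteq> K \<Longrightarrow> S \<in> b"
      using Int.IH(2)[OF K(2)] by blast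
    have cut: "S \<inter> {..<j} = K \<inter> {..<j}" if "S \<inter> {..<max n m} = K \<inter> {..<max n m}" "j \<le> max n m" for S j
    proof -
      have "S \<inter> {..<j} = (S \<inter> {..<max n m}) \<inter> {..<j}" using that(2) by auto
      also have "\<dots> = K \<inter> {..<j}" unfolding that(1) using that(2) by auto
      finally show ?thesis .
    qed
    show ?case
    proof (intro exI[of _ "max n m"] allI impI IntI)
      fix S assume S: "infinite S" "S \<inter> {..<max n m} = K \<inter> {..<max n m}" "S \<subseteq> K"
      show "S \<in> a" by (rule n[OF S(1) cut[OF S(2)] S(3)]) simp
      show "S \<in> b" by (rule m[OF S(1) cut[OF S(2)] S(3)]) simp
    qed
  next
    case (UN C)
    then obtain c where c: "c \<in> C" "K \<in> c" by auto
    from UN.IH[OF c] obtain n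
      where n: "\<forall>S. infinite S \<longrightarrow> S \<inter> {..<n} = K \<inter> {..<n} \<longrightarrow> S \<subseteq> K \<longrightarrow> S \<in> c" ..
    show ?case
      by (intro exI[of _ n] allI impI, rule UnionI[OF c(1)], rule n[rule_format])
  next
    case (Basis s)
    then obtain a A where s: "s = ellentuck_basic a A" by auto
    show ?case
      by (rule exI[of _ "stem_end a"]) (use Basis(2) in \<open>auto simp: s ellentuck_basic_def\<close>)
  qed simp
qed

text \<open>An open set \<open>U\<close> inside the closure of \<open>N\<close> would contain some
  \<open>K\<close>, and by \<open>openin_ellentuck_local\<close> also \<open>a \<union> B\<close>
  for an initial part \<open>a\<close> of \<open>K\<close> and a sparse
  \<open>B \<subseteq> K\<close>. All members of the neighbourhood \<open>[a, B]\<close> of this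
  point are sparse, so it misses \<open>N\<close>.\<close>

lemma non_sparse_nowhere_dense:
  assumes "N \<subseteq> {K. infinite K \<and> \<not> sparse K}"
  shows "nowhere_dense_in ellentuck N"
  unfolding nowhere_dense_in_def
proof
  show "N \<subseteq> topspace ellentuck" using assms by (auto simp: topspace_ellentuck)
  show "ellentuck interior_of (ellentuck closure_of N) = {}"
  proof (rule ccontr)
    assume "ellentuck interior_of (ellentuck closure_of N) \<noteq> {}"
    then obtain K U where U: "openin ellentuck U" "K \<in> U" "U \<subseteq> ellentuck closure_of N"
      by (auto simp: interior_of_def)
    obtain n where n: "\<And>S. infinite S \<Longrightarrow> S \<inter> {..<n} = K \<inter> {..<n} \<Longrightarrow> S \<subseteq> K \<Longrightarrow> S \<in> U"
      using openin_ellentuck_local[OF U(1,2)] by blast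
    have infK: "infinite K"
      using U(1,2) openin_subset topspace_ellentuck by blast
    define a where "a = K \<inter> {..<n}"
    have "K = a \<union> (K \<inter> {n..})" by (auto simp: a_def)
    then have "infinite (K \<inter> {n..})" using infK by (metis a_def finite_Int finite_Un finite_lessThan)
    then obtain B where B: "B \<subseteq> K \<inter> {n..}" "infinite B" "\<And>j. card (B \<inter> {..<2 ^ j}) \<le> j"
      using infinite_sparse_subset by blast
    have fa: "finite a" by (simp add: a_def)
    have "Max a < n" if "a \<noteq> {}" using Max_in[OF fa that] unfolding a_def by blast
    \<comment> \<open>\<open>B\<close> starts at \<open>n\<close> or later, hence above the stem, as
      a basic set requires.\<close>
    then have se: "stem_end a \<le> n" by (simp add: stem_end_def Suc_le_eq)
    define V where "V = ellentuck_basic a B"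
    have "openin ellentuck V"
      unfolding ellentuck_def V_def
      by (rule topology_generated_by_Basis) (use fa B se in fastforce)
    moreover have "a \<union> B \<in> V"
    proof -
      have "i < stem_end a" if "i \<in> a" for i
        using Max_ge[OF fa that] that by (auto simp: stem_end_def)
      then show ?thesis
        using B se by (force simp: V_def ellentuck_basic_def)
    qed
    moreover have "a \<union> B \<in> U"
      by (rule n) (use B in \<open>auto simp: a_def\<close>)
    ultimately obtain S where S: "S \<in> N" "S \<in> V"
      using U(3) in_closure_of[of "a \<union> B" ellentuck N] by blast
    \<comment> \<open>The finite stem contributes the additive constant in the definition of
      \<open>sparse\<close>.\<close>
    have "card (S \<inter> {..<2 ^ j}) \<le> j + card a" for j
    proof -
      have "S \<inter> {..<2 ^ j} \<subseteq> (B \<inter> {..<2 ^ j}) \<union> a" using S(2) by (auto simp: V_def ellentuck_basic_def)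
      then have "card (S \<inter> {..<2 ^ j}) \<le> card ((B \<inter> {..<2 ^ j}) \<union> a)" using fa by (intro card_mono) auto
      also have "\<dots> \<le> card (B \<inter> {..<2 ^ j}) + card a" by (rule card_Un_le)
      finally show ?thesis using B(3)[of j] by linarith
    qed
    then have "sparse S" unfolding sparse_def by blast
    with S(1) assms show False by blast
  qed
qed

theorem theorem3p9:
  assumes "ramsey_positive {K. infinite K \<and> PH_rel K \<noteq> PSPACE_rel K}"
  shows "\<not> PSPACE \<subseteq> PH"
proof
  assume PH: "PSPACE \<subseteq> PH"
  let ?S = "{K. infinite K \<and> PH_rel K \<noteq> PSPACE_rel K}"
  have "?S \<subseteq> {K. infinite K \<and> \<not> sparse K}"
    using PSPACE_rel_subset_PH_rel[OF PH] PH_rel_subset_PSPACE_rel by blast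
  then have "nowhere_dense_in ellentuck ?S" by (rule non_sparse_nowhere_dense)
  \<comment> \<open>Nowhere dense is more than needed: a family with one member witnesses that the
    set is meager.\<close>
  then have "ramsey_small ?S"
    unfolding ramsey_small_def meager_in_def by (intro exI[of _ "{?S}"]) simp
  with assms show False by (simp add: ramsey_positive_def)
qed

end
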